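(* Let $k,n$ be integers with $2\le k<\frac n2$, let $q=\frac{2n}{n-2k}$, and let $\Omega\subset\mathbb{H}^n$ be a bounded star-shaped domain with $C^1$ boundary. If $\lambda<0$, then the problem $$P_ku-\lambda u=|u|^{q-2}u\ \text{ on }\Omega,\qquad \nabla^\alpha_{\mathbb{H}^n}u\big|_{\partial\Omega}=0\ \text{ for }|\alpha|\le k-1$$ has no nontrivial solution in $C^{2k}(\overline\Omega)$.
   Context: $\mathbb{H}^n$ is the $n$-dimensional hyperbolic space, in the ball model: the unit ball $\mathbb{B}^n\subset\mathbb{R}^n$ with metric $\frac{4|dx|^2}{(1-|x|^2)^2}$, and hyperbolic gradient $\nabla_{\mathbb{H}^n}=\frac{1-|x|^2}{2}\nabla$. $\triangle_{\mathbb{H}^n}$ is the Laplace–Beltrami operator. The conformal Laplacian is $P_1=-\triangle_{\mathbb{H}^n}-\frac{n(n-2)}{4}$ and the GJMS operator of order $2k$ is $P_k=P_1(P_1+2)(P_1+6)\cdots(P_1+k(k-1))=\prod_{i=1}^k\bigl(P_1+i(i-1)\bigr)$. Star-shaped means: the inner product of the outer unit normal vector field of $\partial\Omega$ with $\frac{\partial}{\partial\rho}$ is positive, where $\rho$ denotes the geodesic distance from the origin of the ball model. The boundary condition says that all derivatives of $u$ of order at most $k-1$ vanish on $\partial\Omega$. Nontrivial means not identically zero; solutions are real-valued and may change sign. *)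

theory Defs
  imports "HOL-Analysis.Analysis"
begin

section \<open>Partial derivatives and the spaces of continuously differentiable functions\<close>

definition partial :: "'n \<Rightarrow> (real ^ 'n \<Rightarrow> real) \<Rightarrow> real ^ 'n \<Rightarrow> real" where
  "partial i f x = deriv (\<lambda>t. f (x + t *\<^sub>R axis i 1)) 0"

text \<open>
  Higher derivatives are indexed by words \<open>[i\<^sub>1, \<dots>, i\<^sub>m]\<close> in the coordinate directions,
  standing for \<open>\<partial>\<^sub>i\<^sub>1 \<dots> \<partial>\<^sub>i\<^sub>m\<close>. A function in \<open>C\<^sup>m\<close> of the closure is a function on
  the closure all of whose derivatives up to order \<open>m\<close> exist in the open set and extend
  continuously to the closure; its values off the closure are irrelevant.
\<close>
definition Cm_closure :: "nat \<Rightarrow> (real ^ 'n) set \<Rightarrow> (real ^ 'n \<Rightarrow> real) \<Rightarrow> bool" where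
  "Cm_closure m \<Omega> u \<longleftrightarrow>
     continuous_on (closure \<Omega>) u \<and>
     (\<forall>\<alpha>. length \<alpha> < m \<longrightarrow> (\<forall>x\<in>\<Omega>. foldr partial \<alpha> u differentiable at x)) \<and>
     (\<forall>\<alpha>. length \<alpha> \<le> m \<longrightarrow>
        (\<exists>g. continuous_on (closure \<Omega>) g \<and> (\<forall>x\<in>\<Omega>. g x = foldr partial \<alpha> u x)))"


section \<open>The ball model of hyperbolic space\<close>

definition hyp_metric :: "real ^ 'n \<Rightarrow> real ^ 'n ^ 'n" where
  "hyp_metric x = (4 / (1 - (norm x)\<^sup>2)\<^sup>2) *\<^sub>R mat 1"

definition hyp_inner :: "real ^ 'n \<Rightarrow> real ^ 'n \<Rightarrow> real ^ 'n \<Rightarrow> real" where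
  "hyp_inner x v w = v \<bullet> (hyp_metric x *v w)"

text \<open>The closed form of the geodesic distance of \<open>hyp_metric\<close> on the unit ball.\<close>
definition hyp_dist :: "real ^ 'n \<Rightarrow> real ^ 'n \<Rightarrow> real" where
  "hyp_dist x y = arcosh (1 + 2 * (norm (x - y))\<^sup>2 / ((1 - (norm x)\<^sup>2) * (1 - (norm y)\<^sup>2)))"

definition hyp_bounded :: "(real ^ 'n) set \<Rightarrow> bool" where
  "hyp_bounded \<Omega> \<longleftrightarrow> (\<exists>R. \<forall>x\<in>\<Omega>. \<forall>y\<in>\<Omega>. hyp_dist x y \<le> R)"

text \<open>Components of the hyperbolic gradient \<open>((1 - |x|\<^sup>2) / 2) \<nabla>\<close>.\<close>
definition hyp_partial :: "'n \<Rightarrow> (real ^ 'n \<Rightarrow> real) \<Rightarrow> real ^ 'n \<Rightarrow> real" where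
  "hyp_partial i f x = (1 - (norm x)\<^sup>2) / 2 * partial i f x"

text \<open>
  The coordinate field \<open>\<partial>/\<partial>\<rho>\<close> of geodesic polar coordinates at the origin (with the value \<open>0\<close> at
  the origin, where it is undefined); the next two lemmas state that it is the velocity of the
  radial rays parametrised by \<open>\<rho>\<close>.
\<close>
definition radial_field :: "real ^ 'n \<Rightarrow> real ^ 'n" where
  "radial_field x = ((1 - (norm x)\<^sup>2) / 2) *\<^sub>R sgn x"

lemma hyp_dist_ray:
  fixes v :: "real ^ 'n"
  assumes "norm v = 1" "t \<ge> 0"
  shows "hyp_dist 0 (tanh (t / 2) *\<^sub>R v) = t"
proof -
  let ?c = "cosh (t / 2)" and ?s = "sinh (t / 2)"
  have c: "?c > 0" by simp
  have "1 - (tanh (t / 2))\<^sup>2 = (?c\<^sup>2 - ?s\<^sup>2) / ?c\<^sup>2"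
    using c by (simp add: tanh_def power_divide diff_divide_distrib)
  also have "\<dots> = 1 / ?c\<^sup>2" by (simp add: cosh_square_eq)
  finally have "1 - (tanh (t / 2))\<^sup>2 = 1 / ?c\<^sup>2" .
  then have "1 + 2 * (tanh (t / 2))\<^sup>2 / (1 - (tanh (t / 2))\<^sup>2) = 1 + 2 * ?s\<^sup>2"
    using c by (simp add: tanh_def power_divide)
  also have "\<dots> = cosh (2 * (t / 2))"
    by (simp only: cosh_double cosh_square_eq)
  finally have "hyp_dist 0 (tanh (t / 2) *\<^sub>R v) = arcosh (cosh t)"
    using assms by (simp add: hyp_dist_def)
  then show ?thesis using assms by (simp add: arcosh_cosh_real)
qed

lemma radial_field_ray:
  fixes v :: "real ^ 'n"
  assumes "norm v = 1" "t > 0"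
  shows "((\<lambda>t. tanh (t / 2) *\<^sub>R v) has_vector_derivative
            radial_field (tanh (t / 2) *\<^sub>R v)) (at t)"
proof -
  have c: "cosh (t / 2) \<noteq> 0" by simp
  have "((\<lambda>t. tanh (t / 2)) has_real_derivative (1 - (tanh (t / 2))\<^sup>2) / 2) (at t)"
    using c by (auto intro!: derivative_eq_intros)
  moreover have "radial_field (tanh (t / 2) *\<^sub>R v) = ((1 - (tanh (t / 2))\<^sup>2) / 2) *\<^sub>R v"
    using assms by (simp add: radial_field_def sgn_scaleR sgn_div_norm[of v])
  ultimately show ?thesis
    by (auto intro!: derivative_eq_intros simp: has_real_derivative_iff_has_vector_derivative)
qed


section \<open>Laplace--Beltrami and GJMS operators\<close>

definition laplace_beltrami ::
    "(real ^ 'n \<Rightarrow> real ^ 'n ^ 'n) \<Rightarrow> (real ^ 'n \<Rightarrow> real) \<Rightarrow> real ^ 'n \<Rightarrow> real" where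
  "laplace_beltrami g u x =
     (1 / sqrt (det (g x))) *
     (\<Sum>i\<in>UNIV. partial i
        (\<lambda>y. sqrt (det (g y)) * (\<Sum>j\<in>UNIV. matrix_inv (g y) $ i $ j * partial j u y)) x)"

definition conformal_laplacian :: "(real ^ 'n \<Rightarrow> real) \<Rightarrow> real ^ 'n \<Rightarrow> real" where
  "conformal_laplacian u x =
     - laplace_beltrami hyp_metric u x - real CARD('n) * (real CARD('n) - 2) / 4 * u x"

primrec gjms :: "nat \<Rightarrow> (real ^ 'n \<Rightarrow> real) \<Rightarrow> real ^ 'n \<Rightarrow> real" where
  "gjms 0 u = u"
| "gjms (Suc k) u =
     gjms k (\<lambda>x. conformal_laplacian u x + real (Suc k) * (real (Suc k) - 1) * u x)"


section \<open>Domains with continuously differentiable boundary, star-shapedness\<close>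

text \<open>\<open>\<phi>\<close> is a \<open>C\<^sup>1\<close> defining function of \<open>\<Omega>\<close> near \<open>x\<close>, with gradient \<open>D\<close>.\<close>
definition C1_defining ::
    "(real ^ 'n) set \<Rightarrow> real ^ 'n \<Rightarrow> (real ^ 'n \<Rightarrow> real) \<Rightarrow> (real ^ 'n \<Rightarrow> real ^ 'n) \<Rightarrow> bool" where
  "C1_defining \<Omega> x \<phi> D \<longleftrightarrow>
     (\<exists>r>0. (\<forall>y\<in>ball x r. GDERIV \<phi> y :> D y) \<and> continuous_on (ball x r) D \<and>
        \<Omega> \<inter> ball x r = {y \<in> ball x r. \<phi> y < 0} \<and>
        frontier \<Omega> \<inter> ball x r = {y \<in> ball x r. \<phi> y = 0}) \<and>
     D x \<noteq> 0"

definition C1_boundary :: "(real ^ 'n) set \<Rightarrow> bool" where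
  "C1_boundary \<Omega> \<longleftrightarrow> (\<forall>x\<in>frontier \<Omega>. \<exists>\<phi> D. C1_defining \<Omega> x \<phi> D)"

text \<open>
  The outer unit normal with respect to the hyperbolic metric. The metric is conformal to the
  Euclidean one, so its direction is that of the Euclidean gradient of a defining function.
\<close>
definition outer_unit_normal :: "(real ^ 'n) set \<Rightarrow> real ^ 'n \<Rightarrow> real ^ 'n \<Rightarrow> bool" where
  "outer_unit_normal \<Omega> x \<nu> \<longleftrightarrow>
     hyp_inner x \<nu> \<nu> = 1 \<and> (\<exists>\<phi> D c. C1_defining \<Omega> x \<phi> D \<and> c > 0 \<and> \<nu> = c *\<^sub>R D x)"

definition star_shaped :: "(real ^ 'n) set \<Rightarrow> bool" where
  "star_shaped \<Omega> \<longleftrightarrow>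
     (\<forall>x\<in>frontier \<Omega>. \<forall>\<nu>. outer_unit_normal \<Omega> x \<nu> \<longrightarrow> hyp_inner x \<nu> (radial_field x) > 0)"

end

theory Submission
  imports Defs
begin

text \<open>
  With \<open>rho = (1 - |x|\<^sup>2) / 2\<close> and \<open>v = rho\<^bsup>k - n/2\<^esup> u\<close>, conformal covariance turns the
  equation into \<open>(- \<Delta>)\<^sup>k v = h\<close> with \<open>h = lam rho\<^bsup>- 2k\<^esup> v + |v|\<^bsup>q - 2\<^esup> v\<close> on a
  Euclidean domain that is star-shaped about \<open>0\<close>. The dilates \<open>v\<^sub>t(x) = v(t x)\<close> with \<open>t > 1\<close> are
  compactly supported in \<open>\<Omega>\<close>, so the Dirichlet form \<open>B\<close> of order \<open>k\<close> satisfies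
  \<open>\<integral> v\<^sub>t h = B(v\<^sub>t, v) \<le> (B(v\<^sub>t, v\<^sub>t) + B(v, v)) / 2 \<le> (t\<^bsup>2k - n\<^esup> + 1) / 2 \<cdot> \<integral> v h\<close>,
  with equality at \<open>t = 1\<close>. Comparing right derivatives at \<open>t = 1\<close> gives Pohozaev's inequality
  \<open>\<integral> (x \<cdot> \<nabla>v) h \<le> (2k - n) / 2 \<cdot> \<integral> v h\<close> without any integral over the boundary.
  Since \<open>q\<close> is critical, the terms \<open>|v|\<^sup>q\<close> cancel, and what is left forces \<open>v = 0\<close> when \<open>lam < 0\<close>.
\<close>

section \<open>Partial derivatives\<close>

text \<open>The exponent \<open>k - n/2\<close> satisfies
  \<open>(k - n/2) * (q - 2) = - 2 * k\<close>. Hence the power nonlinearity passes to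
  \<open>v\<close> without a weight, and only the linear term carries one. That weight does not
  decrease along rays, so its Euler derivative is nonnegative and adds to the quadratic term that
  survives the cancellation; this fixes the sign of \<open>lam\<close>. The obstacle is the
  boundary: it is only C^1, and derivatives of \<open>v\<close> of order \<open>k\<close> and higher
  need not vanish there. For \<open>t > 1\<close> the boundary zeros of the dilate are moved
  strictly inside, so all \<open>k\<close> integrations by parts take place on a compact part of the
  domain, where the other factor \<open>v\<close> has the \<open>2 * k\<close> derivatives required.
  For \<open>t < 1\<close> the dilate would reach beyond the domain; therefore only a right
  derivative at \<open>1\<close> is available, and an inequality results. Even the energy identity
  at \<open>t = 1\<close> is obtained as a limit from \<open>t > 1\<close>. The power
  \<open>2k - n\<close> of \<open>t\<close> is the scaling of a form with \<open>k\<close>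
  derivatives on each factor in dimension \<open>n\<close>.\<close>

lemma partial_eqI:
  assumes "(f has_derivative f') (at x)"
  shows "partial i f x = f' (axis i 1)"
proof -
  have line: "((\<lambda>t. x + t *\<^sub>R axis i 1) has_derivative (\<lambda>t. t *\<^sub>R axis i 1)) (at 0)"
    by (auto intro!: derivative_eq_intros)
  have "((\<lambda>t. f (x + t *\<^sub>R axis i 1)) has_derivative (\<lambda>t. f' (t *\<^sub>R axis i 1))) (at 0)"
    using has_derivative_compose[OF line, of f f'] assms by simp
  moreover have "f' (t *\<^sub>R axis i 1) = f' (axis i 1) * t" for t
    using assms by (simp add: has_derivative_def linear_simps)
  ultimately have "((\<lambda>t. f (x + t *\<^sub>R axis i 1)) has_real_derivative f' (axis i 1)) (at 0)"
    by (simp add: has_field_derivative_def)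
  then show ?thesis
    unfolding partial_def by (rule DERIV_imp_deriv)
qed

lemma has_derivative_partial:
  assumes "f differentiable (at x)"
  shows "(f has_derivative (\<lambda>y. \<Sum>i\<in>UNIV. y $ i * partial i f x)) (at x)"
proof -
  obtain f' where f': "(f has_derivative f') (at x)"
    using assms by (auto simp: differentiable_def)
  have "f' y = (\<Sum>i\<in>UNIV. y $ i * partial i f x)" for y
  proof -
    have lin: "linear f'"
      using f' by (rule has_derivative_linear)
    have "f' y = f' (\<Sum>i\<in>UNIV. (y $ i) *\<^sub>R axis i 1)"
      using basis_expansion[of y] by (simp add: scalar_mult_eq_scaleR)
    also have "\<dots> = (\<Sum>i\<in>UNIV. y $ i * f' (axis i 1))"
      using lin by (simp add: linear_sum linear_cmul o_def)
    finally show ?thesis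
      using partial_eqI[OF f'] by simp
  qed
  then have "f' = (\<lambda>y. \<Sum>i\<in>UNIV. y $ i * partial i f x)"
    by auto
  then show ?thesis
    using f' by simp
qed

lemma partial_line_derivative:
  assumes "f differentiable (at (x + s *\<^sub>R axis i 1))"
  shows "((\<lambda>t. f (x + t *\<^sub>R axis i 1)) has_real_derivative partial i f (x + s *\<^sub>R axis i 1)) (at s)"
proof -
  let ?p = "x + s *\<^sub>R axis i 1"
  have line: "((\<lambda>t. x + t *\<^sub>R axis i 1) has_derivative (\<lambda>t. t *\<^sub>R axis i 1)) (at s)"
    by (auto intro!: derivative_eq_intros)
  have "((\<lambda>t. f (x + t *\<^sub>R axis i 1)) has_derivative
          (\<lambda>t. \<Sum>j\<in>UNIV. (t *\<^sub>R axis i 1) $ j * partial j f ?p)) (at s)"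
    using has_derivative_compose[OF line has_derivative_partial[OF assms]] by simp
  moreover have "(\<Sum>j\<in>UNIV. (t *\<^sub>R axis i 1) $ j * partial j f ?p) = partial i f ?p * t" for t
    by (simp add: axis_def if_distrib if_distribR cong: if_cong)
  ultimately show ?thesis
    by (simp add: has_field_derivative_def)
qed

text \<open>The line derivative at \<open>x\<close> sees only values near \<open>x\<close>. Since
  functions are controlled on an open set alone, identities between them are differentiated through
  this local form.\<close>

lemma partial_cong:
  assumes "open S" "x \<in> S" "\<And>y. y \<in> S \<Longrightarrow> f y = g y"
  shows "partial i f x = partial i g x"
  unfolding partial_def
proof (rule deriv_cong_ev)
  have "open ((\<lambda>t. x + t *\<^sub>R axis i 1) -` S)"
    by (intro open_vimage assms(1) continuous_intros)
  then have "eventually (\<lambda>t. x + t *\<^sub>R axis i 1 \<in> S) (nhds 0)"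
    using assms(2) by (auto simp: eventually_nhds intro!: exI[of _ "(\<lambda>t. x + t *\<^sub>R axis i 1) -` S"])
  then show "eventually (\<lambda>t. f (x + t *\<^sub>R axis i 1) = g (x + t *\<^sub>R axis i 1)) (nhds 0)"
    by eventually_elim (use assms(3) in auto)
qed simp

lemma differentiable_cong_open:
  assumes "open S" "x \<in> S" "\<And>y. y \<in> S \<Longrightarrow> f y = g y" "f differentiable (at x)"
  shows "g differentiable (at x)"
  using assms by (meson differentiable_def has_derivative_transform_within_open)

lemma partial_const [simp]: "partial i (\<lambda>x. c) x = 0"
  by (simp add: partial_def)

lemma partial_component: "partial i (\<lambda>x. x $ j) x = (if i = j then 1 else 0)"
  by (subst partial_eqI[where f' = "\<lambda>y. y $ j"])
     (auto intro!: derivative_eq_intros simp: axis_def bounded_linear_imp_has_derivative bounded_linear_vec_nth)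

lemma partial_add:
  assumes "f differentiable (at x)" "g differentiable (at x)"
  shows "partial i (\<lambda>x. f x + g x) x = partial i f x + partial i g x"
proof -
  obtain f' g' where d: "(f has_derivative f') (at x)" "(g has_derivative g') (at x)"
    using assms by (auto simp: differentiable_def)
  show ?thesis
    using partial_eqI[OF d(1)] partial_eqI[OF d(2)] partial_eqI[OF has_derivative_add[OF d]] by simp
qed

lemma partial_mult:
  assumes "f differentiable (at x)" "g differentiable (at x)"
  shows "partial i (\<lambda>x. f x * g x) x = partial i f x * g x + f x * partial i g x"
proof -
  obtain f' g' where d: "(f has_derivative f') (at x)" "(g has_derivative g') (at x)"
    using assms by (auto simp: differentiable_def)
  show ?thesis
    using partial_eqI[OF d(1)] partial_eqI[OF d(2)] partial_eqI[OF has_derivative_mult[OF d]] by simp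
qed

lemma partial_cmult:
  assumes "f differentiable (at x)"
  shows "partial i (\<lambda>x. c * f x) x = c * partial i f x"
  using partial_mult[of "\<lambda>x. c" x f i] assms by simp

lemma partial_sum:
  assumes "finite I" "\<And>j. j \<in> I \<Longrightarrow> f j differentiable (at x)"
  shows "partial i (\<lambda>x. \<Sum>j\<in>I. f j x) x = (\<Sum>j\<in>I. partial i (f j) x)"
  using assms
proof (induction I rule: finite_induct)
  case (insert j I)
  then show ?case
    by (simp add: partial_add differentiable_sum)
qed simp

lemma partial_chain:
  assumes "f differentiable (at x)" "(\<phi> has_real_derivative d) (at (f x))"
  shows "partial i (\<lambda>x. \<phi> (f x)) x = d * partial i f x"
    and "(\<lambda>x. \<phi> (f x)) differentiable (at x)"
proof -
  obtain f' where f': "(f has_derivative f') (at x)"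
    using assms by (auto simp: differentiable_def)
  have d: "((\<lambda>x. \<phi> (f x)) has_derivative (\<lambda>y. d * f' y)) (at x)"
    using has_derivative_compose[OF f', of \<phi> "(*) d"] assms(2) by (simp add: has_field_derivative_def)
  show "partial i (\<lambda>x. \<phi> (f x)) x = d * partial i f x"
    using partial_eqI[OF f'] partial_eqI[OF d] by simp
  show "(\<lambda>x. \<phi> (f x)) differentiable (at x)"
    using d by (auto simp: differentiable_def)
qed

text \<open>The mean value theorem is applied twice: to the increment \<open>G\<close> of
  \<open>f\<close> over a step in direction \<open>j\<close>, viewed as a function of the position
  along direction \<open>i\<close>, and then to \<open>partial i f\<close> in direction
  \<open>j\<close>. The point found lies in the parallelogram with sides of length \<open>h\<close>
  at \<open>x\<close>, whence the bound \<open>2 * h\<close>.\<close>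

lemma second_difference:
  fixes f :: "real ^ 'n \<Rightarrow> real"
  assumes "h > 0" "ball x r \<subseteq> S" "2 * h < r"
    and "\<And>y. y \<in> S \<Longrightarrow> f differentiable (at y)" "\<And>y. y \<in> S \<Longrightarrow> partial i f differentiable (at y)"
  shows "\<exists>y. dist x y \<le> 2 * h \<and>
    f (x + h *\<^sub>R axis i 1 + h *\<^sub>R axis j 1) - f (x + h *\<^sub>R axis i 1) - f (x + h *\<^sub>R axis j 1) + f x
      = h\<^sup>2 * partial j (partial i f) y"
proof -
  let ?e = "axis i 1 :: real ^ 'n" and ?d = "axis j 1 :: real ^ 'n"
  have near: "norm (s *\<^sub>R ?e + t *\<^sub>R ?d) \<le> 2 * h" if "0 \<le> s" "s \<le> h" "0 \<le> t" "t \<le> h" for s t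
    using norm_triangle_ineq[of "s *\<^sub>R ?e" "t *\<^sub>R ?d"] that by simp
  have mem: "x + s *\<^sub>R ?e + t *\<^sub>R ?d \<in> S" if "0 \<le> s" "s \<le> h" "0 \<le> t" "t \<le> h" for s t
  proof -
    have "x + s *\<^sub>R ?e + t *\<^sub>R ?d \<in> ball x r"
      using near[OF that] assms(3) by (simp add: dist_norm norm_minus_commute algebra_simps)
    then show ?thesis
      using assms(2) by auto
  qed
  define G where "G s = f ((x + h *\<^sub>R ?d) + s *\<^sub>R ?e) - f (x + s *\<^sub>R ?e)" for s
  have "\<exists>\<xi>. 0 < \<xi> \<and> \<xi> < h \<and> G h - G 0 =
      (h - 0) * (partial i f ((x + h *\<^sub>R ?d) + \<xi> *\<^sub>R ?e) - partial i f (x + \<xi> *\<^sub>R ?e))"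
  proof (rule MVT2[OF assms(1)])
    fix s assume s: "0 \<le> s" "s \<le> h"
    show "(G has_real_derivative
       (partial i f ((x + h *\<^sub>R ?d) + s *\<^sub>R ?e) - partial i f (x + s *\<^sub>R ?e))) (at s)"
      unfolding G_def
      by (intro DERIV_diff partial_line_derivative assms(4))
         (use mem[of s h] mem[of s 0] s assms(1) in \<open>simp_all add: algebra_simps\<close>)
  qed
  then obtain \<xi> where \<xi>: "0 < \<xi>" "\<xi> < h" "G h - G 0 =
      h * (partial i f ((x + h *\<^sub>R ?d) + \<xi> *\<^sub>R ?e) - partial i f (x + \<xi> *\<^sub>R ?e))"
    by auto
  have "\<exists>\<eta>. 0 < \<eta> \<and> \<eta> < h \<and>
      partial i f ((x + \<xi> *\<^sub>R ?e) + h *\<^sub>R ?d) - partial i f ((x + \<xi> *\<^sub>R ?e) + 0 *\<^sub>R ?d) =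
      (h - 0) * partial j (partial i f) ((x + \<xi> *\<^sub>R ?e) + \<eta> *\<^sub>R ?d)"
    by (rule MVT2[OF assms(1)], intro partial_line_derivative assms(5))
       (use mem[of \<xi>] \<xi> in auto)
  then obtain \<eta> where \<eta>: "0 < \<eta>" "\<eta> < h"
      "partial i f ((x + \<xi> *\<^sub>R ?e) + h *\<^sub>R ?d) - partial i f (x + \<xi> *\<^sub>R ?e) =
      h * partial j (partial i f) ((x + \<xi> *\<^sub>R ?e) + \<eta> *\<^sub>R ?d)"
    by auto
  have dist_add: "dist x (x + w) = norm w" for w :: "real ^ 'n"
    by (simp add: dist_norm)
  show ?thesis
  proof (intro exI conjI)
    have "dist x (x + (\<xi> *\<^sub>R ?e + \<eta> *\<^sub>R ?d)) \<le> 2 * h"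
      using near[of \<xi> \<eta>] \<xi>(1,2) \<eta>(1,2) by (simp add: dist_add)
    then show "dist x ((x + \<xi> *\<^sub>R ?e) + \<eta> *\<^sub>R ?d) \<le> 2 * h"
      by (simp add: add.assoc)
    have "G h - G 0 = h * (h * partial j (partial i f) ((x + \<xi> *\<^sub>R ?e) + \<eta> *\<^sub>R ?d))"
      using \<xi>(3) \<eta>(3) by (simp add: algebra_simps)
    then show "f (x + h *\<^sub>R ?e + h *\<^sub>R ?d) - f (x + h *\<^sub>R ?e) - f (x + h *\<^sub>R ?d) + f x =
        h\<^sup>2 * partial j (partial i f) ((x + \<xi> *\<^sub>R ?e) + \<eta> *\<^sub>R ?d)"
      by (simp add: G_def power2_eq_square algebra_simps)
  qed
qed

text \<open>Schwarz's theorem. The second difference quotient is symmetric in the two directions, so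
  it equals either mixed derivative at a point near \<open>x\<close>; continuity makes both of them
  its limit.\<close>

lemma partial_commute:
  fixes f :: "real ^ 'n \<Rightarrow> real"
  assumes S: "open S" "x \<in> S"
    and f: "\<And>y. y \<in> S \<Longrightarrow> f differentiable (at y)"
      "\<And>y. y \<in> S \<Longrightarrow> partial i f differentiable (at y)" "\<And>y. y \<in> S \<Longrightarrow> partial j f differentiable (at y)"
    and c: "continuous_on S (partial j (partial i f))" "continuous_on S (partial i (partial j f))"
  shows "partial i (partial j f) x = partial j (partial i f) x"
proof -
  obtain r where r: "r > 0" "ball x r \<subseteq> S"
    using S by (auto simp: open_contains_ball)
  \<comment> \<open>The factor \<open>r / 4\<close> keeps \<open>2 * h n\<close> at most
    \<open>r / 2\<close>, hence inside the ball.\<close>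
  define h where "h n = r / 4 * inverse (real (Suc n))" for n
  have h: "h n > 0" "2 * h n < r" for n
  proof -
    have "inverse (real (Suc n)) \<le> 1"
      by (rule inverse_le_1_iff[THEN iffD2]) simp
    then have "r / 4 * inverse (real (Suc n)) \<le> r / 4 * 1"
      using r(1) by (intro mult_left_mono) auto
    then show "h n > 0" "2 * h n < r"
      using r(1) by (simp_all only: h_def) simp_all
  qed
  have h0: "(\<lambda>n. 2 * h n) \<longlonglongrightarrow> 0"
    unfolding h_def by (intro tendsto_mult_right_zero LIMSEQ_inverse_real_of_nat)
  define D where "D n = (f (x + h n *\<^sub>R axis i 1 + h n *\<^sub>R axis j 1) - f (x + h n *\<^sub>R axis i 1) -
      f (x + h n *\<^sub>R axis j 1) + f x) / (h n)\<^sup>2" for n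
  have "\<exists>y. dist x y \<le> 2 * h n \<and> D n = partial j (partial i f) y" for n
    using second_difference[OF h(1) r(2) h(2) f(1,2), of n j] h(1)[of n] by (force simp: D_def)
  then obtain y where y: "\<And>n. dist x (y n) \<le> 2 * h n" "\<And>n. D n = partial j (partial i f) (y n)"
    by metis
  have "D n = (f (x + h n *\<^sub>R axis j 1 + h n *\<^sub>R axis i 1) - f (x + h n *\<^sub>R axis j 1) -
      f (x + h n *\<^sub>R axis i 1) + f x) / (h n)\<^sup>2" for n
    by (simp add: D_def algebra_simps)
  then have "\<exists>y. dist x y \<le> 2 * h n \<and> D n = partial i (partial j f) y" for n
    using second_difference[OF h(1) r(2) h(2) f(1,3), of n i] h(1)[of n]
by force
  then obtain z where z: "\<And>n. dist x (z n) \<le> 2 * h n" "\<And>n. D n = partial i (partial j f) (z n)"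
    by metis
  have lim: "(\<lambda>n. g (w n)) \<longlonglongrightarrow> g x" if "\<And>n. dist x (w n) \<le> 2 * h n" "continuous_on S g"
    for w :: "nat \<Rightarrow> real ^ 'n" and g :: "real ^ 'n \<Rightarrow> real"
  proof -
    have "(\<lambda>n. dist (w n) x) \<longlonglongrightarrow> 0"
      using that(1) by (intro Lim_null_comparison[OF _ h0]) (simp add: dist_commute)
    then have "w \<longlonglongrightarrow> x"
      by (subst tendsto_dist_iff)
    moreover have "isCont g x"
      using that(2) S by (simp add: continuous_on_eq_continuous_at)
    ultimately show ?thesis
      by (intro isCont_tendsto_compose[of x g w])
  qed
  have "D = (\<lambda>n. partial j (partial i f) (y n))" "D = (\<lambda>n. partial i (partial j f) (z n))"
    using y(2) z(2) by blast+
  then have "D \<longlonglongrightarrow> partial j (partial i f) x" "D \<longlonglongrightarrow> partial i (partial j f) x"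
    using lim[of y, OF y(1) c(1)] lim[of z, OF z(1) c(2)] by simp_all
  then show ?thesis
    by (intro LIMSEQ_unique)
qed

section \<open>Functions with bounded derivatives\<close>

text \<open>Bounded functions become integrable when extended by zero from a bounded open set, and
  bounds survive restriction to smaller sets. Full differentiability is demanded at each order below
  \<open>m\<close>, because \<open>partial\<close> alone records only the behaviour along coordinate
  lines.\<close>

primrec Cb :: "nat \<Rightarrow> (real ^ 'n) set \<Rightarrow> (real ^ 'n \<Rightarrow> real) \<Rightarrow> bool" where
  "Cb 0 S f \<longleftrightarrow> continuous_on S f \<and> bounded (f ` S)"
| "Cb (Suc m) S f \<longleftrightarrow> continuous_on S f \<and> bounded (f ` S) \<and>
     (\<forall>x\<in>S. f differentiable (at x)) \<and> (\<forall>i. Cb m S (partial i f))"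

lemma Cb_continuous: "Cb m S f \<Longrightarrow> continuous_on S f"
  by (cases m) auto

lemma Cb_bounded: "Cb m S f \<Longrightarrow> bounded (f ` S)"
  by (cases m) auto

lemma Cb_bound:
  assumes "Cb m S f"
  obtains B where "B \<ge> 0" "\<And>x. x \<in> S \<Longrightarrow> \<bar>f x\<bar> \<le> B"
proof -
  obtain B where "B > 0" "\<forall>y\<in>f ` S. norm y \<le> B"
    using Cb_bounded[OF assms] by (auto simp: bounded_pos)
  then show ?thesis
    using that[of B] by auto
qed

lemma Cb_differentiable: "Cb (Suc m) S f \<Longrightarrow> x \<in> S \<Longrightarrow> f differentiable (at x)"
  by simp

lemma Cb_partial: "Cb (Suc m) S f \<Longrightarrow> Cb m S (partial i f)"
  by simp

lemma Cb_Suc_imp: "Cb (Suc m) S f \<Longrightarrow> Cb m S f"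
  by (induction m arbitrary: f) auto

lemma Cb_mono: "Cb m S f \<Longrightarrow> l \<le> m \<Longrightarrow> Cb l S f"
  by (induction m) (auto simp: le_Suc_eq simp del: Cb.simps dest: Cb_Suc_imp)

lemma Cb_subset: "Cb m S f \<Longrightarrow> T \<subseteq> S \<Longrightarrow> Cb m T f"
  by (induction m arbitrary: f) (auto intro: continuous_on_subset bounded_subset)

lemma Cb_cong:
  assumes "open S" "Cb m S f" "\<And>x. x \<in> S \<Longrightarrow> f x = g x"
  shows "Cb m S g"
  using assms(2,3)
proof (induction m arbitrary: f g)
  case 0
  then show ?case
    by (metis (no_types, lifting) Cb.simps(1) continuous_on_cong image_cong)
next
  case (Suc m)
  have "Cb m S (partial i g)" for i
    using Suc.IH[of "partial i f" "partial i g"] Suc.prems partial_cong[OF assms(1), of _ f g i] by simp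
  moreover have "g differentiable (at x)" if "x \<in> S" for x
    using differentiable_cong_open[OF assms(1) that] Suc.prems that by auto
  moreover have "continuous_on S g" "bounded (g ` S)"
    using Suc.prems by (auto cong: continuous_on_cong image_cong)
  ultimately show ?case
    by simp
qed

section \<open>Algebra of functions with bounded derivatives\<close>

lemma bounded_image_add:
  fixes f g :: "'a \<Rightarrow> real"
  assumes "bounded (f ` S)" "bounded (g ` S)"
  shows "bounded ((\<lambda>x. f x + g x) ` S)"
  using bounded_plus_comp[OF assms] .

lemma bounded_image_mult:
  fixes f g :: "'a \<Rightarrow> real"
  assumes "bounded (f ` S)" "bounded (g ` S)"
  shows "bounded ((\<lambda>x. f x * g x) ` S)"
proof -
  obtain B C where "\<And>x. x \<in> S \<Longrightarrow> \<bar>f x\<bar> \<le> B" "\<And>x. x \<in> S \<Longrightarrow> \<bar>g x\<bar> \<le> C"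
    using assms by (auto simp: bounded_iff)
  then have "\<bar>f x * g x\<bar> \<le> B * C" if "x \<in> S" for x
    using that unfolding abs_mult by (intro mult_mono) (auto intro: order_trans[OF abs_ge_zero])
  then show ?thesis
    by (auto simp: bounded_iff)
qed

lemma Cb_const [simp]: "open S \<Longrightarrow> Cb m S (\<lambda>x. c)"
proof (induction m arbitrary: c)
  case (Suc m)
  have "Cb m S (partial i (\<lambda>x. c))" for i
    by (rule Cb_cong[OF Suc.prems Suc.IH[OF Suc.prems, of 0]]) simp
  then show ?case
    by (simp add: image_constant_conv)
qed (simp add: image_constant_conv)

lemma Cb_add:
  assumes "open S" "Cb m S f" "Cb m S g"
  shows "Cb m S (\<lambda>x. f x + g x)"
  using assms(2,3)
proof (induction m arbitrary: f g)
  case (Suc m)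
  have "Cb m S (partial i (\<lambda>x. f x + g x))" for i
    by (rule Cb_cong[OF assms(1) Suc.IH[of "partial i f" "partial i g"]])
       (use Suc.prems in \<open>auto simp: partial_add\<close>)
  then show ?case
    using Suc.prems by (auto intro: continuous_on_add bounded_image_add)
qed (auto intro: continuous_on_add bounded_image_add)

lemma Cb_mult:
  assumes "open S" "Cb m S f" "Cb m S g"
  shows "Cb m S (\<lambda>x. f x * g x)"
  using assms(2,3)
proof (induction m arbitrary: f g)
  case (Suc m)
  have "Cb m S (partial i (\<lambda>x. f x * g x))" for i
    by (rule Cb_cong[OF assms(1) Cb_add[OF assms(1) Suc.IH[of "partial i f" g] Suc.IH[of f "partial i g"]]])
       (use Suc.prems in \<open>simp_all add: partial_mult Cb_Suc_imp[of m] Cb_partial[of m] Cb_differentiable[of m] del: Cb.simps(2)\<close>)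
  then show ?case
    using Suc.prems by (auto intro: continuous_on_mult bounded_image_mult)
qed (auto intro: continuous_on_mult bounded_image_mult)

lemma Cb_cmult:
  assumes "open S" "Cb m S f"
  shows "Cb m S (\<lambda>x. c * f x)"
  using Cb_mult[OF assms(1) Cb_const[OF assms(1)] assms(2)] .

lemma Cb_sum:
  assumes "open S" "\<And>i. i \<in> I \<Longrightarrow> Cb m S (f i)"
  shows "Cb m S (\<lambda>x. \<Sum>i\<in>I. f i x)"
  using assms(2)
proof (induction I rule: infinite_finite_induct)
  case (insert i I)
  then show ?case
    by (simp add: Cb_add[OF assms(1)])
qed (use assms(1) in simp_all)

lemma Cb_component:
  assumes "open S" "bounded S"
  shows "Cb m S (\<lambda>x. x $ j)"
proof (cases m)
  case 0
  then show ?thesis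
    using bounded_component_cart[OF assms(2)] by (simp add: continuous_on_component)
next
  case (Suc l)
  have "Cb l S (partial i (\<lambda>x. x $ j))" for i
    by (rule Cb_cong[OF assms(1) Cb_const[OF assms(1), of l "if i = j then 1 else 0"]])
       (simp add: partial_component)
  then show ?thesis
    using bounded_component_cart[OF assms(2)] Suc
    by (auto intro!: continuous_on_component bounded_linear_imp_differentiable bounded_linear_vec_nth)
qed

text \<open>\<open>foldr\<close> applies the last letter of a word first. The words of
  \<open>partial i f\<close> are thus the words of \<open>f\<close> ending in \<open>i\<close>,
  which matches the recursion of \<open>Cb\<close>.\<close>

lemma Cb_from_words:
  assumes "\<And>\<alpha> :: 'n::finite list. length \<alpha> < m \<Longrightarrow> \<forall>x\<in>S. foldr partial \<alpha> f differentiable (at x)"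
    and "\<And>\<alpha> :: 'n list. length \<alpha> \<le> m \<Longrightarrow> continuous_on S (foldr partial \<alpha> f) \<and> bounded (foldr partial \<alpha> f ` S)"
  shows "Cb m S f"
  using assms
proof (induction m arbitrary: f)
  case 0
  then show ?case
    using "0.prems"(2)[of "[]"] by simp
next
  case (Suc m)
  have "Cb m S (partial i f)" for i
    by (rule Suc.IH) (use Suc.prems(1)[of "_ @ [i]"] Suc.prems(2)[of "_ @ [i]"] in auto)
  then show ?case
    using Suc.prems(1)[of "[]"] Suc.prems(2)[of "[]"] by simp
qed

text \<open>Each derivative extends continuously to the compact closure, where the extension is
  bounded. Of the extensions only this bound is kept.\<close>

lemma Cm_closure_imp_Cb:
  fixes \<Omega> :: "(real ^ 'n) set"
  assumes "bounded \<Omega>" "Cm_closure m \<Omega> u"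
  shows "Cb m \<Omega> u"
proof (rule Cb_from_words)
  fix \<alpha> :: "'n list"
  assume "length \<alpha> \<le> m"
  then obtain g where g: "continuous_on (closure \<Omega>) g" "\<forall>x\<in>\<Omega>. g x = foldr partial \<alpha> u x"
    using assms(2) by (auto simp: Cm_closure_def)
  have "bounded (g ` closure \<Omega>)"
    using assms(1) g(1) by (simp add: compact_continuous_image compact_imp_bounded)
  then have "bounded (g ` \<Omega>)" "continuous_on \<Omega> g"
    using g(1) closure_subset by (auto intro: bounded_subset continuous_on_subset)
  then show "continuous_on \<Omega> (foldr partial \<alpha> u) \<and> bounded (foldr partial \<alpha> u ` \<Omega>)"
    using g(2) by (auto cong: continuous_on_cong image_cong)
qed (use assms(2) in \<open>auto simp: Cm_closure_def\<close>)

text \<open>The index counts orders: \<open>vanishing m\<close> concerns the derivatives of orders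
  \<open>0\<close> to \<open>m - 1\<close>, so \<open>vanishing k\<close> is the boundary condition
  of the problem. It is phrased by limits from within \<open>S\<close>, since \<open>partial\<close>
  says nothing about \<open>S\<close> at or beyond the frontier.\<close>

primrec vanishing :: "nat \<Rightarrow> (real ^ 'n) set \<Rightarrow> (real ^ 'n \<Rightarrow> real) \<Rightarrow> bool" where
  "vanishing 0 S f \<longleftrightarrow> True"
| "vanishing (Suc m) S f \<longleftrightarrow> (\<forall>x\<in>frontier S. (f \<longlongrightarrow> 0) (at x within S)) \<and>
     (\<forall>i. vanishing m S (partial i f))"

lemma vanishing_mono_Suc: "vanishing (Suc m) S f \<Longrightarrow> vanishing m S f"
  by (induction m arbitrary: f) auto

lemma tendsto_within_cong:
  assumes "(f \<longlongrightarrow> l) (at x within S)" "\<And>y. y \<in> S \<Longrightarrow> f y = g y"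
  shows "(g \<longlongrightarrow> l) (at x within S)"
  using assms(1) by (rule Lim_transform_eventually) (use assms(2) in \<open>auto simp: eventually_at_filter\<close>)

lemma vanishing_cong:
  assumes "open S" "vanishing m S f" "\<And>x. x \<in> S \<Longrightarrow> f x = g x"
  shows "vanishing m S g"
  using assms(2,3)
proof (induction m arbitrary: f g)
  case (Suc m)
  have "vanishing m S (partial i g)" for i
    using Suc.IH[of "partial i f" "partial i g"] Suc.prems partial_cong[OF assms(1), of _ f g i] by simp
  moreover have "(g \<longlongrightarrow> 0) (at x within S)" if "x \<in> frontier S" for x
    using Suc.prems that by (auto intro: tendsto_within_cong)
  ultimately show ?case
    by simp
qed simp

lemma vanishing_add:
  assumes "open S" "Cb m S f" "Cb m S g" "vanishing m S f" "vanishing m S g"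
  shows "vanishing m S (\<lambda>x. f x + g x)"
  using assms(2-)
proof (induction m arbitrary: f g)
  case (Suc m)
  have "vanishing m S (partial i (\<lambda>x. f x + g x))" for i
    by (rule vanishing_cong[OF assms(1) Suc.IH[of "partial i f" "partial i g"]])
       (use Suc.prems in \<open>auto simp: partial_add\<close>)
  moreover have "((\<lambda>x. f x + g x) \<longlongrightarrow> 0) (at x within S)" if "x \<in> frontier S" for x
    using tendsto_add[of f 0 "at x within S" g 0] Suc.prems that by simp
  ultimately show ?case
    by simp
qed simp

text \<open>By the product rule each derivative of order below \<open>m\<close> is a sum of terms
  that contain such a derivative of \<open>g\<close>, which tends to \<open>0\<close>, and a bounded
  derivative of \<open>f\<close>.\<close>

lemma vanishing_mult:
  assumes "open S" "Cb m S f" "Cb m S g" "vanishing m S g"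
  shows "vanishing m S (\<lambda>x. f x * g x)"
  using assms(2-)
proof (induction m arbitrary: f g)
  case (Suc m)
  note [simp del] = Cb.simps(2)
  have reg: "Cb m S f" "Cb m S g" "Cb m S (partial i f)" "Cb m S (partial i g)" "vanishing m S g"
    "vanishing m S (partial i g)" for i
    using Suc.prems(1,2) Cb_Suc_imp Cb_partial vanishing_mono_Suc[OF Suc.prems(3)] Suc.prems(3) by auto
  have "vanishing m S (partial i (\<lambda>x. f x * g x))" for i
    by (rule vanishing_cong[OF assms(1) vanishing_add[OF assms(1) _ _ Suc.IH[of "partial i f" g] Suc.IH[of f "partial i g"]]])
       (use reg Suc.prems in \<open>simp_all add: partial_mult Cb_mult[OF assms(1)] Cb_differentiable[of m]\<close>)
  moreover have "((\<lambda>x. f x * g x) \<longlongrightarrow> 0) (at x within S)" if x: "x \<in> frontier S" for x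
  proof -
    obtain B where B: "\<And>x. x \<in> S \<Longrightarrow> \<bar>f x\<bar> \<le> B"
      using Cb_bound[OF reg(1)] by metis
    have "Bfun f (at x within S)"
      by (rule BfunI[of _ B]) (use B in \<open>auto simp: eventually_at_filter\<close>)
    then show ?thesis
      using x Suc.prems(3) bounded_bilinear.Bfun_prod_Zfun[OF bounded_bilinear_mult, of f "at x within S" g]
      by (simp add: tendsto_Zfun_iff)
  qed
  ultimately show ?case
    by simp
qed simp

text \<open>\<open>hyp_partial i f\<close> is \<open>partial i f\<close> times the conformal weight,
  and \<open>w\<close> is the inverse of that weight. Multiplication by \<open>w\<close> preserves
  vanishing, so the condition on hyperbolic derivatives passes to Euclidean ones, order by
  order.\<close>

lemma vanishing_from_hyp_partial:
  fixes f :: "real ^ 'n \<Rightarrow> real"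
  assumes S: "open S" and w: "\<And>l. Cb l S w" "\<And>x. x \<in> S \<Longrightarrow> w x * ((1 - (norm x)\<^sup>2) / 2) = 1"
    and \<rho>: "\<And>l. Cb l S (\<lambda>x. (1 - (norm x)\<^sup>2) / 2)"
    and f: "Cb m S f"
    and van: "\<And>\<alpha> :: 'n list. length \<alpha> < m \<Longrightarrow>
       \<forall>x\<in>frontier S. (foldr hyp_partial \<alpha> f \<longlongrightarrow> 0) (at x within S)"
  shows "vanishing m S f"
  using f van
proof (induction m arbitrary: f)
  case (Suc m)
  have "vanishing m S (partial i f)" for i
  proof -
    have "Cb m S (hyp_partial i f)"
      using Cb_mult[OF S \<rho>, of m "partial i f"] Suc.prems(1) by (simp add: hyp_partial_def[abs_def])
    moreover from this have "vanishing m S (hyp_partial i f)"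
      by (rule Suc.IH) (use Suc.prems(2)[of "_ @ [i]"] in auto)
    ultimately have "vanishing m S (\<lambda>x. w x * hyp_partial i f x)"
      by (intro vanishing_mult S w)
    then show ?thesis
    proof (rule vanishing_cong[OF S])
      fix x assume "x \<in> S"
      then show "w x * hyp_partial i f x = partial i f x"
        using w(2)[of x] by (simp add: hyp_partial_def flip: mult.assoc)
    qed
  qed
  then show ?case
    using Suc.prems(2)[of "[]"] by simp
qed simp

section \<open>Conformal covariance of the GJMS operators\<close>

definition lap :: "(real ^ 'n \<Rightarrow> real) \<Rightarrow> real ^ 'n \<Rightarrow> real" where
  "lap f x = (\<Sum>i\<in>UNIV. partial i (partial i f) x)"

text \<open>The generator of dilations: the derivative of \<open>f (t x)\<close> in \<open>t\<close>
  at \<open>t = 1\<close>.\<close>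

definition euler :: "(real ^ 'n \<Rightarrow> real) \<Rightarrow> real ^ 'n \<Rightarrow> real" where
  "euler f x = (\<Sum>i\<in>UNIV. x $ i * partial i f x)"

text \<open>The reciprocal conformal factor: \<open>hyp_metric x\<close> is
  \<open>1 / (rho x)\<^sup>2\<close> times the identity matrix.\<close>

definition rho :: "real ^ 'n \<Rightarrow> real" where
  "rho x = (1 - (norm x)\<^sup>2) / 2"

lemma lap_cong:
  assumes "open S" "x \<in> S" "\<And>y. y \<in> S \<Longrightarrow> f y = g y"
  shows "lap f x = lap g x"
proof -
  have "partial i (partial i f) x = partial i (partial i g) x" for i
    by (intro partial_cong[OF assms(1)] assms(2,3))
  then show ?thesis
    by (simp add: lap_def)
qed

lemma lap_iter_cong:
  assumes "open S" "\<And>y. y \<in> S \<Longrightarrow> f y = g y" "x \<in> S"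
  shows "(lap ^^ m) f x = (lap ^^ m) g x"
  using assms(3)
proof (induction m arbitrary: x)
  case (Suc m)
  then show ?case
    using lap_cong[OF assms(1) Suc.prems Suc.IH] by simp
qed (use assms in simp)

lemma Cb_lap:
  assumes "open S" "Cb (m + 2) S f"
  shows "Cb m S (lap f)"
  unfolding lap_def[abs_def]
  using assms by (intro Cb_sum) (auto simp: numeral_2_eq_2)

lemma Cb_lap_iter:
  assumes "open S" "Cb (l + 2 * m) S f"
  shows "Cb l S ((lap ^^ m) f)"
  using assms(2)
proof (induction m arbitrary: l)
  case (Suc m)
  then show ?case
    using Cb_lap[OF assms(1), of l] Suc.IH[of "l + 2"] by simp
qed simp

lemma Cb_euler:
  assumes "open S" "bounded S" "Cb (Suc m) S f"
  shows "Cb m S (euler f)"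
  unfolding euler_def[abs_def]
  using assms by (intro Cb_sum Cb_mult Cb_component) auto

lemma lap_add:
  assumes "open S" "Cb 2 S f" "Cb 2 S g" "x \<in> S"
  shows "lap (\<lambda>x. f x + g x) x = lap f x + lap g x"
proof -
  have 1: "partial i (\<lambda>x. f x + g x) y = partial i f y + partial i g y" if "y \<in> S" for y i
    using assms that by (simp add: partial_add numeral_2_eq_2)
  have "partial i (partial i (\<lambda>x. f x + g x)) x = partial i (partial i f) x + partial i (partial i g) x" for i
    using partial_cong[OF assms(1,4), OF 1] assms by (simp add: partial_add numeral_2_eq_2)
  then show ?thesis
    by (simp add: lap_def sum.distrib)
qed

lemma lap_mult:
  assumes "open S" "Cb 2 S f" "Cb 2 S g" "x \<in> S"
  shows "lap (\<lambda>x. f x * g x) x =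
    lap f x * g x + 2 * (\<Sum>i\<in>UNIV. partial i f x * partial i g x) + f x * lap g x"
proof -
  have 1: "partial i (\<lambda>x. f x * g x) y = partial i f y * g y + f y * partial i g y" if "y \<in> S" for y i
    using assms that by (simp add: partial_mult numeral_2_eq_2)
  have "partial i (partial i (\<lambda>x. f x * g x)) x =
      partial i (partial i f) x * g x + 2 * (partial i f x * partial i g x) + f x * partial i (partial i g) x" for i
    using partial_cong[OF assms(1,4), OF 1] assms
    by (simp add: partial_add partial_mult numeral_2_eq_2 differentiable_mult)
  then show ?thesis
    by (simp add: lap_def sum.distrib sum_distrib_left sum_distrib_right)
qed

lemma lap_cmult:
  assumes "open S" "Cb 2 S f" "x \<in> S"
  shows "lap (\<lambda>x. c * f x) x = c * lap f x"
  using lap_mult[OF assms(1) _ assms(2,3), of "\<lambda>x. c"] assms(1)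
  by (simp add: lap_def partial_const[abs_def])

lemma lap_iter_cmult:
  assumes "open S" "Cb (2 * m) S f" "x \<in> S"
  shows "(lap ^^ m) (\<lambda>x. c * f x) x = c * (lap ^^ m) f x"
  using assms(2,3)
proof (induction m arbitrary: x)
  case (Suc m)
  have m: "Cb (2 * m) S f" "Cb 2 S ((lap ^^ m) f)"
    using Suc.prems Cb_mono[of "2 * Suc m" S f "2 * m"] Cb_lap_iter[OF assms(1), of 2 m f] by simp_all
  show ?case
    using lap_cong[OF assms(1) Suc.prems(2) Suc.IH[OF m(1)]] lap_cmult[OF assms(1) m(2) Suc.prems(2)] by simp
qed simp

section \<open>Commutation of partial derivatives, Laplacian and Euler field\<close>

lemma partial_commute_Cb:
  assumes "open S" "Cb 2 S f" "x \<in> S"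
  shows "partial i (partial j f) x = partial j (partial i f) x"
  using assms by (intro partial_commute[OF assms(1,3)]) (auto simp: numeral_2_eq_2)

lemma partial_lap:
  assumes "open S" "Cb 3 S f" "x \<in> S"
  shows "partial i (lap f) x = lap (partial i f) x"
proof -
  have reg: "Cb 2 S (partial j f)" "Cb 2 S f" for j
    using assms(2) Cb_partial[of 2] Cb_Suc_imp[of 2] by simp_all
  have "partial i (lap f) x = (\<Sum>j\<in>UNIV. partial i (partial j (partial j f)) x)"
    unfolding lap_def[abs_def] using assms by (subst partial_sum) (auto simp: numeral_3_eq_3)
  also have "\<dots> = (\<Sum>j\<in>UNIV. partial j (partial i (partial j f)) x)"
    using partial_commute_Cb[OF assms(1) reg(1) assms(3)] by simp
  also have "\<dots> = (\<Sum>j\<in>UNIV. partial j (partial j (partial i f)) x)"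
    by (intro sum.cong refl partial_cong[OF assms(1,3)] partial_commute_Cb[OF assms(1) reg(2)])
  finally show ?thesis
    by (simp add: lap_def)
qed

text \<open>In \<open>dform_lap_iter\<close> this lets the derivative left over from an integration
  by parts pass through the remaining Laplacians.\<close>

lemma partial_lap_iter:
  assumes "open S" "Cb (2 * m + 1) S f" "x \<in> S"
  shows "partial i ((lap ^^ m) f) x = (lap ^^ m) (partial i f) x"
  using assms(2,3)
proof (induction m arbitrary: x)
  case (Suc m)
  have m: "Cb (2 * m + 1) S f" "Cb 3 S ((lap ^^ m) f)"
    using Suc.prems Cb_mono[of "2 * Suc m + 1" S f "2 * m + 1"] Cb_lap_iter[OF assms(1), of 3 m f]
    by (simp_all add: eval_nat_numeral add.commute del: Cb.simps)
  show ?case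
    using partial_lap[OF assms(1) m(2) Suc.prems(2)] lap_cong[OF assms(1) Suc.prems(2) Suc.IH[OF m(1)]] by simp
qed simp

text \<open>The extra term arises when the derivative falls on the coefficient \<open>x $ i\<close>
  of the Euler field.\<close>

lemma partial_euler:
  assumes "open S" "Cb 2 S f" "x \<in> S"
  shows "partial i (euler f) x = partial i f x + euler (partial i f) x"
proof -
  have reg: "partial j f differentiable (at x)" for j
    using assms by (simp add: numeral_2_eq_2)
  have c: "(\<lambda>x. x $ j) differentiable (at x)" for j
    by (intro bounded_linear_imp_differentiable bounded_linear_vec_nth)
  have "partial i (euler f) x = (\<Sum>j\<in>UNIV. (if i = j then 1 else 0) * partial j f x + x $ j * partial i (partial j f) x)"
    unfolding euler_def[abs_def]
    by (subst partial_sum) (simp_all add: reg c partial_mult partial_component)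
  also have "\<dots> = partial i f x + (\<Sum>j\<in>UNIV. x $ j * partial j (partial i f) x)"
    using partial_commute_Cb[OF assms, of i]
    by (simp add: sum.distrib if_distrib[of "\<lambda>c. c * _"] cong: if_cong)
  finally show ?thesis
    by (simp add: euler_def)
qed

text \<open>Each of the two derivatives in \<open>partial i (partial i f)\<close> contributes one
  commutator from \<open>partial_euler\<close>, hence the factor 2.\<close>

lemma lap_euler:
  assumes "open S" "bounded S" "Cb 3 S f" "x \<in> S"
  shows "lap (euler f) x = 2 * lap f x + euler (lap f) x"
proof -
  have reg: "Cb 2 S f" "Cb 2 S (partial i f)" "Cb 1 S (euler (partial i f))" for i
    using assms(3) Cb_Suc_imp[of 2] Cb_partial[of 2] Cb_euler[OF assms(1,2), of 1]
    by (simp_all add: numeral_3_eq_3 numeral_2_eq_2)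
  have "partial i (partial i (euler f)) x = 2 * partial i (partial i f) x + euler (partial i (partial i f)) x" for i
  proof -
    have "partial i (partial i (euler f)) x = partial i (\<lambda>y. partial i f y + euler (partial i f) y) x"
      by (rule partial_cong[OF assms(1,4) partial_euler[OF assms(1) reg(1)]])
    also have "\<dots> = partial i (partial i f) x + partial i (euler (partial i f)) x"
      using reg(2,3)[of i] assms(4) by (intro partial_add) (auto simp: numeral_2_eq_2)
    finally show ?thesis
      using partial_euler[OF assms(1) reg(2) assms(4)] by simp
  qed
  moreover have "euler (lap f) x = (\<Sum>i\<in>UNIV. euler (partial i (partial i f)) x)"
  proof -
    have "partial j (lap f) x = (\<Sum>i\<in>UNIV. partial j (partial i (partial i f)) x)" for j
      unfolding lap_def[abs_def] using assms by (subst partial_sum) (auto simp: numeral_3_eq_3)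
    then show ?thesis
      unfolding euler_def by (simp add: sum_distrib_left) (rule sum.swap)
  qed
  ultimately show ?thesis
    by (simp add: lap_def sum.distrib sum_distrib_left)
qed

section \<open>Derivatives of the conformal factor\<close>

lemma sum_component_sq: "(\<Sum>i\<in>UNIV. x $ i * x $ i) = (norm x)\<^sup>2" for x :: "real ^ 'n"
  by (simp add: power2_norm_eq_inner inner_vec_def)

lemma Cb_rho:
  assumes "open S" "bounded S"
  shows "Cb m S rho"
proof (rule Cb_cong[OF assms(1)])
  show "Cb m S (\<lambda>x. 1 / 2 + (\<Sum>i\<in>UNIV. (- 1 / 2) * (x $ i * x $ i)))"
    by (intro Cb_add Cb_const Cb_sum Cb_mult Cb_component assms)
  show "1 / 2 + (\<Sum>i\<in>UNIV. (- 1 / 2) * (x $ i * x $ i)) = rho x" for x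
    using sum_component_sq[of x] by (simp add: rho_def sum_negf flip: sum_divide_distrib)
qed

lemma rho_has_derivative: "(rho has_derivative (\<lambda>y. - (x \<bullet> y))) (at x)"
  unfolding rho_def[abs_def] power2_norm_eq_inner
  by (auto intro!: derivative_eq_intros simp: inner_commute)

lemma rho_differentiable: "rho differentiable (at x)"
  using rho_has_derivative by (auto simp: differentiable_def)

lemma partial_rho: "partial i rho x = - (x $ i)"
  using partial_eqI[OF rho_has_derivative] by (simp add: inner_axis)

lemma lap_rho: "lap rho x = - real CARD('n)" for x :: "real ^ 'n"
proof -
  have c: "(\<lambda>x. x $ i) differentiable (at x)" for i
    by (intro bounded_linear_imp_differentiable bounded_linear_vec_nth)
  have "partial i (partial i rho) x = - 1" for i
    using partial_cmult[OF c, of i "- 1"] by (simp add: partial_rho[abs_def] partial_component)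
  then show ?thesis
    by (simp add: lap_def)
qed

lemma lap_rho_mult:
  fixes g :: "real ^ 'n \<Rightarrow> real"
  assumes "open S" "bounded S" "Cb 2 S g" "x \<in> S"
  shows "lap (\<lambda>x. rho x * g x) x = rho x * lap g x - real CARD('n) * g x - 2 * euler g x"
  using lap_mult[OF assms(1) Cb_rho[OF assms(1,2)] assms(3,4)]
  by (simp add: lap_rho partial_rho euler_def sum_negf)

text \<open>
  The induction rests on \<open>[\<Delta>, rho] = - n - 2 E\<close> and \<open>[\<Delta>, E] = 2 \<Delta>\<close>, where \<open>E\<close> is the Euler field.
\<close>
lemma rho_lap_iter:
  fixes g :: "real ^ 'n \<Rightarrow> real"
  assumes S: "open S" "bounded S" and "Cb (2 * m + 2) S g" "x \<in> S"
  shows "rho x * (lap ^^ Suc m) g x =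
    (lap ^^ m) (\<lambda>y. lap (\<lambda>z. rho z * g z) y
        + ((real m + 1) * real CARD('n) - 2 * real m * (real m + 1)) * g y
        + 2 * (real m + 1) * euler g y) x"
  using assms(3,4)
proof (induction m arbitrary: g x)
  case 0
  then show ?case
    using lap_rho_mult[OF S _ "0.prems"(2), of g] "0.prems"(1)
    by (simp add: numeral_2_eq_2 del: Cb.simps)
next
  case (Suc m)
  \<comment> \<open>The constant obeys \<open>?a (Suc m) = ?a m + ?n - 4 * (m + 1)\<close>: moving
    \<open>rho\<close> past one more Laplacian adds \<open>?n\<close> and twice the Euler field, and
    replacing \<open>euler (lap g)\<close> by \<open>lap (euler g) - 2 * lap g\<close> costs twice
    the coefficient \<open>2 * (m + 1)\<close>.\<close>
  let ?n = "real CARD('n)" and ?a = "\<lambda>m. (real m + 1) * real CARD('n) - 2 * real m * (real m + 1)"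
  have g4: "Cb 4 S g" and lapg: "Cb (2 * m + 2) S (lap g)"
    using Suc.prems(1) Cb_mono[of "2 * Suc m + 2" S g 4] Cb_lap[OF S(1), of "2 * m + 2" g] by simp_all
  have g3: "Cb 3 S g" and g2: "Cb 2 S g" and lapg2: "Cb 2 S (lap g)"
    using Cb_mono[OF g4, of 3] Cb_mono[OF g4, of 2] Cb_lap[OF S(1), of 2 g] g4 by simp_all
  have E2: "Cb 2 S (euler g)" and rg2: "Cb 2 S (lap (\<lambda>z. rho z * g z))"
    using g3 g4 by (auto intro!: Cb_euler Cb_lap Cb_mult Cb_rho S)
  have key: "lap (\<lambda>z. rho z * lap g z) y + ?a m * lap g y + 2 * (real m + 1) * euler (lap g) y =
      lap (\<lambda>y. lap (\<lambda>z. rho z * g z) y + ?a (Suc m) * g y + 2 * (real (Suc m) + 1) * euler g y) y"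
    if y: "y \<in> S" for y
  proof -
    have lin: "lap (\<lambda>y. lap (\<lambda>z. rho z * g z) y + a * g y + b * euler g y) y =
        lap (lap (\<lambda>z. rho z * g z)) y + a * lap g y + b * lap (euler g) y" for a b
      using y by (simp add: lap_add[OF S(1)] lap_cmult[OF S(1)] Cb_add Cb_cmult S g2 E2 rg2)
    have "lap (\<lambda>z. rho z * lap g z) y = lap (\<lambda>z. lap (\<lambda>z. rho z * g z) z + ?n * g z + 2 * euler g z) y"
      by (rule lap_cong[OF S(1) y]) (simp add: lap_rho_mult[OF S g2])
    also have "\<dots> = lap (lap (\<lambda>z. rho z * g z)) y + ?n * lap g y + 2 * lap (euler g) y"
      by (rule lin)
    finally show ?thesis
      unfolding lin lap_euler[OF S g3 y] by (simp add: algebra_simps)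
  qed
  have "rho x * (lap ^^ Suc (Suc m)) g x = rho x * (lap ^^ Suc m) (lap g) x"
    by (simp only: funpow_Suc_right o_apply)
  also have "\<dots> = (lap ^^ m) (\<lambda>y. lap (\<lambda>z. rho z * lap g z) y + ?a m * lap g y + 2 * (real m + 1) * euler (lap g) y) x"
    by (rule Suc.IH[OF lapg Suc.prems(2)])
  also have "\<dots> = (lap ^^ m) (lap (\<lambda>y. lap (\<lambda>z. rho z * g z) y + ?a (Suc m) * g y + 2 * (real (Suc m) + 1) * euler g y)) x"
    by (rule lap_iter_cong[OF S(1) key Suc.prems(2)])
  finally show ?case
    by (simp only: funpow_Suc_right o_apply)
qed

section \<open>Powers of the conformal factor\<close>

lemma rho_pos_iff: "rho x > 0 \<longleftrightarrow> x \<in> ball 0 1"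
  using abs_square_less_1[of "norm x"] by (simp add: rho_def)

lemma norm_sq_rho: "(norm x)\<^sup>2 = 1 - 2 * rho x"
  by (simp add: rho_def field_simps)

lemma partial_rho_powr:
  assumes "rho x > 0"
  shows "partial i (\<lambda>x. rho x powr a) x = - a * (rho x powr (a - 1) * x $ i)"
    and "(\<lambda>x. rho x powr a) differentiable (at x)"
  using partial_chain[OF rho_differentiable has_real_derivative_powr[OF assms]] by (simp_all add: partial_rho)

text \<open>On the compact ball of radius \<open>r < 1\<close> the function \<open>rho\<close> is
  bounded away from \<open>0\<close>, so all its real powers are bounded there. A derivative lowers
  the exponent and produces a coordinate factor, hence the induction runs over all exponents at
  once.\<close>

lemma Cb_rho_powr:
  fixes S :: "(real ^ 'n) set"
  assumes "open S" "S \<subseteq> cball 0 r" "r < 1"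
  shows "Cb m S (\<lambda>x. rho x powr a)"
proof (induction m arbitrary: a)
  case base: 0
  have S: "bounded S"
    using assms(2) bounded_cball bounded_subset by blast
  have pos: "rho x > 0" if "x \<in> cball 0 r" for x :: "real ^ 'n"
    using that assms(3) by (simp add: rho_pos_iff)
  have "continuous_on UNIV (rho :: real ^ 'n \<Rightarrow> real)"
    unfolding rho_def[abs_def] by (intro continuous_intros) auto
  then have c: "continuous_on (cball 0 r) (\<lambda>x :: real ^ 'n. rho x powr a)"
    by (intro continuous_on_powr continuous_on_const) (use pos in \<open>force intro: continuous_on_subset\<close>)+
  then have "bounded ((\<lambda>x :: real ^ 'n. rho x powr a) ` cball 0 r)"
    by (simp add: compact_continuous_image compact_imp_bounded)
  then show ?case
    using c assms(2) by (auto intro: continuous_on_subset bounded_subset)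
next
  case (Suc m)
  have S: "bounded S" and pos: "\<And>x. x \<in> S \<Longrightarrow> rho x > 0"
    using assms(2,3) bounded_cball bounded_subset by (blast, force simp: rho_pos_iff)
  have "Cb m S (partial i (\<lambda>x. rho x powr a))" for i
  proof (rule Cb_cong[OF assms(1)])
    show "Cb m S (\<lambda>x. - a * (rho x powr (a - 1) * x $ i))"
      by (intro Cb_cmult Cb_mult Cb_component Suc.IH assms(1) S)
  qed (simp add: partial_rho_powr pos)
  then show ?case
    using Cb_continuous[OF Suc.IH] Cb_bounded[OF Suc.IH] by (auto simp: partial_rho_powr pos)
qed

text \<open>The Euclidean form of hyperbolic boundedness, obtained later from
  \<open>hyp_bounded_imp_cball\<close>. It keeps the region away from the unit sphere, where
  negative powers of \<open>rho\<close> blow up.\<close>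

locale hyp_region =
  fixes S :: "(real ^ 'n) set" and r :: real
  assumes S_open: "open S" and S_cball: "S \<subseteq> cball 0 r" and r_less_1: "r < 1"
begin

lemma S_bounded: "bounded S"
  using S_cball bounded_cball bounded_subset by blast

lemma rho_pos: "x \<in> S \<Longrightarrow> rho x > 0"
  using S_cball r_less_1 by (force simp: rho_pos_iff)

lemmas Cb_powr = Cb_rho_powr[OF S_open S_cball r_less_1]

lemma lap_rho_powr:
  assumes "x \<in> S"
  shows "lap (\<lambda>x. rho x powr a) x =
    a * (a - 1) * rho x powr (a - 2) * (norm x)\<^sup>2 - a * real CARD('n) * rho x powr (a - 1)"
proof -
  have c: "(\<lambda>x :: real ^ 'n. x $ i) differentiable (at x)" for i
    by (intro bounded_linear_imp_differentiable bounded_linear_vec_nth)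
  have "partial i (partial i (\<lambda>x. rho x powr a)) x =
      a * (a - 1) * rho x powr (a - 2) * (x $ i * x $ i) - a * rho x powr (a - 1)" for i
  proof -
    have "partial i (partial i (\<lambda>x. rho x powr a)) x = partial i (\<lambda>x. - a * (rho x powr (a - 1) * x $ i)) x"
      by (rule partial_cong[OF S_open assms]) (simp add: partial_rho_powr rho_pos)
    also have "\<dots> = - a * (- (a - 1) * (rho x powr (a - 1 - 1) * x $ i) * x $ i + rho x powr (a - 1))"
      using assms by (subst partial_cmult) (simp_all add: partial_mult partial_rho_powr rho_pos c partial_component)
    finally show ?thesis
      by (simp add: algebra_simps)
  qed
  then show ?thesis
    by (simp add: lap_def sum_subtractf flip: sum_distrib_left sum_component_sq)
qed

lemma sqrt_det_hyp_metric:
  assumes "x \<in> S"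
  shows "sqrt (det (hyp_metric x)) = rho x powr (- real CARD('n))"
proof -
  have "det (hyp_metric x) = (1 / (rho x)\<^sup>2) ^ CARD('n)"
    by (simp add: hyp_metric_def mat_def det_diagonal rho_def power_divide)
  also have "\<dots> = (rho x powr (- real CARD('n)))\<^sup>2"
    using rho_pos[OF assms]
    by (simp add: powr_minus powr_realpow power_divide power_inverse divide_inverse flip: power_mult)
      (simp add: mult.commute)
  finally show ?thesis
    by simp
qed

text \<open>\<open>matrix_inv\<close> chooses some two-sided inverse; associativity identifies it
  with the explicit one.\<close>

lemma matrix_inv_hyp_metric:
  assumes "x \<in> S"
  shows "matrix_inv (hyp_metric x) = (rho x)\<^sup>2 *\<^sub>R mat 1"
proof -
  have g: "hyp_metric x = (1 / (rho x)\<^sup>2) *\<^sub>R mat 1"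
    by (simp add: hyp_metric_def rho_def power_divide)
  have inv: "hyp_metric x ** ((rho x)\<^sup>2 *\<^sub>R mat 1) = mat 1" "((rho x)\<^sup>2 *\<^sub>R mat 1) ** hyp_metric x = mat 1"
    using rho_pos[OF assms] by (simp_all add: g matrix_scalar_ac flip: scalar_matrix_assoc)
  then have "hyp_metric x ** matrix_inv (hyp_metric x) = mat 1 \<and> matrix_inv (hyp_metric x) ** hyp_metric x = mat 1"
    unfolding matrix_inv_def by (intro someI_ex[of "\<lambda>B. hyp_metric x ** B = mat 1 \<and> B ** hyp_metric x = mat 1"]) blast
  then show ?thesis
    using inv by (metis matrix_mul_assoc matrix_mul_lid matrix_mul_rid)
qed

text \<open>With volume density \<open>rho\<close> to the power \<open>- n\<close> and inverse
  metric \<open>rho\<close> squared, the Laplace-Beltrami operator is the divergence of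
  \<open>rho\<close> to the power \<open>2 - n\<close> times the gradient, multiplied by
  \<open>rho\<close> to the power \<open>n\<close>. Differentiating the weight, with gradient
  \<open>- x\<close> of \<open>rho\<close>, produces the Euler term.\<close>

lemma conformal_laplacian_eq:
  assumes "Cb 2 S u" "x \<in> S"
  shows "conformal_laplacian u x =
    - (rho x)\<^sup>2 * lap u x - (real CARD('n) - 2) * rho x * euler u x
      - real CARD('n) * (real CARD('n) - 2) / 4 * u x"
proof -
  let ?n = "real CARD('n)"
  have inner: "sqrt (det (hyp_metric y)) * (\<Sum>j\<in>UNIV. matrix_inv (hyp_metric y) $ i $ j * partial j u y) =
      rho y powr (2 - ?n) * partial i u y" if "y \<in> S" for y i
  proof -
    have "(\<Sum>j\<in>UNIV. matrix_inv (hyp_metric y) $ i $ j * partial j u y) = (rho y)\<^sup>2 * partial i u y"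
      by (simp add: matrix_inv_hyp_metric[OF that] mat_def if_distrib[of "\<lambda>c. _ * c * _"] cong: if_cong)
    then show ?thesis
      using rho_pos[OF that]
      by (simp add: sqrt_det_hyp_metric[OF that] powr_diff powr_minus powr_numeral field_simps)
  qed
  have "partial i (\<lambda>y. sqrt (det (hyp_metric y)) * (\<Sum>j\<in>UNIV. matrix_inv (hyp_metric y) $ i $ j * partial j u y)) x
      = (?n - 2) * rho x powr (1 - ?n) * (x $ i * partial i u x) + rho x powr (2 - ?n) * partial i (partial i u) x" for i
  proof -
    have "partial i (\<lambda>y. rho y powr (2 - ?n) * partial i u y) x =
       - (2 - ?n) * (rho x powr (2 - ?n - 1) * x $ i) * partial i u x + rho x powr (2 - ?n) * partial i (partial i u) x"
      using assms by (subst partial_mult) (simp_all add: partial_rho_powr rho_pos numeral_2_eq_2)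
    then show ?thesis
      using partial_cong[OF S_open assms(2) inner] by (simp add: algebra_simps)
  qed
  then have "laplace_beltrami hyp_metric u x =
      rho x powr ?n * ((?n - 2) * rho x powr (1 - ?n) * euler u x + rho x powr (2 - ?n) * lap u x)"
    by (simp add: laplace_beltrami_def sqrt_det_hyp_metric[OF assms(2)] powr_minus_divide sum.distrib
        euler_def lap_def sum_distrib_left mult.assoc)
  also have "\<dots> = (?n - 2) * (rho x powr ?n * rho x powr (1 - ?n)) * euler u x
       + (rho x powr ?n * rho x powr (2 - ?n)) * lap u x"
    by (simp add: algebra_simps)
  also have "\<dots> = (?n - 2) * rho x * euler u x + (rho x)\<^sup>2 * lap u x"
    using rho_pos[OF assms(2)] by (simp flip: powr_add)
  finally show ?thesis
    by (simp add: conformal_laplacian_def)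
qed

text \<open>The induction peels off the innermost factor of \<open>gjms\<close>, which here is the
  last one of the product. By \<open>rho_lap_iter\<close>, multiplying by \<open>rho\<close>
  replaces one Laplacian by a second-order operator under the remaining \<open>k\<close>; applied to
  \<open>g\<close> this operator is, up to sign and a power of \<open>rho\<close>, exactly that
  factor applied to \<open>u\<close>, and the induction hypothesis applies to
  \<open>u'\<close>.\<close>

lemma gjms_conformal:
  assumes "Cb (2 * k) S u" "x \<in> S"
  shows "(lap ^^ k) (\<lambda>y. rho y powr (real k - real CARD('n) / 2) * u y) x =
    (- 1) ^ k * rho x powr (- real k - real CARD('n) / 2) * gjms k u x"
  using assms
proof (induction k arbitrary: u x)
  case (Suc k)
  let ?n = "real CARD('n)"
  define s where "s = real (Suc k) - ?n / 2"
  define g where "g y = rho y powr s * u y" for y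
  define u' where "u' y = conformal_laplacian u y + real (Suc k) * (real (Suc k) - 1) * u y" for y
  have u2: "Cb 2 S u" and uk: "Cb (2 * k) S u" and u2k: "Cb (2 * k + 2) S u"
    using Suc.prems(1) Cb_mono[OF Suc.prems(1), of 2] Cb_mono[OF Suc.prems(1), of "2 * k"]
    by (simp_all add: algebra_simps del: Cb.simps)
  have g2k: "Cb (2 * k + 2) S g" and g2: "Cb 2 S g"
    unfolding g_def by (intro Cb_mult S_open Cb_powr u2k u2)+
  have u'k: "Cb (2 * k) S u'"
  proof (rule Cb_cong[OF S_open])
    have "Cb (2 * k) S (euler u)"
      using u2k Cb_mono[of "2 * k + 2" S u "Suc (2 * k)"] by (intro Cb_euler S_open S_bounded) (simp del: Cb.simps)
    then show "Cb (2 * k) S (\<lambda>y. - 1 * (rho y * rho y * lap u y) + (2 - ?n) * (rho y * euler u y)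
        + (real (Suc k) * (real (Suc k) - 1) - ?n * (?n - 2) / 4) * u y)"
      by (intro Cb_add Cb_cmult Cb_mult S_open Cb_lap Cb_rho S_bounded u2k uk)
    show "- 1 * (rho y * rho y * lap u y) + (2 - ?n) * (rho y * euler u y)
        + (real (Suc k) * (real (Suc k) - 1) - ?n * (?n - 2) / 4) * u y = u' y" if "y \<in> S" for y
      unfolding u'_def conformal_laplacian_eq[OF u2 that] by (simp add: power2_eq_square algebra_simps)
  qed
  have bracket: "lap (\<lambda>z. rho z * g z) y + ((real k + 1) * ?n - 2 * real k * (real k + 1)) * g y
      + 2 * (real k + 1) * euler g y = - 1 * (rho y powr (real k - ?n / 2) * u' y)" if y: "y \<in> S" for y
  proof -
    define P where "P = rho y powr (s - 1)"
    have pos: "rho y > 0"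
      using rho_pos[OF y] .
    have p1: "rho y powr s = rho y * P" "rho y powr (s + 1) = (rho y)\<^sup>2 * P"
      using pos by (simp_all add: P_def powr_diff powr_add power2_eq_square)
    have k: "real k = s - 1 + ?n / 2"
      by (simp add: s_def)
    have "lap (\<lambda>z. rho z * g z) y = lap (\<lambda>z. rho z powr (s + 1) * u z) y"
      by (rule lap_cong[OF S_open y]) (use rho_pos in \<open>simp add: g_def powr_add less_imp_le\<close>)
    also have "\<dots> = lap (\<lambda>z. rho z powr (s + 1)) y * u y
        + 2 * (\<Sum>i\<in>UNIV. partial i (\<lambda>z. rho z powr (s + 1)) y * partial i u y) + rho y powr (s + 1) * lap u y"
      by (rule lap_mult[OF S_open Cb_powr u2 y])
    also have "(\<Sum>i\<in>UNIV. partial i (\<lambda>z. rho z powr (s + 1)) y * partial i u y) = - (s + 1) * rho y * P * euler u y"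
      by (simp add: partial_rho_powr pos p1 euler_def sum_distrib_left mult_ac)
    also have "lap (\<lambda>z. rho z powr (s + 1)) y = (s + 1) * s * P * (1 - 2 * rho y) - (s + 1) * ?n * (rho y * P)"
      unfolding lap_rho_powr[OF y] norm_sq_rho by (simp add: P_def[symmetric] p1)
    finally have L: "lap (\<lambda>z. rho z * g z) y =
        ((s + 1) * s * P * (1 - 2 * rho y) - (s + 1) * ?n * (rho y * P)) * u y
        + 2 * (- (s + 1) * rho y * P * euler u y) + (rho y)\<^sup>2 * P * lap u y"
      by (simp add: p1)
    have pg: "partial i g y = - s * (P * y $ i) * u y + rho y * P * partial i u y" for i
      unfolding g_def[abs_def] using u2 y
      by (subst partial_mult) (simp_all add: partial_rho_powr pos P_def[symmetric] p1 numeral_2_eq_2)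
    have "euler g y = (\<Sum>i\<in>UNIV. - s * P * u y * (y $ i * y $ i) + rho y * P * (y $ i * partial i u y))"
      unfolding euler_def pg by (intro sum.cong refl) (simp add: algebra_simps)
    also have "\<dots> = - s * P * u y * (1 - 2 * rho y) + rho y * P * euler u y"
      by (simp only: sum.distrib sum_component_sq norm_sq_rho euler_def flip: sum_distrib_left)
    finally have E: "euler g y = - s * P * u y * (1 - 2 * rho y) + rho y * P * euler u y" .
    have gy: "g y = rho y * P * u y"
      by (simp add: g_def p1)
    have Q: "rho y powr (real k - ?n / 2) = P"
      by (simp add: P_def s_def algebra_simps)
    \<comment> \<open>After substituting \<open>k = s - 1 + n/2\<close>, the multiples of
      \<open>rho * P * u\<close> cancel, the Euler terms add up to \<open>(n - 2) * rho * P\<close>,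
      and the coefficient of \<open>P * u\<close> is \<open>s * (1 - s - n)\<close>. The latter
      equals \<open>n * (n - 2) / 4 - k * (k + 1)\<close>, the negative of the constant in
      \<open>u'\<close>.\<close>
    show ?thesis
      unfolding L E Q unfolding gy u'_def conformal_laplacian_eq[OF u2 y] of_nat_Suc k
      by (simp add: field_simps power2_eq_square)
  qed
  have "rho x * (lap ^^ Suc k) g x = (lap ^^ k) (\<lambda>y. - 1 * (rho y powr (real k - ?n / 2) * u' y)) x"
    unfolding rho_lap_iter[OF S_open S_bounded g2k Suc.prems(2)]
    by (rule lap_iter_cong[OF S_open bracket Suc.prems(2)])
  also have "\<dots> = - 1 * (lap ^^ k) (\<lambda>y. rho y powr (real k - ?n / 2) * u' y) x"
    by (rule lap_iter_cmult[OF S_open _ Suc.prems(2)]) (intro Cb_mult Cb_powr u'k S_open)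
  also have "\<dots> = - 1 * ((- 1) ^ k * rho x powr (- real k - ?n / 2) * gjms k u' x)"
    by (simp only: Suc.IH[OF u'k Suc.prems(2)])
  also have "gjms k u' x = gjms (Suc k) u x"
    by (simp add: u'_def[abs_def])
  finally have "rho x * (lap ^^ Suc k) g x = (- 1) ^ Suc k * rho x powr (- real k - ?n / 2) * gjms (Suc k) u x"
    by simp
  moreover have "rho x powr (- real k - ?n / 2) = rho x * rho x powr (- real (Suc k) - ?n / 2)"
    using powr_mult_base[of "rho x" "- real (Suc k) - ?n / 2"] rho_pos[OF Suc.prems(2)] by simp
  ultimately have "rho x * (lap ^^ Suc k) g x =
      rho x * ((- 1) ^ Suc k * rho x powr (- real (Suc k) - ?n / 2) * gjms (Suc k) u x)"
    by (simp only: mult_ac)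
  then show ?case
    using rho_pos[OF Suc.prems(2)] unfolding g_def[abs_def] s_def by (subst (asm) mult_left_cancel) auto
qed (use rho_pos in \<open>simp add: powr_minus\<close>)

end

section \<open>Extension by zero and integration by parts\<close>

text \<open>Integrals over a domain are written as integrals of extensions over the whole space, so
  that translations and dilations act on the integrand alone.\<close>

definition zero_ext :: "'a set \<Rightarrow> ('a \<Rightarrow> real) \<Rightarrow> 'a \<Rightarrow> real" where
  "zero_ext S f x = (if x \<in> S then f x else 0)"

lemma zero_ext_measurable:
  fixes S :: "'a::topological_space set"
  assumes "open S" "continuous_on S f"
  shows "zero_ext S f \<in> borel_measurable borel"
  unfolding zero_ext_def[abs_def]
  using assms by (intro borel_measurable_continuous_on_if) (auto intro: continuous_on_const)

lemma zero_ext_integrable: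
  fixes S :: "'a::euclidean_space set"
  assumes "open S" "bounded S" "continuous_on S f" "bounded (f ` S)"
  shows "integrable lborel (zero_ext S f)"
proof -
  obtain B where B: "\<And>x. x \<in> S \<Longrightarrow> \<bar>f x\<bar> \<le> B"
    using assms(4) by (auto simp: bounded_iff)
  have "integrable lborel (\<lambda>x. B * indicator S x)"
    using assms(1) emeasure_bounded_finite[OF assms(2)] by (intro integrable_mult_right integrable_real_indicator) auto
  then show ?thesis
  proof (rule Bochner_Integration.integrable_bound)
    show "zero_ext S f \<in> borel_measurable lborel"
      using zero_ext_measurable[OF assms(1,3)] by simp
    have "norm (zero_ext S f x) \<le> norm (B * indicator S x)" for x
      using B[of x] by (cases "x \<in> S") (simp_all add: zero_ext_def)
    then show "AE x in lborel. norm (zero_ext S f x) \<le> norm (B * indicator S x)"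
      by simp
  qed
qed

lemma Cb_zero_ext_integrable:
  fixes S :: "(real ^ 'n) set"
  assumes "open S" "bounded S" "Cb m S f"
  shows "integrable lborel (zero_ext S f)"
  using zero_ext_integrable[OF assms(1,2) Cb_continuous[OF assms(3)] Cb_bounded[OF assms(3)]] .

lemma integral_zero_ext_cong:
  assumes "\<And>x. x \<in> S \<Longrightarrow> f x = g x"
  shows "integral\<^sup>L M (zero_ext S f) = integral\<^sup>L M (zero_ext S g)"
  by (intro Bochner_Integration.integral_cong refl) (auto simp: zero_ext_def assms)

lemma integral_zero_ext_sum:
  fixes S :: "(real ^ 'n) set"
  assumes "open S" "bounded S" "\<And>i. i \<in> I \<Longrightarrow> Cb 0 S (f i)"
  shows "(\<integral>x. zero_ext S (\<lambda>x. \<Sum>i\<in>I. f i x) x \<partial>lborel) = (\<Sum>i\<in>I. \<integral>x. zero_ext S (f i) x \<partial>lborel)"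
proof -
  have "zero_ext S (\<lambda>x. \<Sum>i\<in>I. f i x) x = (\<Sum>i\<in>I. zero_ext S (f i) x)" for x
    by (simp add: zero_ext_def)
  then show ?thesis
    using Cb_zero_ext_integrable[OF assms] by simp
qed

lemma zero_ext_has_derivative:
  assumes "open S" "f differentiable (at x)" "x \<in> S"
  shows "(zero_ext S f has_derivative (\<lambda>y. \<Sum>i\<in>UNIV. y $ i * partial i f x)) (at x)"
  using has_derivative_partial[OF assms(2)] assms(1,3)
  by (rule has_derivative_transform_within_open) (simp add: zero_ext_def)

text \<open>\<open>S\<close> need not be convex, so the mean value bound is available only along
  segments inside \<open>S\<close>. The constant is the sum of the bounds on the partial
  derivatives.\<close>

lemma Cb_segment_lipschitz:
  fixes S :: "(real ^ 'n) set"
  assumes "Cb 1 S a"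
  obtains L where "L \<ge> 0" "\<And>x y. closed_segment x y \<subseteq> S \<Longrightarrow> \<bar>a x - a y\<bar> \<le> L * norm (x - y)"
proof -
  have "\<forall>i. \<exists>B\<ge>0. \<forall>x\<in>S. \<bar>partial i a x\<bar> \<le> B"
  proof
    fix i
    have "Cb 0 S (partial i a)"
      using assms by simp
    then show "\<exists>B\<ge>0. \<forall>x\<in>S. \<bar>partial i a x\<bar> \<le> B"
      by (elim Cb_bound) blast
  qed
  then obtain B where B: "\<And>i. B i \<ge> 0" "\<And>i x. x \<in> S \<Longrightarrow> \<bar>partial i a x\<bar> \<le> B i"
    by metis
  define L where "L = (\<Sum>i\<in>UNIV. B i)"
  have "\<bar>a x - a y\<bar> \<le> L * norm (x - y)" if seg: "closed_segment x y \<subseteq> S" for x y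
  proof -
    have "norm (a x - a y) \<le> L * norm (x - y)"
    proof (rule differentiable_bound[OF convex_closed_segment])
      fix z assume z: "z \<in> closed_segment x y"
      have zS: "z \<in> S"
        using z seg by blast
      have "a differentiable (at z)"
        using assms zS by simp
      then show "(a has_derivative (\<lambda>y. \<Sum>i\<in>UNIV. y $ i * partial i a z)) (at z within closed_segment x y)"
        by (rule has_derivative_at_withinI[OF has_derivative_partial])
      show "onorm (\<lambda>y. \<Sum>i\<in>UNIV. y $ i * partial i a z) \<le> L"
      proof (rule onorm_bound)
        show "L \<ge> 0"
          using B(1) by (simp add: L_def sum_nonneg)
        fix y :: "real ^ 'n"
        have "\<bar>\<Sum>i\<in>UNIV. y $ i * partial i a z\<bar> \<le> (\<Sum>i\<in>UNIV. norm y * B i)"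
          by (rule order_trans[OF sum_abs], rule sum_mono, unfold abs_mult, rule mult_mono)
             (use B zS component_le_norm_cart in simp_all)
        then show "norm (\<Sum>i\<in>UNIV. y $ i * partial i a z) \<le> L * norm y"
          unfolding L_def sum_distrib_right by (simp add: mult.commute)
      qed
    qed auto
    then show ?thesis
      by simp
  qed
  moreover have "L \<ge> 0"
    using B(1) by (simp add: L_def sum_nonneg)
  ultimately show ?thesis
    using that by blast
qed

text \<open>If a segment leaves \<open>S\<close>, then \<open>a\<close> tends to \<open>0\<close> at
  the exit point, so the value at an inner endpoint is at most \<open>L\<close> times the distance
  to that point. For two inner endpoints, both are compared with a common point of the segment
  outside \<open>S\<close>, and the two distances add up.\<close>

lemma zero_ext_lipschitz:
  fixes S :: "(real ^ 'n) set"
  assumes "open S" "Cb 1 S a" "vanishing 1 S a"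
  obtains L where "L \<ge> 0" "\<And>x y. \<bar>zero_ext S a x - zero_ext S a y\<bar> \<le> L * norm (x - y)"
proof -
  obtain L where L: "L \<ge> 0" "\<And>x y. closed_segment x y \<subseteq> S \<Longrightarrow> \<bar>a x - a y\<bar> \<le> L * norm (x - y)"
    using Cb_segment_lipschitz[OF assms(2)] by blast
  have exit: "\<bar>a x\<bar> \<le> L * norm (x - y)" if xy: "x \<in> S" "y \<notin> S" for x y
  proof -
    have "closed (closed_segment x y - S)" "closed_segment x y - S \<noteq> {}"
      using assms(1) xy by (auto intro: closed_Diff)
    \<comment> \<open>\<open>z\<close> is the first point outside \<open>S\<close> on the way from
      \<open>x\<close> to \<open>y\<close>. The points \<open>w n\<close> below approach it from the
      side of \<open>x\<close>, so that the segments from \<open>x\<close> to \<open>w n\<close>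
      stay in \<open>S\<close>.\<close>
    then obtain z where z: "z \<in> closed_segment x y - S" "\<And>w. w \<in> closed_segment x y - S \<Longrightarrow> dist x z \<le> dist x w"
      using distance_attains_inf by metis
    have xz: "norm (x - z) \<le> norm (x - y)"
      using z(2)[of y] xy by (simp add: dist_norm)
    define e where "e n = inverse (real (Suc n))" for n
    have e: "0 < e n" "e n \<le> 1" for n
      by (simp_all add: e_def inverse_le_1_iff)
    define w where "w n = z + e n *\<^sub>R (x - z)" for n
    have sub: "closed_segment x (w n) \<subseteq> S" and dw: "norm (x - w n) \<le> norm (x - z)" for n
    proof -
      have nz: "norm (x - z) > 0"
        using xy z(1) by auto
      have "p \<in> S" if p: "p \<in> closed_segment x (w n)" for p
      proof -
        obtain s where s: "0 \<le> s" "s \<le> 1" "p = (1 - s) *\<^sub>R x + s *\<^sub>R w n"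
          using p by (auto simp: closed_segment_def)
        define c where "c = s * (1 - e n)"
        have "c \<le> 1 * (1 - e n)"
          unfolding c_def using s e[of n] by (intro mult_right_mono) auto
        then have c: "0 \<le> c" "c < 1"
          using s e[of n] by (simp_all add: c_def)
        have pz: "p = (1 - c) *\<^sub>R x + c *\<^sub>R z"
          by (simp add: s(3) w_def c_def algebra_simps)
        then have "p \<in> closed_segment x z"
          using c by (auto simp: closed_segment_def)
        then have seg: "p \<in> closed_segment x y"
          using z(1) by (meson DiffD1 ends_in_segment(1) subset_closed_segment subsetD)
        have "x - p = c *\<^sub>R (x - z)"
          by (simp add: pz algebra_simps)
        then have "dist x p = c * dist x z"
          using c by (simp add: dist_norm)
        also have "\<dots> < dist x z"
          using c nz by (simp add: dist_norm)
        finally show ?thesis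
          using z(2)[of p] seg by (meson DiffI not_le)
      qed
      then show "closed_segment x (w n) \<subseteq> S"
        by blast
      have "x - w n = (1 - e n) *\<^sub>R (x - z)"
        by (simp add: w_def algebra_simps)
      then have "norm (x - w n) = (1 - e n) * norm (x - z)"
        using e[of n] by simp
      also have "\<dots> \<le> 1 * norm (x - z)"
        using e[of n] by (intro mult_right_mono) auto
      finally show "norm (x - w n) \<le> norm (x - z)"
        by simp
    qed
    have wS: "w n \<in> S" for n
      using sub[of n] by auto
    have "(\<lambda>n. z + e n *\<^sub>R (x - z)) \<longlonglongrightarrow> z + 0 *\<^sub>R (x - z)"
      unfolding e_def by (intro tendsto_intros LIMSEQ_inverse_real_of_nat)
    then have wz: "w \<longlonglongrightarrow> z"
      by (simp add: w_def[abs_def])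
    then have "z \<in> closure S"
      using wS closure_sequential by blast
    then have "z \<in> frontier S"
      using z(1) assms(1) by (simp add: frontier_def interior_open)
    then have "(a \<longlongrightarrow> 0) (at z within S)"
      using assms(3) by simp
    moreover have "w n \<noteq> z" for n
      using wS[of n] z(1) by auto
    then have "filterlim w (at z within S) sequentially"
      using wz wS by (simp add: filterlim_at)
    ultimately have "(\<lambda>n. a (w n)) \<longlonglongrightarrow> 0"
      by (rule filterlim_compose)
    then have "(\<lambda>n. \<bar>a x - a (w n)\<bar>) \<longlonglongrightarrow> \<bar>a x - 0\<bar>"
      by (intro tendsto_intros)
    moreover have "\<bar>a x - a (w n)\<bar> \<le> L * norm (x - y)" for n
      using L(2)[OF sub[of n]] mult_left_mono[OF order_trans[OF dw[of n] xz] L(1)] by linarith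
    ultimately show ?thesis
      using LIMSEQ_le_const2[of _ "\<bar>a x - 0\<bar>" "L * norm (x - y)"] by auto
  qed
  have "\<bar>zero_ext S a x - zero_ext S a y\<bar> \<le> L * norm (x - y)" for x y
  proof (cases "x \<in> S \<and> y \<in> S")
    case True
    show ?thesis
    proof (cases "closed_segment x y \<subseteq> S")
      case False
      then obtain p where p: "p \<in> closed_segment x y" "p \<notin> S"
        by blast
      have "\<bar>a x\<bar> + \<bar>a y\<bar> \<le> L * norm (x - p) + L * norm (y - p)"
        using exit[of x p] exit[of y p] True p by (intro add_mono) auto
      also have "\<dots> = L * (dist x p + dist p y)"
        by (simp add: dist_norm norm_minus_commute algebra_simps)
      also have "dist x p + dist p y = norm (x - y)"
        using p(1) unfolding between_mem_segment[symmetric] between dist_norm by simp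
      finally show ?thesis
        using True by (simp add: zero_ext_def)
    qed (use L True in \<open>simp add: zero_ext_def\<close>)
  next
    case False
    then show ?thesis
      using exit[of x y] exit[of y x] L(1) by (auto simp: zero_ext_def norm_minus_commute)
  qed
  then show ?thesis
    using that L(1) by blast
qed

text \<open>Dominated convergence with an arbitrary moving point \<open>T j x\<close>, so that it
  covers both translations and dilations. The Lipschitz bound is asked only where \<open>h\<close>
  is nonzero, since \<open>F\<close> may jump elsewhere.\<close>

lemma diff_quotient_integral:
  fixes F h g :: "real ^ 'n \<Rightarrow> real" and T :: "nat \<Rightarrow> real ^ 'n \<Rightarrow> real ^ 'n" and \<epsilon> :: "nat \<Rightarrow> real"
  assumes meas: "F \<in> borel_measurable borel" "g \<in> borel_measurable borel" "\<And>j. T j \<in> borel_measurable borel"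
    and h: "integrable lborel h"
    and bound: "\<And>j x. h x \<noteq> 0 \<Longrightarrow> \<bar>F (T j x) - F x\<bar> \<le> L * \<bar>\<epsilon> j\<bar>" and L: "L \<ge> 0"
    and lim: "AE x in lborel. h x \<noteq> 0 \<longrightarrow> (\<lambda>j. (F (T j x) - F x) / \<epsilon> j) \<longlonglongrightarrow> g x"
  shows "(\<lambda>j. \<integral>x. (F (T j x) - F x) / \<epsilon> j * h x \<partial>lborel) \<longlonglongrightarrow> (\<integral>x. g x * h x \<partial>lborel)"
proof (rule integral_dominated_convergence)
  have [measurable]: "h \<in> borel_measurable borel"
    using h by auto
  note meas [measurable]
  show "(\<lambda>x. g x * h x) \<in> borel_measurable lborel"
    by measurable
  show "(\<lambda>x. (F (T j x) - F x) / \<epsilon> j * h x) \<in> borel_measurable lborel" for j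
    by measurable
  show "integrable lborel (\<lambda>x. L * \<bar>h x\<bar>)"
    using h by auto
  show "AE x in lborel. (\<lambda>j. (F (T j x) - F x) / \<epsilon> j * h x) \<longlonglongrightarrow> g x * h x"
    using lim
  proof eventually_elim
    case (elim x)
    then show ?case
      by (cases "h x = 0") (auto intro: tendsto_mult_right simp del: times_divide_eq_left)
  qed
  show "AE x in lborel. norm ((F (T j x) - F x) / \<epsilon> j * h x) \<le> L * \<bar>h x\<bar>" for j
  proof (rule AE_I2)
    fix x
    show "norm ((F (T j x) - F x) / \<epsilon> j * h x) \<le> L * \<bar>h x\<bar>"
    \<comment> \<open>For \<open>\<epsilon> j = 0\<close> the quotient is \<open>0\<close> by the
      convention on division.\<close>
    proof (cases "h x = 0 \<or> \<epsilon> j = 0")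
      case False
      then show ?thesis
        using bound[of x j] by (simp add: abs_mult divide_simps mult_right_mono)
    qed (use L in auto)
  qed
qed

lemma diff_quotient_tendsto:
  fixes F :: "'a::real_normed_vector \<Rightarrow> real"
  assumes "(F has_derivative F') (at x)" "\<epsilon> \<longlonglongrightarrow> 0" "\<And>j. \<epsilon> j \<noteq> (0::real)"
  shows "(\<lambda>j. (F (x + \<epsilon> j *\<^sub>R w) - F x) / \<epsilon> j) \<longlonglongrightarrow> F' w"
proof -
  have line: "((\<lambda>t. x + t *\<^sub>R w) has_derivative (\<lambda>t. t *\<^sub>R w)) (at 0)"
    by (auto intro!: derivative_eq_intros)
  have "((\<lambda>t. F (x + t *\<^sub>R w)) has_derivative (\<lambda>t. F' (t *\<^sub>R w))) (at 0)"
    using has_derivative_compose[OF line, of F F'] assms(1) by simp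
  moreover have "F' (t *\<^sub>R w) = F' w * t" for t
    using assms(1) by (simp add: has_derivative_def linear_simps)
  ultimately have "((\<lambda>t. F (x + t *\<^sub>R w)) has_real_derivative F' w) (at 0)"
    by (simp add: has_field_derivative_def)
  then have "(\<lambda>t. (F (x + t *\<^sub>R w) - F x) / t) \<midarrow>0\<rightarrow> F' w"
    by (simp add: DERIV_def)
  moreover have "filterlim \<epsilon> (at 0) sequentially"
    using assms(2,3) by (simp add: filterlim_at)
  ultimately show ?thesis
    by (rule filterlim_compose)
qed

text \<open>\<open>negligible\<close> refers to the completed measure; a closed set is Borel, so
  being null descends to \<open>lborel\<close>.\<close>

lemma AE_not_negligible:
  assumes "closed N" "negligible N"
  shows "AE x in lborel. x \<notin> N"
  using assms by (intro AE_not_in) (simp add: negligible_iff_null_sets null_sets_completion_iff)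

text \<open>Off the null set \<open>frontier S\<close> the extension is differentiable, its gradient
  being the extension of the gradient, and the Lipschitz bound dominates the quotients. Constant
  fields \<open>w\<close> serve integration by parts, and the identity field gives the Euler
  derivative.\<close>

lemma zero_ext_diff_quotient_integral:
  fixes S :: "(real ^ 'n) set"
  assumes S: "open S" "negligible (frontier S)" and a: "Cb 1 S a" "vanishing 1 S a"
    and w: "continuous_on UNIV w" and h: "integrable lborel h" "\<And>x. h x \<noteq> 0 \<Longrightarrow> norm (w x) \<le> C"
    and \<epsilon>: "\<epsilon> \<longlonglongrightarrow> 0" "\<And>j. \<epsilon> j \<noteq> (0::real)"
  shows "(\<lambda>j. \<integral>x. (zero_ext S a (x + \<epsilon> j *\<^sub>R w x) - zero_ext S a x) / \<epsilon> j * h x \<partial>lborel) \<longlonglongrightarrow>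
     (\<integral>x. zero_ext S (\<lambda>x. \<Sum>i\<in>UNIV. w x $ i * partial i a x) x * h x \<partial>lborel)"
proof -
  obtain L where L: "L \<ge> 0" "\<And>x y. \<bar>zero_ext S a x - zero_ext S a y\<bar> \<le> L * norm (x - y)"
    using zero_ext_lipschitz[OF S(1) a] by blast
  have wm: "w \<in> borel_measurable borel"
    using w by (rule borel_measurable_continuous_onI)
  have ca: "continuous_on S (partial i a)" for i
    using a(1) by simp
  show ?thesis
  proof (rule diff_quotient_integral)
    show "zero_ext S a \<in> borel_measurable borel"
      by (rule zero_ext_measurable[OF S(1) Cb_continuous[OF a(1)]])
    show "zero_ext S (\<lambda>x. \<Sum>i\<in>UNIV. w x $ i * partial i a x) \<in> borel_measurable borel"
      by (intro zero_ext_measurable S(1) continuous_intros ca continuous_on_subset[OF w]) auto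
    show "(\<lambda>x. x + \<epsilon> j *\<^sub>R w x) \<in> borel_measurable borel" for j
      using wm by measurable
    show "\<bar>zero_ext S a (x + \<epsilon> j *\<^sub>R w x) - zero_ext S a x\<bar> \<le> L * max C 0 * \<bar>\<epsilon> j\<bar>" if "h x \<noteq> 0" for x j
    proof -
      have "\<bar>zero_ext S a (x + \<epsilon> j *\<^sub>R w x) - zero_ext S a x\<bar> \<le> L * (\<bar>\<epsilon> j\<bar> * norm (w x))"
        using L(2)[of "x + \<epsilon> j *\<^sub>R w x" x] by simp
      also have "\<dots> \<le> L * (\<bar>\<epsilon> j\<bar> * max C 0)"
        using h(2)[OF that] L(1) by (intro mult_left_mono) auto
      finally show ?thesis
        by (simp add: mult_ac)
    qed
    show "AE x in lborel. h x \<noteq> 0 \<longrightarrow> (\<lambda>j. (zero_ext S a (x + \<epsilon> j *\<^sub>R w x) - zero_ext S a x) / \<epsilon> j) \<longlonglongrightarrow>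
        zero_ext S (\<lambda>x. \<Sum>i\<in>UNIV. w x $ i * partial i a x) x"
      using AE_not_negligible[OF frontier_closed S(2)]
    proof eventually_elim
      case (elim x)
      show ?case
      proof (cases "x \<in> S")
        case True
        then show ?thesis
          using diff_quotient_tendsto[OF zero_ext_has_derivative[OF S(1) _ True] \<epsilon>, of a "w x"] a(1)
          by (simp add: zero_ext_def)
      next
        case False
        then have x: "x \<in> - closure S"
          using elim S(1) by (simp add: frontier_def interior_open)
        have "(zero_ext S a has_derivative (\<lambda>y. 0)) (at x)"
        proof (rule has_derivative_transform_within_open[OF has_derivative_const])
          show "open (- closure S)" "x \<in> - closure S"
            using x by auto
          show "0 = zero_ext S a y" if "y \<in> - closure S" for y
            using that closure_subset by (auto simp: zero_ext_def)
        qed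
        then show ?thesis
          using diff_quotient_tendsto[OF _ \<epsilon>, of "zero_ext S a" "\<lambda>y. 0" x "w x"] False by (simp add: zero_ext_def)
      qed
    qed
  qed (use h L in auto)
qed

section \<open>Change of variables and integration by parts\<close>

lemma lborel_integral_translate:
  fixes f :: "'a::euclidean_space \<Rightarrow> real"
  assumes "f \<in> borel_measurable borel"
  shows "(\<integral>x. f (c + x) \<partial>lborel) = (\<integral>x. f x \<partial>lborel)"
  using integral_distr[of "(+) c" lborel borel f] assms by (simp add: lborel_distr_plus)

lemma lborel_integral_dilate:
  fixes f :: "'a::euclidean_space \<Rightarrow> real"
  assumes "f \<in> borel_measurable borel" "c > 0"
  shows "(\<integral>x. f (c *\<^sub>R x) \<partial>lborel) = (\<integral>x. f x \<partial>lborel) / c ^ DIM('a)"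
proof -
  let ?D = "distr lborel borel (\<lambda>x. 0 + c *\<^sub>R x) :: 'a measure"
  have [measurable]: "f \<in> borel_measurable borel"
    by (rule assms)
  have "integral\<^sup>L lborel f = integral\<^sup>L (density ?D (\<lambda>_. ennreal (\<bar>c\<bar> ^ DIM('a)))) f"
    using assms(2) lborel_affine[of c "0 :: 'a"] by (simp only: ennreal_power abs_ge_zero)
  also have "\<dots> = \<bar>c\<bar> ^ DIM('a) * integral\<^sup>L ?D f"
    by (subst integral_density) simp_all
  also have "integral\<^sup>L ?D f = (\<integral>x. f (0 + c *\<^sub>R x) \<partial>lborel)"
    by (rule integral_distr) measurable
  finally have "integral\<^sup>L lborel f = c ^ DIM('a) * (\<integral>x. f (c *\<^sub>R x) \<partial>lborel)"
    using assms(2) by simp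
  then show ?thesis
    using assms(2) by (simp add: divide_simps)
qed

lemma sum_axis: "(\<Sum>k\<in>UNIV. axis i (1 :: real) $ k * f k) = f i"
  by (simp add: axis_def if_distrib[of "\<lambda>c. c * _"] cong: if_cong)

lemma integrable_bounded_mult:
  fixes f g :: "'a \<Rightarrow> real"
  assumes "f \<in> borel_measurable M" "\<And>x. \<bar>f x\<bar> \<le> B" "integrable M g"
  shows "integrable M (\<lambda>x. f x * g x)"
proof (rule Bochner_Integration.integrable_bound)
  show "integrable M (\<lambda>x. B * g x)"
    using assms(3) by simp
  show "(\<lambda>x. f x * g x) \<in> borel_measurable M"
    using assms by simp
  have "norm (f x * g x) \<le> norm (B * g x)" for x
    using assms(2)[of x] by (simp add: abs_mult mult_right_mono)
  then show "AE x in M. norm (f x * g x) \<le> norm (B * g x)"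
    by simp
qed

text \<open>
  Integration by parts without a divergence theorem: the difference quotients of both factors
  converge dominatedly, and they are exchanged by translation invariance.
\<close>
lemma integration_by_parts:
  fixes U S :: "(real ^ 'n) set"
  assumes U: "open U" "closure U \<subseteq> S" "negligible (frontier U)" and S: "open S" "bounded S"
    and a: "Cb 1 U a" "vanishing 1 U a" and c: "Cb 1 S c"
  shows "(\<integral>x. zero_ext U (\<lambda>x. a x * partial i c x) x \<partial>lborel) = - (\<integral>x. zero_ext U (\<lambda>x. partial i a x * c x) x \<partial>lborel)"
proof -
  let ?e = "axis i 1 :: real ^ 'n"
  have US: "U \<subseteq> S"
    using U(2) closure_subset by blast
  have Ub: "bounded U"
    by (rule bounded_subset[OF S(2) US])
  have "compact (closure U)"
    using Ub by simp
  \<comment> \<open>Shifts of \<open>U\<close> by at most \<open>d\<close> stay in \<open>S\<close>.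
    Therefore \<open>c\<close> is differenced only where it is smooth, and the jump of its extension
    at the frontier of \<open>S\<close> is never seen.\<close>
  then obtain d where d: "d > 0" "(\<Union>x\<in>closure U. cball x d) \<subseteq> S"
    using compact_subset_open_imp_cball_epsilon_subset[OF _ S(1) U(2)] by metis
  obtain L where L: "L \<ge> 0" "\<And>x y. closed_segment x y \<subseteq> S \<Longrightarrow> \<bar>c x - c y\<bar> \<le> L * norm (x - y)"
    using Cb_segment_lipschitz[OF c] by blast
  define \<epsilon> where "\<epsilon> j = d * inverse (real (Suc j))" for j
  have \<epsilon>: "\<epsilon> j > 0" "\<epsilon> j \<le> d" for j
    using d(1) by (simp_all add: \<epsilon>_def inverse_le_1_iff mult_left_le)
  have \<epsilon>0: "\<epsilon> \<longlonglongrightarrow> 0"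
    unfolding \<epsilon>_def by (intro tendsto_mult_right_zero LIMSEQ_inverse_real_of_nat)
  have am: "zero_ext U a \<in> borel_measurable borel" and cm: "zero_ext S c \<in> borel_measurable borel"
    using zero_ext_measurable[OF U(1) Cb_continuous[OF a(1)]] zero_ext_measurable[OF S(1) Cb_continuous[OF c]] .
  have shift: "x + \<epsilon> j *\<^sub>R ?e \<in> cball x d" for x j
    using \<epsilon>[of j] by (simp add: dist_norm)
  have near: "closed_segment x (x + \<epsilon> j *\<^sub>R ?e) \<subseteq> S" if "x \<in> U" for x j
  proof -
    have "closed_segment x (x + \<epsilon> j *\<^sub>R ?e) \<subseteq> cball x d"
      using shift d(1) by (intro closed_segment_subset) auto
    then show ?thesis
      using d(2) that closure_subset[of U] by blast
  qed
  have ac: "integrable lborel (zero_ext U a)" "integrable lborel (zero_ext S c)"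
    using Cb_zero_ext_integrable[OF U(1) Ub a(1)] Cb_zero_ext_integrable[OF S c] .
  obtain B where B: "B \<ge> 0" "\<And>x. x \<in> U \<Longrightarrow> \<bar>a x\<bar> \<le> B"
    using Cb_bound[OF a(1)] by blast
  have bnd: "\<bar>zero_ext U a x\<bar> \<le> B" for x
    using B by (simp add: zero_ext_def)
  have i1: "integrable lborel (\<lambda>x. zero_ext U a (- \<epsilon> j *\<^sub>R ?e + x) * zero_ext S c x)" for j
    by (rule integrable_bounded_mult[OF _ bnd ac(2)]) (use am in measurable)
  have i2: "integrable lborel (\<lambda>x. zero_ext U a x * zero_ext S c x)"
    by (rule integrable_bounded_mult[OF _ bnd ac(2)]) (use am in measurable)
  obtain B' where B': "B' \<ge> 0" "\<And>x. x \<in> S \<Longrightarrow> \<bar>c x\<bar> \<le> B'"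
    using Cb_bound[OF c] by blast
  have bnd': "\<bar>zero_ext S c x\<bar> \<le> B'" for x
    using B' by (simp add: zero_ext_def)
  have "integrable lborel (\<lambda>x. zero_ext S c (\<epsilon> j *\<^sub>R ?e + x) * zero_ext U a x)" for j
    by (rule integrable_bounded_mult[OF _ bnd' ac(1)]) (use cm in measurable)
  then have i3: "integrable lborel (\<lambda>x. zero_ext U a x * zero_ext S c (\<epsilon> j *\<^sub>R ?e + x))" for j
    by (simp only: mult.commute)
  \<comment> \<open>The shift of \<open>a\<close> is by \<open>- \<epsilon> j\<close> and that of
    \<open>c\<close> by \<open>\<epsilon> j\<close>, each divided by its own step: substitution then
    turns one integral into the negative of the other.\<close>
  have "(\<lambda>j. \<integral>x. (zero_ext U a (x + - \<epsilon> j *\<^sub>R ?e) - zero_ext U a x) / - \<epsilon> j * zero_ext S c x \<partial>lborel) \<longlonglongrightarrow>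
      (\<integral>x. zero_ext U (\<lambda>x. \<Sum>k\<in>UNIV. ?e $ k * partial k a x) x * zero_ext S c x \<partial>lborel)"
    by (rule zero_ext_diff_quotient_integral[OF U(1,3) a, of "\<lambda>_. ?e" _ 1])
       (use ac \<epsilon> \<epsilon>0 tendsto_minus[OF \<epsilon>0] in \<open>auto simp: less_imp_neq[THEN not_sym]\<close>)
  also have "(\<lambda>x. zero_ext U (\<lambda>x. \<Sum>k\<in>UNIV. ?e $ k * partial k a x) x * zero_ext S c x) = zero_ext U (\<lambda>x. partial i a x * c x)"
    using US by (auto simp: fun_eq_iff zero_ext_def sum_axis)
  finally have lim1: "(\<lambda>j. \<integral>x. (zero_ext U a (x + - \<epsilon> j *\<^sub>R ?e) - zero_ext U a x) / - \<epsilon> j * zero_ext S c x \<partial>lborel) \<longlonglongrightarrow>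
      (\<integral>x. zero_ext U (\<lambda>x. partial i a x * c x) x \<partial>lborel)" .
  have "(\<lambda>j. \<integral>x. (zero_ext S c (x + \<epsilon> j *\<^sub>R ?e) - zero_ext S c x) / \<epsilon> j * zero_ext U a x \<partial>lborel) \<longlonglongrightarrow>
      (\<integral>x. zero_ext S (partial i c) x * zero_ext U a x \<partial>lborel)"
  proof (rule diff_quotient_integral)
    show "zero_ext S (partial i c) \<in> borel_measurable borel"
      using c by (intro zero_ext_measurable S(1)) simp
    show "\<bar>zero_ext S c (x + \<epsilon> j *\<^sub>R ?e) - zero_ext S c x\<bar> \<le> L * \<bar>\<epsilon> j\<bar>" if "zero_ext U a x \<noteq> 0" for x j
    proof -
      have x: "x \<in> U"
        using that by (auto simp: zero_ext_def split: if_splits)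
      have "x \<in> S" "x + \<epsilon> j *\<^sub>R ?e \<in> S"
        using near[OF x, of j] by auto
      then show ?thesis
        using L(2)[OF near[OF x, of j]] by (simp add: zero_ext_def abs_minus_commute)
    qed
    show "AE x in lborel. zero_ext U a x \<noteq> 0 \<longrightarrow> (\<lambda>j. (zero_ext S c (x + \<epsilon> j *\<^sub>R ?e) - zero_ext S c x) / \<epsilon> j) \<longlonglongrightarrow> zero_ext S (partial i c) x"
    proof (intro AE_I2 impI)
      fix x assume "zero_ext U a x \<noteq> 0"
      then have x: "x \<in> S"
        using US by (auto simp: zero_ext_def split: if_splits)
      have "(\<lambda>j. (zero_ext S c (x + \<epsilon> j *\<^sub>R ?e) - zero_ext S c x) / \<epsilon> j) \<longlonglongrightarrow> (\<Sum>k\<in>UNIV. ?e $ k * partial k c x)"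
        by (rule diff_quotient_tendsto[OF zero_ext_has_derivative[OF S(1) _ x] \<epsilon>0])
           (use c x \<epsilon> in \<open>auto simp: less_imp_neq[THEN not_sym]\<close>)
      then show "(\<lambda>j. (zero_ext S c (x + \<epsilon> j *\<^sub>R ?e) - zero_ext S c x) / \<epsilon> j) \<longlonglongrightarrow> zero_ext S (partial i c) x"
        using x by (simp add: zero_ext_def sum_axis)
    qed
  qed (use cm ac L in auto)
  also have "(\<lambda>x. zero_ext S (partial i c) x * zero_ext U a x) = zero_ext U (\<lambda>x. a x * partial i c x)"
    using US by (auto simp: fun_eq_iff zero_ext_def)
  finally have lim2: "(\<lambda>j. \<integral>x. (zero_ext S c (x + \<epsilon> j *\<^sub>R ?e) - zero_ext S c x) / \<epsilon> j * zero_ext U a x \<partial>lborel) \<longlonglongrightarrow>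
      (\<integral>x. zero_ext U (\<lambda>x. a x * partial i c x) x \<partial>lborel)" .
  have "(\<integral>x. (zero_ext U a (x + - \<epsilon> j *\<^sub>R ?e) - zero_ext U a x) / - \<epsilon> j * zero_ext S c x \<partial>lborel) =
      - (\<integral>x. (zero_ext S c (x + \<epsilon> j *\<^sub>R ?e) - zero_ext S c x) / \<epsilon> j * zero_ext U a x \<partial>lborel)" for j
  proof -
    have "(\<integral>x. (zero_ext U a (x + - \<epsilon> j *\<^sub>R ?e) - zero_ext U a x) / - \<epsilon> j * zero_ext S c x \<partial>lborel) =
       (\<integral>x. (zero_ext U a (- \<epsilon> j *\<^sub>R ?e + x) * zero_ext S c x - zero_ext U a x * zero_ext S c x) * (- 1 / \<epsilon> j) \<partial>lborel)"
      by (intro Bochner_Integration.integral_cong refl) (simp add: algebra_simps diff_divide_distrib)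
    also have "\<dots> = ((\<integral>x. zero_ext U a (- \<epsilon> j *\<^sub>R ?e + x) * zero_ext S c x \<partial>lborel) - (\<integral>x. zero_ext U a x * zero_ext S c x \<partial>lborel)) * (- 1 / \<epsilon> j)"
      using i1[of j] i2 by (simp only: integral_mult_left_zero Bochner_Integration.integral_diff)
    also have "(\<integral>x. zero_ext U a (- \<epsilon> j *\<^sub>R ?e + x) * zero_ext S c x \<partial>lborel) = (\<integral>x. zero_ext U a x * zero_ext S c (\<epsilon> j *\<^sub>R ?e + x) \<partial>lborel)"
      by (subst lborel_integral_translate[of _ "\<epsilon> j *\<^sub>R ?e", symmetric]) (use am cm in simp_all)
    also have "(\<dots> - (\<integral>x. zero_ext U a x * zero_ext S c x \<partial>lborel)) * (- 1 / \<epsilon> j) =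
        (\<integral>x. (zero_ext U a x * zero_ext S c (\<epsilon> j *\<^sub>R ?e + x) - zero_ext U a x * zero_ext S c x) * (- 1 / \<epsilon> j) \<partial>lborel)"
      using i3[of j] i2 by (simp only: integral_mult_left_zero Bochner_Integration.integral_diff)
    also have "\<dots> = (\<integral>x. - ((zero_ext S c (x + \<epsilon> j *\<^sub>R ?e) - zero_ext S c x) / \<epsilon> j * zero_ext U a x) \<partial>lborel)"
      by (intro Bochner_Integration.integral_cong refl) (simp add: algebra_simps diff_divide_distrib)
    finally show ?thesis
      by simp
  qed
  then have "(\<integral>x. zero_ext U (\<lambda>x. partial i a x * c x) x \<partial>lborel) =
      - (\<integral>x. zero_ext U (\<lambda>x. a x * partial i c x) x \<partial>lborel)"
    by (intro LIMSEQ_unique[OF lim1]) (simp only: tendsto_minus[OF lim2])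
  then show ?thesis
    by simp
qed

section \<open>The Dirichlet form and the Pohozaev inequality\<close>

text \<open>The sum over all words of \<open>m\<close> directions of the integrated products of the
  corresponding derivatives. Counting words rather than multi-indices gives the multiplicities that
  occur in the \<open>m\<close>-th power of the Laplacian, with no distinction between even and odd
  \<open>m\<close>; the form is visibly symmetric and nonnegative on the diagonal.\<close>

primrec dform :: "nat \<Rightarrow> (real ^ 'n) set \<Rightarrow> (real ^ 'n \<Rightarrow> real) \<Rightarrow> (real ^ 'n \<Rightarrow> real) \<Rightarrow> real" where
  "dform 0 U a b = (\<integral>x. zero_ext U (\<lambda>x. a x * b x) x \<partial>lborel)"
| "dform (Suc m) U a b = (\<Sum>i\<in>UNIV. dform m U (partial i a) (partial i b))"

lemma dform_cong:
  assumes "open U" "\<And>x. x \<in> U \<Longrightarrow> a x = a' x" "\<And>x. x \<in> U \<Longrightarrow> b x = b' x"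
  shows "dform m U a b = dform m U a' b'"
  using assms(2,3)
proof (induction m arbitrary: a a' b b')
  case 0
  then show ?case
    by (simp add: integral_zero_ext_cong[of U "\<lambda>x. a x * b x" "\<lambda>x. a' x * b' x"])
next
  case (Suc m)
  have "dform m U (partial i a) (partial i b) = dform m U (partial i a') (partial i b')" for i
    by (intro Suc.IH partial_cong[OF assms(1)] Suc.prems)
  then show ?case
    by simp
qed

text \<open>The bound \<open>2 a b \<le> a\<^sup>2 + b\<^sup>2\<close>, applied pointwise to each
  derivative of order \<open>m\<close>.\<close>

lemma dform_le_average:
  assumes "open U" "bounded U" "Cb m U a" "Cb m U b"
  shows "dform m U a b \<le> (dform m U a a + dform m U b b) / 2"
  using assms(3,4)
proof (induction m arbitrary: a b)
  case 0
  have int: "integrable lborel (zero_ext U (\<lambda>x. f x * g x))" if "Cb 0 U f" "Cb 0 U g" for f g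
    by (rule Cb_zero_ext_integrable[OF assms(1,2) Cb_mult[OF assms(1) that]])
  have "2 * (\<integral>x. zero_ext U (\<lambda>x. a x * b x) x \<partial>lborel) = (\<integral>x. 2 * zero_ext U (\<lambda>x. a x * b x) x \<partial>lborel)"
    by simp
  also have "\<dots> \<le> (\<integral>x. zero_ext U (\<lambda>x. a x * a x) x + zero_ext U (\<lambda>x. b x * b x) x \<partial>lborel)"
  proof (rule integral_mono)
    show "integrable lborel (\<lambda>x. 2 * zero_ext U (\<lambda>x. a x * b x) x)"
      using int[OF 0] by simp
    show "integrable lborel (\<lambda>x. zero_ext U (\<lambda>x. a x * a x) x + zero_ext U (\<lambda>x. b x * b x) x)"
      using int[OF 0(1) 0(1)] int[OF 0(2) 0(2)] by simp
    show "2 * zero_ext U (\<lambda>x. a x * b x) x \<le> zero_ext U (\<lambda>x. a x * a x) x + zero_ext U (\<lambda>x. b x * b x) x" for x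
      using sum_squares_bound[of "a x" "b x"] by (simp add: zero_ext_def power2_eq_square mult.assoc)
  qed
  also have "\<dots> = (\<integral>x. zero_ext U (\<lambda>x. a x * a x) x \<partial>lborel) + (\<integral>x. zero_ext U (\<lambda>x. b x * b x) x \<partial>lborel)"
    using int[OF 0(1) 0(1)] int[OF 0(2) 0(2)] by simp
  finally show ?case
    by simp
next
  case (Suc m)
  have "dform (Suc m) U a b \<le>
      (\<Sum>i\<in>UNIV. (dform m U (partial i a) (partial i a) + dform m U (partial i b) (partial i b)) / 2)"
    unfolding dform.simps by (intro sum_mono Suc.IH Cb_partial Suc.prems)
  also have "\<dots> = (dform (Suc m) U a a + dform (Suc m) U b b) / 2"
    by (simp add: sum.distrib flip: sum_divide_distrib)
  finally show ?case .
qed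

lemma dform_mono:
  assumes "open U" "U \<subseteq> S" "open S" "bounded S" "Cb m S b"
  shows "dform m U b b \<le> dform m S b b"
  using assms(5)
proof (induction m arbitrary: b)
  case 0
  have "bounded U"
    by (rule bounded_subset[OF assms(4,2)])
  have S: "Cb 0 S (\<lambda>x. b x * b x)"
    by (rule Cb_mult[OF assms(3) 0 0])
  show ?case
    unfolding dform.simps
  proof (rule integral_mono)
    show "integrable lborel (zero_ext U (\<lambda>x. b x * b x))"
      by (rule Cb_zero_ext_integrable[OF assms(1) \<open>bounded U\<close> Cb_subset[OF S assms(2)]])
    show "integrable lborel (zero_ext S (\<lambda>x. b x * b x))"
      by (rule Cb_zero_ext_integrable[OF assms(3,4) S])
    show "zero_ext U (\<lambda>x. b x * b x) x \<le> zero_ext S (\<lambda>x. b x * b x) x" for x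
      using assms(2) by (auto simp: zero_ext_def)
  qed
next
  case (Suc m)
  then show ?case
    by (auto intro!: sum_mono)
qed

text \<open>Each step moves one derivative from the Laplacian of \<open>b\<close> to
  \<open>a\<close>. The two factors play different roles: \<open>a\<close> has \<open>m\<close>
  derivatives on \<open>U\<close>, and those of order below \<open>m\<close> vanish on its frontier,
  while \<open>b\<close> has \<open>2 * m\<close> derivatives on a neighbourhood of the
  closure.\<close>

lemma dform_lap_iter:
  fixes U S :: "(real ^ 'n) set"
  assumes U: "open U" "closure U \<subseteq> S" "negligible (frontier U)" and S: "open S" "bounded S"
    and "Cb m U a" "vanishing m U a" "Cb (2 * m) S b"
  shows "(\<integral>x. zero_ext U (\<lambda>x. a x * (lap ^^ m) b x) x \<partial>lborel) = (- 1) ^ m * dform m U a b"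
  using assms(6-)
proof (induction m arbitrary: a b)
  case (Suc m)
  have US: "U \<subseteq> S"
    using U(2) closure_subset by blast
  have Ub: "bounded U"
    by (rule bounded_subset[OF S(2) US])
  have b: "Cb (2 * m + 2) S b"
    using Suc.prems(3) by (simp add: algebra_simps del: Cb.simps)
  have b1: "Cb (2 * m + 1) S b"
    by (rule Cb_mono[OF b]) simp
  have lb: "Cb 2 S ((lap ^^ m) b)"
    using b by (intro Cb_lap_iter S(1)) (simp add: add.commute del: Cb.simps)
  have lb1: "Cb 1 S (partial i ((lap ^^ m) b))" for i
    using lb by (simp add: numeral_2_eq_2)
  have a1: "Cb 1 U a"
    by (rule Cb_mono[OF Suc.prems(1)]) simp
  have a0: "Cb 0 U a"
    by (rule Cb_mono[OF Suc.prems(1)]) simp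
  have va: "vanishing 1 U a"
    using Suc.prems(2) by simp
  have lb0: "Cb 0 U (partial i (partial i ((lap ^^ m) b)))" for i
  proof (rule Cb_subset[OF Cb_partial US])
    show "Cb (Suc 0) S (partial i ((lap ^^ m) b))"
      using lb1[of i] by (simp only: One_nat_def)
  qed
  have "(\<integral>x. zero_ext U (\<lambda>x. a x * (lap ^^ Suc m) b x) x \<partial>lborel) =
      (\<integral>x. zero_ext U (\<lambda>x. \<Sum>i\<in>UNIV. a x * partial i (partial i ((lap ^^ m) b)) x) x \<partial>lborel)"
    by (simp add: lap_def sum_distrib_left)
  also have "\<dots> = (\<Sum>i\<in>UNIV. \<integral>x. zero_ext U (\<lambda>x. a x * partial i (partial i ((lap ^^ m) b)) x) x \<partial>lborel)"
    by (intro integral_zero_ext_sum U(1) Ub Cb_mult a0 lb0)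
  also have "\<dots> = (\<Sum>i\<in>UNIV. - (\<integral>x. zero_ext U (\<lambda>x. partial i a x * partial i ((lap ^^ m) b) x) x \<partial>lborel))"
    using integration_by_parts[OF U S a1 va lb1] by simp
  also have "\<dots> = (\<Sum>i\<in>UNIV. - (\<integral>x. zero_ext U (\<lambda>x. partial i a x * (lap ^^ m) (partial i b) x) x \<partial>lborel))"
  proof (intro sum.cong refl arg_cong[of _ _ uminus] integral_zero_ext_cong)
    fix i x assume "x \<in> U"
    then have "x \<in> S"
      using US by blast
    then show "partial i a x * partial i ((lap ^^ m) b) x = partial i a x * (lap ^^ m) (partial i b) x"
      using partial_lap_iter[OF S(1) b1] by simp
  qed
  also have "\<dots> = (\<Sum>i\<in>UNIV. - ((- 1) ^ m * dform m U (partial i a) (partial i b)))"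
  proof (intro sum.cong refl arg_cong[of _ _ uminus] Suc.IH)
    show "Cb m U (partial i a)" "vanishing m U (partial i a)" "Cb (2 * m) S (partial i b)" for i
      using Suc.prems(1,2) b1 by simp_all
  qed
  finally show ?case
    by (simp add: sum_negf sum_distrib_left)
qed simp

text \<open>The form of star-shapedness that the analysis uses: every proper contraction maps the
  closure into the open set.\<close>

locale star_region =
  fixes S :: "(real ^ 'n) set"
  assumes S_open: "open S" and S_bounded: "bounded S"
    and S_star: "\<And>x t. x \<in> closure S \<Longrightarrow> 0 \<le> t \<Longrightarrow> t < 1 \<Longrightarrow> t *\<^sub>R x \<in> S"
begin

text \<open>The natural domain of the dilate \<open>a (t x)\<close>, hence a preimage. For
  \<open>t > 1\<close> it is \<open>S\<close> shrunk by the factor \<open>1 / t\<close>.\<close>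

definition U :: "real \<Rightarrow> (real ^ 'n) set" where
  "U t = (\<lambda>x. t *\<^sub>R x) -` S"

lemma U_iff: "x \<in> U t \<longleftrightarrow> t *\<^sub>R x \<in> S"
  by (simp add: U_def)

lemma U_open: "open (U t)"
  unfolding U_def by (intro open_vimage S_open continuous_intros)

lemma closure_U_scale: "x \<in> closure (U t) \<Longrightarrow> t *\<^sub>R x \<in> closure S"
proof -
  have "closed ((\<lambda>x. t *\<^sub>R x) -` closure S)"
    by (intro closed_vimage closed_closure continuous_intros)
  then have "closure (U t) \<subseteq> (\<lambda>x. t *\<^sub>R x) -` closure S"
    using closure_subset by (intro closure_minimal) (auto simp: U_def)
  then show "x \<in> closure (U t) \<Longrightarrow> t *\<^sub>R x \<in> closure S"
    by blast
qed

lemma closure_U: "t > 1 \<Longrightarrow> closure (U t) \<subseteq> S"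
proof
  fix x assume "t > 1" "x \<in> closure (U t)"
  then show "x \<in> S"
    using S_star[OF closure_U_scale[of x t], of "1 / t"] by simp
qed

lemma U_subset: "t > 1 \<Longrightarrow> U t \<subseteq> S"
  using closure_U closure_subset by blast

lemma U_bounded: "t > 1 \<Longrightarrow> bounded (U t)"
  by (rule bounded_subset[OF S_bounded U_subset])

lemma frontier_U_scale: "x \<in> frontier (U t) \<Longrightarrow> t *\<^sub>R x \<in> frontier S"
  using closure_U_scale[of x t] by (simp add: frontier_def interior_open S_open U_open U_iff)

text \<open>Of two frontier points on one ray, the inner would be a proper contraction of the outer
  and hence belong to the open set \<open>S\<close>.\<close>

lemma frontier_ray_unique:
  assumes "x \<in> frontier S" "c *\<^sub>R x \<in> frontier S" "c \<ge> 0"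
  shows "c = 1"
proof (rule ccontr)
  assume "c \<noteq> 1"
  have x: "x \<in> closure S" "x \<notin> S" "c *\<^sub>R x \<in> closure S" "c *\<^sub>R x \<notin> S"
    using assms(1,2) by (simp_all add: frontier_def interior_open S_open)
  show False
  proof (cases "c < 1")
    case True
    then show False
      using S_star[OF x(1) assms(3)] x(4) by simp
  next
    case False
    then show False
      using S_star[OF x(3), of "1 / c"] x(2) \<open>c \<noteq> 1\<close> by simp
  qed
qed

text \<open>A closed set met at most once by each ray from the origin is null; the uniqueness is
  scaled back to the frontier of \<open>S\<close>.\<close>

lemma negligible_frontier_U: "t > 0 \<Longrightarrow> negligible (frontier (U t))"
proof (rule starlike_negligible[OF frontier_closed, of 0])
  fix c and x :: "real ^ 'n"
  assume "t > 0" "0 + c *\<^sub>R x \<in> frontier (U t)" "0 \<le> c" "0 + x \<in> frontier (U t)"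
  then show "c = 1"
    using frontier_ray_unique[of "t *\<^sub>R x" c] frontier_U_scale[of x t] frontier_U_scale[of "c *\<^sub>R x" t]
    by (simp add: mult.commute)
qed

lemma negligible_frontier: "negligible (frontier S)"
  using negligible_frontier_U[of 1] by (simp add: U_def)

text \<open>The scalar \<open>c\<close> makes inductions on the order possible: differentiating a
  dilate yields a dilate of the derivative with \<open>c * t\<close> in place of
  \<open>c\<close>.\<close>

lemma partial_dilate:
  fixes a :: "real ^ 'n \<Rightarrow> real"
  assumes "a differentiable (at (t *\<^sub>R x))"
  shows "partial i (\<lambda>x. c * a (t *\<^sub>R x)) x = (c * t) * partial i a (t *\<^sub>R x)"
    and "(\<lambda>x. c * a (t *\<^sub>R x)) differentiable (at x)"
proof -
  have "((\<lambda>x. t *\<^sub>R x) has_derivative (\<lambda>x. t *\<^sub>R x)) (at x)"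
    by (auto intro!: derivative_eq_intros)
  from has_derivative_compose[OF this has_derivative_partial[OF assms]]
  have d: "((\<lambda>x. c * a (t *\<^sub>R x)) has_derivative
      (\<lambda>y. c * (\<Sum>j\<in>UNIV. (t *\<^sub>R y) $ j * partial j a (t *\<^sub>R x)))) (at x)"
    by (intro has_derivative_mult_right) simp
  have "(\<Sum>j\<in>UNIV. (t *\<^sub>R axis i 1 :: real ^ 'n) $ j * partial j a (t *\<^sub>R x)) =
      t * (\<Sum>j\<in>UNIV. (axis i 1 :: real ^ 'n) $ j * partial j a (t *\<^sub>R x))"
    by (simp add: sum_distrib_left mult.assoc)
  then show "partial i (\<lambda>x. c * a (t *\<^sub>R x)) x = (c * t) * partial i a (t *\<^sub>R x)"
    using partial_eqI[OF d, of i] by (simp only: sum_axis mult.assoc)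
  show "(\<lambda>x. c * a (t *\<^sub>R x)) differentiable (at x)"
    using d by (auto simp: differentiable_def)
qed

lemma Cb_0_dilate:
  assumes "Cb 0 S a"
  shows "Cb 0 (U t) (\<lambda>x. c * a (t *\<^sub>R x))"
proof -
  have "continuous_on (U t) (\<lambda>x. a (t *\<^sub>R x))"
    by (rule continuous_on_compose2[OF Cb_continuous[OF assms]]) (auto intro: continuous_intros simp: U_iff)
  moreover obtain B where B: "B \<ge> 0" "\<And>x. x \<in> S \<Longrightarrow> \<bar>a x\<bar> \<le> B"
    using Cb_bound[OF assms] by blast
  have "bounded ((\<lambda>x. c * a (t *\<^sub>R x)) ` U t)"
    unfolding bounded_iff
    by (rule exI[of _ "\<bar>c\<bar> * B"]) (use B in \<open>auto simp: U_iff abs_mult intro: mult_left_mono\<close>)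
  ultimately show ?thesis
    by (simp add: continuous_on_mult_left)
qed

lemma Cb_dilate:
  assumes "Cb m S a"
  shows "Cb m (U t) (\<lambda>x. c * a (t *\<^sub>R x))"
  using assms
proof (induction m arbitrary: a c)
  case (0 a c)
  then show ?case
    by (rule Cb_0_dilate)
next
  case (Suc m a c)
  have "Cb m (U t) (partial i (\<lambda>x. c * a (t *\<^sub>R x)))" for i
  proof (rule Cb_cong[OF U_open Suc.IH])
    show "Cb m S (partial i a)"
      using Suc.prems by simp
    show "c * t * partial i a (t *\<^sub>R x) = partial i (\<lambda>x. c * a (t *\<^sub>R x)) x" if "x \<in> U t" for x
      using Suc.prems that by (simp add: partial_dilate U_iff)
  qed
  moreover have "Cb 0 (U t) (\<lambda>x. c * a (t *\<^sub>R x))"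
    by (rule Cb_0_dilate[OF Cb_mono[OF Suc.prems]]) simp
  moreover have "(\<lambda>x. c * a (t *\<^sub>R x)) differentiable (at x)" if "x \<in> U t" for x
    using Suc.prems that by (intro partial_dilate) (simp add: U_iff)
  ultimately show ?case
    by simp
qed

lemma vanishing_dilate:
  assumes "t > 0" "Cb m S a" "vanishing m S a"
  shows "vanishing m (U t) (\<lambda>x. c * a (t *\<^sub>R x))"
  using assms(2,3)
proof (induction m arbitrary: a c)
  case (Suc m a c)
  have "vanishing m (U t) (partial i (\<lambda>x. c * a (t *\<^sub>R x)))" for i
  proof (rule vanishing_cong[OF U_open Suc.IH])
    show "Cb m S (partial i a)" "vanishing m S (partial i a)"
      using Suc.prems by simp_all
    show "c * t * partial i a (t *\<^sub>R x) = partial i (\<lambda>x. c * a (t *\<^sub>R x)) x" if "x \<in> U t" for x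
      using Suc.prems that by (simp add: partial_dilate U_iff)
  qed
  moreover have "((\<lambda>x. c * a (t *\<^sub>R x)) \<longlongrightarrow> 0) (at x within U t)" if x: "x \<in> frontier (U t)" for x
  proof -
    have "(a \<longlongrightarrow> 0) (at (t *\<^sub>R x) within S)"
      using Suc.prems(2) frontier_U_scale[OF x] by simp
    moreover have "filterlim (\<lambda>x. t *\<^sub>R x) (at (t *\<^sub>R x) within S) (at x within U t)"
      unfolding filterlim_at
    proof
      show "\<forall>\<^sub>F y in at x within U t. t *\<^sub>R y \<in> S \<and> t *\<^sub>R y \<noteq> t *\<^sub>R x"
        using assms(1) by (auto simp: eventually_at_filter U_iff)
      show "((\<lambda>x. t *\<^sub>R x) \<longlongrightarrow> t *\<^sub>R x) (at x within U t)"
        by (intro tendsto_intros)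
    qed
    ultimately have "((\<lambda>x. a (t *\<^sub>R x)) \<longlongrightarrow> 0) (at x within U t)"
      by (rule filterlim_compose)
    then show ?thesis
      by (rule tendsto_mult_right_zero)
  qed
  ultimately show ?case
    by simp
qed simp

lemma dform_dilate_Suc:
  assumes "Cb (Suc m) S a"
  shows "dform (Suc m) (U t) (\<lambda>x. c * a (t *\<^sub>R x)) b =
    (\<Sum>i\<in>UNIV. dform m (U t) (\<lambda>x. (c * t) * partial i a (t *\<^sub>R x)) (partial i b))"
  unfolding dform.simps
  by (intro sum.cong refl dform_cong U_open) (use assms in \<open>simp_all add: partial_dilate U_iff\<close>)

text \<open>Each of the \<open>m\<close> derivatives contributes a factor \<open>t\<close> on both
  sides, and the substitution contributes \<open>t\<close> to the power \<open>- n\<close>. A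
  quotient of natural powers expresses an exponent that may be negative.\<close>

lemma dform_dilate:
  assumes "t > 0" "Cb m S a"
  shows "dform m (U t) (\<lambda>x. c * a (t *\<^sub>R x)) (\<lambda>x. c * a (t *\<^sub>R x)) =
    c\<^sup>2 * t ^ (2 * m) / t ^ CARD('n) * dform m S a a"
  using assms(2)
proof (induction m arbitrary: a c)
  case base: (0 a c)
  have "dform 0 (U t) (\<lambda>x. c * a (t *\<^sub>R x)) (\<lambda>x. c * a (t *\<^sub>R x)) =
      (\<integral>x. c\<^sup>2 * zero_ext S (\<lambda>x. a x * a x) (t *\<^sub>R x) \<partial>lborel)"
    unfolding dform.simps
    by (intro Bochner_Integration.integral_cong refl) (simp add: zero_ext_def U_iff power2_eq_square)
  also have "\<dots> = c\<^sup>2 * (\<integral>x. zero_ext S (\<lambda>x. a x * a x) (t *\<^sub>R x) \<partial>lborel)"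
    by simp
  also have "(\<integral>x. zero_ext S (\<lambda>x. a x * a x) (t *\<^sub>R x) \<partial>lborel) = (\<integral>x. zero_ext S (\<lambda>x. a x * a x) x \<partial>lborel) / t ^ DIM(real ^ 'n)"
    by (intro lborel_integral_dilate zero_ext_measurable S_open Cb_continuous[OF Cb_mult[OF S_open base base]] assms(1))
  finally show ?case
    by simp
next
  case (Suc m a c)
  have "dform (Suc m) (U t) (\<lambda>x. c * a (t *\<^sub>R x)) (\<lambda>x. c * a (t *\<^sub>R x)) =
      (\<Sum>i\<in>UNIV. dform m (U t) (\<lambda>x. (c * t) * partial i a (t *\<^sub>R x)) (\<lambda>x. (c * t) * partial i a (t *\<^sub>R x)))"
    unfolding dform.simps
    by (intro sum.cong refl dform_cong U_open) (use Suc.prems in \<open>simp_all add: partial_dilate U_iff\<close>)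
  also have "\<dots> = (\<Sum>i\<in>UNIV. (c * t)\<^sup>2 * t ^ (2 * m) / t ^ CARD('n) * dform m S (partial i a) (partial i a))"
    using Suc.prems by (intro sum.cong refl Suc.IH) simp
  also have "\<dots> = (c * t)\<^sup>2 * t ^ (2 * m) / t ^ CARD('n) * dform (Suc m) S a a"
    by (simp add: sum_distrib_left)
  also have "(c * t)\<^sup>2 * t ^ (2 * m) = c\<^sup>2 * t ^ (2 * Suc m)"
    by (simp add: power2_eq_square mult_ac)
  finally show ?case .
qed

text \<open>Points of \<open>S\<close> eventually lie in \<open>U (t j)\<close>, other points never
  do, and bounds on all factors dominate. The sequence \<open>c\<close> varies because a derivative
  turns \<open>c j\<close> into \<open>c j * t j\<close>. In \<open>pohozaev\<close> this serves at
  order \<open>k\<close> with \<open>b = v\<close> and at order \<open>0\<close> with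
  \<open>b = h\<close>.\<close>

lemma dform_dilate_limit:
  assumes t: "t \<longlonglongrightarrow> 1" "\<And>j. t j > 1" and "Cb m S a" "Cb m S b" "c \<longlonglongrightarrow> 1"
  shows "(\<lambda>j. dform m (U (t j)) (\<lambda>x. c j * a (t j *\<^sub>R x)) b) \<longlonglongrightarrow> dform m S a b"
  using assms(3-)
proof (induction m arbitrary: a b c)
  case base: (0 a b c)
  obtain A where A: "A \<ge> 0" "\<And>x. x \<in> S \<Longrightarrow> \<bar>a x\<bar> \<le> A"
    using Cb_bound[OF base(1)] by blast
  obtain B where B: "B \<ge> 0" "\<And>x. x \<in> S \<Longrightarrow> \<bar>b x\<bar> \<le> B"
    using Cb_bound[OF base(2)] by blast
  obtain C where C: "C > 0" "\<And>j. \<bar>c j\<bar> \<le> C"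
    using convergent_imp_bounded[OF base(3)] by (auto simp: bounded_pos)
  show ?case
    unfolding dform.simps
  proof (rule integral_dominated_convergence)
    show "zero_ext S (\<lambda>x. a x * b x) \<in> borel_measurable lborel"
      using zero_ext_measurable[OF S_open Cb_continuous[OF Cb_mult[OF S_open base(1,2)]]] by simp
    show "zero_ext (U (t j)) (\<lambda>x. c j * a (t j *\<^sub>R x) * b x) \<in> borel_measurable lborel" for j
      using zero_ext_measurable[OF U_open Cb_continuous[OF Cb_mult[OF U_open Cb_dilate[OF base(1)]
            Cb_subset[OF base(2) U_subset[OF t(2)]]]]] by simp
    show "integrable lborel (zero_ext S (\<lambda>_. C * A * B))"
      by (rule Cb_zero_ext_integrable[OF S_open S_bounded Cb_const[OF S_open]])
    show "AE x in lborel. (\<lambda>j. zero_ext (U (t j)) (\<lambda>x. c j * a (t j *\<^sub>R x) * b x) x) \<longlonglongrightarrow> zero_ext S (\<lambda>x. a x * b x) x"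
    proof (rule AE_I2)
      fix x
      show "(\<lambda>j. zero_ext (U (t j)) (\<lambda>x. c j * a (t j *\<^sub>R x) * b x) x) \<longlonglongrightarrow> zero_ext S (\<lambda>x. a x * b x) x"
      proof (cases "x \<in> S")
        case True
        have lim: "(\<lambda>j. t j *\<^sub>R x) \<longlonglongrightarrow> x"
          using tendsto_scaleR[OF t(1) tendsto_const[of x]] by simp
        then have ev: "eventually (\<lambda>j. t j *\<^sub>R x \<in> S) sequentially"
          using topological_tendstoD[OF lim S_open True] by simp
        have "isCont a x"
          using Cb_continuous[OF base(1)] S_open True by (simp add: continuous_on_eq_continuous_at)
        then have "(\<lambda>j. a (t j *\<^sub>R x)) \<longlonglongrightarrow> a x"
          by (rule isCont_tendsto_compose[OF _ lim])
        then have "(\<lambda>j. c j * a (t j *\<^sub>R x) * b x) \<longlonglongrightarrow> 1 * a x * b x"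
          by (intro tendsto_mult base(3) tendsto_const)
        then have "(\<lambda>j. zero_ext (U (t j)) (\<lambda>x. c j * a (t j *\<^sub>R x) * b x) x) \<longlonglongrightarrow> 1 * a x * b x"
          by (rule Lim_transform_eventually) (use ev in \<open>eventually_elim, simp add: zero_ext_def U_iff\<close>)
        then show ?thesis
          using True by (simp add: zero_ext_def)
      next
        case False
        then have "x \<notin> U (t j)" for j
          using U_subset[OF t(2)] by blast
        then show ?thesis
          using False by (simp add: zero_ext_def)
      qed
    qed
    show "AE x in lborel. norm (zero_ext (U (t j)) (\<lambda>x. c j * a (t j *\<^sub>R x) * b x) x) \<le> zero_ext S (\<lambda>_. C * A * B) x" for j
    proof (rule AE_I2)
      fix x
      show "norm (zero_ext (U (t j)) (\<lambda>x. c j * a (t j *\<^sub>R x) * b x) x) \<le> zero_ext S (\<lambda>_. C * A * B) x"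
      proof (cases "x \<in> U (t j)")
        case True
        then have x: "x \<in> S" "t j *\<^sub>R x \<in> S"
          using U_subset[OF t(2)[of j]] by (blast, simp add: U_iff)
        have "\<bar>c j * a (t j *\<^sub>R x) * b x\<bar> \<le> C * A * B"
          unfolding abs_mult using A B C x by (intro mult_mono) (auto simp: less_imp_le)
        then show ?thesis
          using True x by (simp add: zero_ext_def)
      next
        case False
        then show ?thesis
          using A(1) B(1) C(1) by (simp add: zero_ext_def)
      qed
    qed
  qed
next
  case (Suc m a b c)
  have ct: "(\<lambda>j. c j * t j) \<longlonglongrightarrow> 1"
    using tendsto_mult[OF Suc.prems(3) t(1)] by simp
  have "(\<lambda>j. \<Sum>i\<in>UNIV. dform m (U (t j)) (\<lambda>x. (c j * t j) * partial i a (t j *\<^sub>R x)) (partial i b)) \<longlonglongrightarrow>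
      (\<Sum>i\<in>UNIV. dform m S (partial i a) (partial i b))"
    using Suc.prems by (intro tendsto_sum Suc.IH ct) simp_all
  then show ?case
    using dform_dilate_Suc[OF Suc.prems(1)] by simp
qed

text \<open>Moving by \<open>\<epsilon>\<close> along the field \<open>x\<close> is the dilation by
  \<open>1 + \<epsilon>\<close>. The limit is thus the right derivative at \<open>t = 1\<close> of
  the pairing of the dilate with \<open>h\<close>.\<close>

lemma integral_euler_quotient:
  assumes a: "Cb 1 S a" "vanishing 1 S a" and h: "Cb 0 S h" and \<epsilon>: "\<epsilon> \<longlonglongrightarrow> 0" "\<And>j. \<epsilon> j > (0::real)"
  shows "(\<lambda>j. ((\<integral>x. zero_ext (U (1 + \<epsilon> j)) (\<lambda>x. a ((1 + \<epsilon> j) *\<^sub>R x) * h x) x \<partial>lborel)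
      - (\<integral>x. zero_ext S (\<lambda>x. a x * h x) x \<partial>lborel)) / \<epsilon> j) \<longlonglongrightarrow> (\<integral>x. zero_ext S (\<lambda>x. euler a x * h x) x \<partial>lborel)"
proof -
  obtain C where C: "\<And>x. x \<in> S \<Longrightarrow> norm x \<le> C"
    using S_bounded by (auto simp: bounded_iff)
  have a0: "Cb 0 S a"
    using a(1) by simp
  have "(\<lambda>j. \<integral>x. (zero_ext S a (x + \<epsilon> j *\<^sub>R x) - zero_ext S a x) / \<epsilon> j * zero_ext S h x \<partial>lborel) \<longlonglongrightarrow>
     (\<integral>x. zero_ext S (\<lambda>x. \<Sum>i\<in>UNIV. x $ i * partial i a x) x * zero_ext S h x \<partial>lborel)"
  proof (rule zero_ext_diff_quotient_integral[OF S_open negligible_frontier a, of "\<lambda>x. x"])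
    show "integrable lborel (zero_ext S h)"
      by (rule Cb_zero_ext_integrable[OF S_open S_bounded h])
    show "norm x \<le> C" if "zero_ext S h x \<noteq> 0" for x
      using that C by (auto simp: zero_ext_def split: if_splits)
    show "\<epsilon> j \<noteq> 0" for j
      using \<epsilon>(2)[of j] by simp
  qed (use \<epsilon>(1) in auto)
  also have "(\<lambda>x. zero_ext S (\<lambda>x. \<Sum>i\<in>UNIV. x $ i * partial i a x) x * zero_ext S h x) = zero_ext S (\<lambda>x. euler a x * h x)"
    by (simp add: fun_eq_iff zero_ext_def euler_def)
  finally have lim: "(\<lambda>j. \<integral>x. (zero_ext S a (x + \<epsilon> j *\<^sub>R x) - zero_ext S a x) / \<epsilon> j * zero_ext S h x \<partial>lborel) \<longlonglongrightarrow>
      (\<integral>x. zero_ext S (\<lambda>x. euler a x * h x) x \<partial>lborel)" .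
  have "(\<integral>x. (zero_ext S a (x + \<epsilon> j *\<^sub>R x) - zero_ext S a x) / \<epsilon> j * zero_ext S h x \<partial>lborel) =
      ((\<integral>x. zero_ext (U (1 + \<epsilon> j)) (\<lambda>x. a ((1 + \<epsilon> j) *\<^sub>R x) * h x) x \<partial>lborel)
      - (\<integral>x. zero_ext S (\<lambda>x. a x * h x) x \<partial>lborel)) / \<epsilon> j" for j
  proof -
    let ?t = "1 + \<epsilon> j"
    have t: "?t > 1"
      using \<epsilon>(2)[of j] by simp
    have i1: "integrable lborel (zero_ext (U ?t) (\<lambda>x. a (?t *\<^sub>R x) * h x))"
      using Cb_zero_ext_integrable[OF U_open U_bounded[OF t] Cb_mult[OF U_open Cb_dilate[OF a0, of _ 1]
            Cb_subset[OF h U_subset[OF t]]]] by simp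
    have i2: "integrable lborel (zero_ext S (\<lambda>x. a x * h x))"
      by (rule Cb_zero_ext_integrable[OF S_open S_bounded Cb_mult[OF S_open a0 h]])
    have "(zero_ext S a (x + \<epsilon> j *\<^sub>R x) - zero_ext S a x) / \<epsilon> j * zero_ext S h x =
        (zero_ext (U ?t) (\<lambda>x. a (?t *\<^sub>R x) * h x) x - zero_ext S (\<lambda>x. a x * h x) x) / \<epsilon> j" for x
    proof -
      have "x + \<epsilon> j *\<^sub>R x = ?t *\<^sub>R x"
        by (simp add: scaleR_add_left)
      moreover have "x \<in> S" if "?t *\<^sub>R x \<in> S"
        using U_subset[OF t] that by (auto simp: U_iff)
      ultimately show ?thesis
        by (auto simp: zero_ext_def U_iff left_diff_distrib)
    qed
    then have "(\<integral>x. (zero_ext S a (x + \<epsilon> j *\<^sub>R x) - zero_ext S a x) / \<epsilon> j * zero_ext S h x \<partial>lborel) =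
        (\<integral>x. (zero_ext (U ?t) (\<lambda>x. a (?t *\<^sub>R x) * h x) x - zero_ext S (\<lambda>x. a x * h x) x) / \<epsilon> j \<partial>lborel)"
      by (simp only:)
    then show ?thesis
      using i1 i2 by (simp only: integral_divide_zero Bochner_Integration.integral_diff)
  qed
  then show ?thesis
    using lim by (simp only:)
qed

section \<open>Right derivatives at the dilation factor 1\<close>

lemma inverse_Suc_seq:
  "(\<lambda>j. inverse (real (Suc j))) \<longlonglongrightarrow> 0" "inverse (real (Suc j)) > 0"
  by (rule LIMSEQ_inverse_real_of_nat) simp

lemma power_quotient_limit:
  fixes \<epsilon> :: "nat \<Rightarrow> real"
  assumes "\<epsilon> \<longlonglongrightarrow> 0" "\<And>j. \<epsilon> j > 0"
  shows "(\<lambda>j. ((1 + \<epsilon> j) ^ p / (1 + \<epsilon> j) ^ q - 1) / \<epsilon> j) \<longlonglongrightarrow> real p - real q"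
proof -
  have "((\<lambda>t :: real. t ^ p / t ^ q) has_real_derivative (real p - real q)) (at 1)"
    by (auto intro!: derivative_eq_intros)
  then show ?thesis
    using diff_quotient_tendsto[of "\<lambda>t. t ^ p / t ^ q" "(*) (real p - real q)" 1 \<epsilon> 1] assms
    by (simp add: has_field_derivative_def less_imp_neq[THEN not_sym])
qed

text \<open>The divergence theorem for the field \<open>a x\<close> with \<open>a = 0\<close> on the
  boundary, obtained by differentiating at \<open>t = 1\<close> the rule that the integral of
  \<open>a (t x)\<close> is \<open>t\<close> to the power \<open>- n\<close> times that of
  \<open>a\<close>.\<close>

lemma integral_euler:
  assumes a: "Cb 1 S a" "vanishing 1 S a"
  shows "(\<integral>x. zero_ext S (euler a) x \<partial>lborel) = - real CARD('n) * (\<integral>x. zero_ext S a x \<partial>lborel)"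
proof -
  define \<epsilon> :: "nat \<Rightarrow> real" where "\<epsilon> j = inverse (real (Suc j))" for j
  have \<epsilon>: "\<epsilon> \<longlonglongrightarrow> 0" "\<epsilon> j > 0" for j
    unfolding \<epsilon>_def by (rule inverse_Suc_seq)+
  let ?J = "\<integral>x. zero_ext S a x \<partial>lborel"
  have "(\<integral>x. zero_ext (U (1 + \<epsilon> j)) (\<lambda>x. a ((1 + \<epsilon> j) *\<^sub>R x) * 1) x \<partial>lborel) = ?J / (1 + \<epsilon> j) ^ CARD('n)" for j
  proof -
    have "(\<integral>x. zero_ext (U (1 + \<epsilon> j)) (\<lambda>x. a ((1 + \<epsilon> j) *\<^sub>R x) * 1) x \<partial>lborel) =
        (\<integral>x. zero_ext S a ((1 + \<epsilon> j) *\<^sub>R x) \<partial>lborel)"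
      by (intro Bochner_Integration.integral_cong refl) (simp add: zero_ext_def U_iff)
    also have "\<dots> = ?J / (1 + \<epsilon> j) ^ DIM(real ^ 'n)"
      using \<epsilon>(2)[of j] by (intro lborel_integral_dilate zero_ext_measurable S_open Cb_continuous[OF a(1)]) auto
    finally show ?thesis
      by simp
  qed
  then have lim: "(\<lambda>j. (?J / (1 + \<epsilon> j) ^ CARD('n) - ?J) / \<epsilon> j) \<longlonglongrightarrow> (\<integral>x. zero_ext S (euler a) x \<partial>lborel)"
    using integral_euler_quotient[OF a Cb_const[OF S_open, of 0 1] \<epsilon>] by simp
  have "(\<lambda>j. ?J * (((1 + \<epsilon> j) ^ 0 / (1 + \<epsilon> j) ^ CARD('n) - 1) / \<epsilon> j)) \<longlonglongrightarrow> ?J * (real 0 - real CARD('n))"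
    by (intro tendsto_mult_left power_quotient_limit \<epsilon>)
  moreover have "?J * (((1 + \<epsilon> j) ^ 0 / (1 + \<epsilon> j) ^ CARD('n) - 1) / \<epsilon> j) = (?J / (1 + \<epsilon> j) ^ CARD('n) - ?J) / \<epsilon> j" for j
    by (simp add: right_diff_distrib)
  ultimately have "(\<lambda>j. (?J / (1 + \<epsilon> j) ^ CARD('n) - ?J) / \<epsilon> j) \<longlonglongrightarrow> ?J * (real 0 - real CARD('n))"
    by (simp only:)
  then have "(\<integral>x. zero_ext S (euler a) x \<partial>lborel) = ?J * (real 0 - real CARD('n))"
    by (rule LIMSEQ_unique[OF lim])
  then show ?thesis
    by simp
qed

text \<open>
  Testing with the dilates of \<open>v\<close>, which are compactly supported in \<open>S\<close>, avoids the boundary: the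
  boundary term of Pohozaev's identity has a sign, and \<open>dform_le_average\<close> discards it.
\<close>
lemma pohozaev:
  assumes k: "k > 0" and v: "Cb (2 * k) S v" "vanishing k S v"
    and h: "\<And>x. h x = (- 1) ^ k * (lap ^^ k) v x"
  shows "(\<integral>x. zero_ext S (\<lambda>x. euler v x * h x) x \<partial>lborel) \<le>
    (real (2 * k) - real CARD('n)) / 2 * (\<integral>x. zero_ext S (\<lambda>x. v x * h x) x \<partial>lborel)"
proof -
  define \<epsilon> :: "nat \<Rightarrow> real" where "\<epsilon> j = inverse (real (Suc j))" for j
  have \<epsilon>: "\<epsilon> \<longlonglongrightarrow> 0" "\<epsilon> j > 0" for j
    unfolding \<epsilon>_def by (rule inverse_Suc_seq)+
  define t where "t j = 1 + \<epsilon> j" for j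
  have t1: "t \<longlonglongrightarrow> 1" and t: "t j > 1" for j
    using tendsto_add[OF tendsto_const[of 1] \<epsilon>(1)] \<epsilon>(2)[of j] by (simp_all add: t_def[abs_def])
  have vk: "Cb k S v" and v1: "Cb 1 S v" and v0: "Cb 0 S v"
    using k by (auto intro!: Cb_mono[OF v(1)] simp del: Cb.simps)
  have van1: "vanishing 1 S v"
    using k v(2) by (cases k) auto
  have h0: "Cb 0 S h"
  proof (rule Cb_cong[OF S_open])
    show "Cb 0 S (\<lambda>x. (- 1) ^ k * (lap ^^ k) v x)"
      using v(1) by (intro Cb_cmult S_open Cb_lap_iter) simp
  qed (simp add: h)
  define I where "I j = (\<integral>x. zero_ext (U (t j)) (\<lambda>x. v (t j *\<^sub>R x) * h x) x \<partial>lborel)" for j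
  define J where "J = (\<integral>x. zero_ext S (\<lambda>x. v x * h x) x \<partial>lborel)"
  \<comment> \<open>The factor \<open>1\<close> keeps the shape \<open>c * a (t *\<^sub>R x)\<close>
    of the dilation lemmas.\<close>
  have vt: "Cb k (U (t j)) (\<lambda>x. 1 * v (t j *\<^sub>R x))" for j
    by (rule Cb_dilate[OF vk])
  have vt_van: "vanishing k (U (t j)) (\<lambda>x. v (t j *\<^sub>R x))" for j
    using vanishing_dilate[OF _ vk v(2), of "t j" 1] t[of j] by simp
  have I_form: "I j = dform k (U (t j)) (\<lambda>x. 1 * v (t j *\<^sub>R x)) v" for j
  proof -
    have "I j = (\<integral>x. (- 1) ^ k * zero_ext (U (t j)) (\<lambda>x. 1 * v (t j *\<^sub>R x) * (lap ^^ k) v x) x \<partial>lborel)"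
      unfolding I_def by (intro Bochner_Integration.integral_cong refl) (simp add: zero_ext_def h)
    also have "\<dots> = (- 1) ^ k * (\<integral>x. zero_ext (U (t j)) (\<lambda>x. 1 * v (t j *\<^sub>R x) * (lap ^^ k) v x) x \<partial>lborel)"
      by simp
    also have "(\<integral>x. zero_ext (U (t j)) (\<lambda>x. 1 * v (t j *\<^sub>R x) * (lap ^^ k) v x) x \<partial>lborel) =
        (- 1) ^ k * dform k (U (t j)) (\<lambda>x. 1 * v (t j *\<^sub>R x)) v"
      by (rule dform_lap_iter[OF U_open closure_U[OF t] _ S_open S_bounded vt _ v(1)])
         (use t[of j] in \<open>auto intro!: negligible_frontier_U simp: vt_van\<close>)
    finally show ?thesis
      by (simp flip: power_mult_distrib mult.assoc)
  qed
  \<comment> \<open>Letting the dilates return to \<open>v\<close> gives the energy identity on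
    \<open>S\<close> itself, where a direct integration by parts would have to meet the
    boundary.\<close>
  have "I \<longlonglongrightarrow> dform k S v v"
    unfolding I_form[abs_def] by (rule dform_dilate_limit[OF t1 t vk vk tendsto_const])
  moreover have "I \<longlonglongrightarrow> J"
    using dform_dilate_limit[OF t1 t v0 h0 tendsto_const] by (simp add: I_def[abs_def] J_def)
  ultimately have E: "dform k S v v = J"
    by (rule LIMSEQ_unique)
  have le: "I j \<le> (t j ^ (2 * k) / t j ^ CARD('n) * J + J) / 2" for j
  proof -
    have "I j \<le> (dform k (U (t j)) (\<lambda>x. 1 * v (t j *\<^sub>R x)) (\<lambda>x. 1 * v (t j *\<^sub>R x)) + dform k (U (t j)) v v) / 2"
      unfolding I_form
      by (rule dform_le_average[OF U_open U_bounded[OF t] vt Cb_subset[OF vk U_subset[OF t]]])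
    also have "dform k (U (t j)) (\<lambda>x. 1 * v (t j *\<^sub>R x)) (\<lambda>x. 1 * v (t j *\<^sub>R x)) = t j ^ (2 * k) / t j ^ CARD('n) * J"
      using t[of j] by (subst dform_dilate[OF _ vk]) (simp_all add: E)
    also have "dform k (U (t j)) v v \<le> J"
      using dform_mono[OF U_open U_subset[OF t] S_open S_bounded vk] by (simp add: E)
    finally show ?thesis
      by simp
  qed
  have "(\<lambda>j. (I j - J) / \<epsilon> j) \<longlonglongrightarrow> (\<integral>x. zero_ext S (\<lambda>x. euler v x * h x) x \<partial>lborel)"
    using integral_euler_quotient[OF v1 van1 h0 \<epsilon>] by (simp add: I_def J_def t_def)
  moreover have "(\<lambda>j. ((1 + \<epsilon> j) ^ (2 * k) / (1 + \<epsilon> j) ^ CARD('n) - 1) / \<epsilon> j * (J / 2)) \<longlonglongrightarrow>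
      (real (2 * k) - real CARD('n)) * (J / 2)"
    by (intro tendsto_mult_right power_quotient_limit \<epsilon>)
  moreover have "(I j - J) / \<epsilon> j \<le> ((1 + \<epsilon> j) ^ (2 * k) / (1 + \<epsilon> j) ^ CARD('n) - 1) / \<epsilon> j * (J / 2)" for j
  proof -
    have "I j - J \<le> (t j ^ (2 * k) / t j ^ CARD('n) - 1) * (J / 2)"
      using le[of j] by (simp add: field_simps)
    from divide_right_mono[OF this less_imp_le[OF \<epsilon>(2)[of j]]] show ?thesis
      by (simp add: t_def mult_ac)
  qed
  ultimately have "(\<integral>x. zero_ext S (\<lambda>x. euler v x * h x) x \<partial>lborel) \<le> (real (2 * k) - real CARD('n)) * (J / 2)"
    by (intro LIMSEQ_le) auto
  then show ?thesis
    by (simp add: J_def)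
qed

end

section \<open>Geometry of star-shaped domains\<close>

text \<open>The distance to a fixed point \<open>y\<close> of the set tends to infinity at the unit
  sphere, since the denominator inside \<open>arcosh\<close> tends to \<open>0\<close> while
  \<open>norm (x - y)\<close> stays bounded below.\<close>

lemma hyp_bounded_imp_cball:
  fixes \<Omega> :: "(real ^ 'n) set"
  assumes "\<Omega> \<subseteq> ball 0 1" "\<Omega> \<noteq> {}" "hyp_bounded \<Omega>"
  obtains r where "r < 1" "\<Omega> \<subseteq> cball 0 r"
proof -
  obtain y where y: "y \<in> \<Omega>"
    using assms(2) by blast
  obtain R where R: "\<And>x. x \<in> \<Omega> \<Longrightarrow> hyp_dist x y \<le> R"
    using assms(3) y by (auto simp: hyp_bounded_def)
  define p where "p = norm y"
  define d where "d = (1 - p) / 2"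
  define C where "C = cosh R"
  have p: "0 \<le> p" "p < 1" "d > 0" and C: "C > 0"
    using y assms(1) by (auto simp: p_def d_def C_def)
  \<comment> \<open>Up to the midpoint \<open>(1 + p) / 2\<close> between \<open>norm y\<close> and
    \<open>1\<close> nothing has to be shown. Beyond it, \<open>x\<close> and \<open>y\<close> are
    at least \<open>d\<close> apart, so the distance bound gives
    \<open>2 * d\<^sup>2 / C \<le> 1 - (norm x)\<^sup>2\<close>, and
    \<open>2 * norm x \<le> 1 + (norm x)\<^sup>2\<close> gives the second bound.\<close>
  define r where "r = max ((1 + p) / 2) (1 - d\<^sup>2 / C)"
  have "norm x \<le> r" if x: "x \<in> \<Omega>" for x
  proof (cases "norm x \<le> (1 + p) / 2")
    case False
    have x1: "norm x < 1"
      using x assms(1) by auto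
    have pos: "1 - (norm x)\<^sup>2 > 0" "1 - p\<^sup>2 > 0" "1 - p\<^sup>2 \<le> 1"
      using x1 p by (simp_all add: power_less_one_iff)
    let ?A = "(norm (x - y))\<^sup>2" and ?B = "(1 - (norm x)\<^sup>2) * (1 - p\<^sup>2)"
    have B: "?B > 0"
      using pos by simp
    have z: "1 + 2 * ?A / ?B \<ge> 1"
      using B by simp
    have "arcosh (1 + 2 * ?A / ?B) \<le> R"
      using R[OF x] by (simp add: hyp_dist_def p_def)
    moreover have "0 \<le> arcosh (1 + 2 * ?A / ?B)"
      using z by (rule arcosh_nonneg_real)
    ultimately have "cosh (arcosh (1 + 2 * ?A / ?B)) \<le> C"
      unfolding C_def by (subst cosh_real_nonneg_le_iff) auto
    then have "2 * ?A / ?B \<le> C"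
      using z by (simp add: cosh_arcosh_real)
    then have "2 * ?A \<le> C * ?B"
      using B by (simp add: pos_divide_le_eq)
    also have "\<dots> \<le> C * ((1 - (norm x)\<^sup>2) * 1)"
      using C pos by (intro mult_left_mono) auto
    finally have A: "2 * ?A \<le> C * (1 - (norm x)\<^sup>2)"
      by simp
    have "d \<le> norm (x - y)"
      using norm_triangle_ineq2[of x y] False by (simp add: d_def p_def field_simps)
    then have "d\<^sup>2 \<le> ?A"
      using p by (intro power_mono) auto
    with A have "2 * d\<^sup>2 \<le> C * (1 - (norm x)\<^sup>2)"
      by simp
    then have "2 * d\<^sup>2 / C \<le> 1 - (norm x)\<^sup>2"
      using C by (simp add: pos_divide_le_eq mult.commute)
    moreover have "2 * norm x \<le> 1 + (norm x)\<^sup>2"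
      using sum_squares_bound[of 1 "norm x"] by simp
    ultimately show ?thesis
      by (simp add: r_def)
  qed (auto simp: r_def le_max_iff_disj)
  moreover have "r < 1"
    using p C by (simp add: r_def)
  ultimately show ?thesis
    by (intro that[of r]) auto
qed

lemma hyp_inner_eq: "hyp_inner x v w = 4 / (1 - (norm x)\<^sup>2)\<^sup>2 * (v \<bullet> w)"
  by (simp add: hyp_inner_def hyp_metric_def scaleR_matrix_vector_assoc[symmetric])

locale star_shaped_domain =
  fixes \<Omega> :: "(real ^ 'n) set" and r :: real
  assumes \<Omega>_open: "open \<Omega>" and \<Omega>_nonempty: "\<Omega> \<noteq> {}" and \<Omega>_cball: "\<Omega> \<subseteq> cball 0 r" and r_less: "r < 1"
    and C1: "C1_boundary \<Omega>" and star: "star_shaped \<Omega>"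
begin

lemma frontier_norm: "x \<in> frontier \<Omega> \<Longrightarrow> norm x < 1"
proof -
  have "closure \<Omega> \<subseteq> cball 0 r"
    using \<Omega>_cball by (intro closure_minimal) auto
  then show "x \<in> frontier \<Omega> \<Longrightarrow> norm x < 1"
    using r_less by (force simp: frontier_def)
qed

text \<open>The metric is conformal, so the sign of the hyperbolic product is that of the Euclidean
  one. The origin is covered too: there \<open>radial_field\<close> is \<open>0\<close>, so
  star-shapedness keeps it off the frontier.\<close>

lemma normal_radial:
  assumes x: "x \<in> frontier \<Omega>" and D: "C1_defining \<Omega> x \<phi> D"
  shows "D x \<bullet> x > 0"
proof -
  define K where "K = 4 / (1 - (norm x)\<^sup>2)\<^sup>2"
  have pos: "1 - (norm x)\<^sup>2 > 0"
    using frontier_norm[OF x] by (simp add: power_less_one_iff)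
  then have K: "K > 0"
    by (simp add: K_def)
  have Dx: "D x \<noteq> 0"
    using D by (simp add: C1_defining_def)
  \<comment> \<open>Scales \<open>D x\<close> to hyperbolic length 1, the squared length being
    \<open>K\<close> times the Euclidean one.\<close>
  define c where "c = 1 / (sqrt K * norm (D x))"
  have c: "c > 0"
    using K Dx by (simp add: c_def)
  have "hyp_inner x (c *\<^sub>R D x) (c *\<^sub>R D x) = K * (c\<^sup>2 * (norm (D x))\<^sup>2)"
    unfolding hyp_inner_eq K_def by (simp add: power2_norm_eq_inner power2_eq_square[of c])
  also have "\<dots> = 1"
    using K Dx by (simp add: c_def power_divide power_mult_distrib)
  finally have "outer_unit_normal \<Omega> x (c *\<^sub>R D x)"
    unfolding outer_unit_normal_def using D c by blast
  then have "hyp_inner x (c *\<^sub>R D x) (radial_field x) > 0"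
    using star x by (auto simp: star_shaped_def)
  also have "hyp_inner x (c *\<^sub>R D x) (radial_field x) = K * (c * ((1 - (norm x)\<^sup>2) / 2 * (inverse (norm x) * (D x \<bullet> x))))"
    unfolding hyp_inner_eq K_def radial_field_def sgn_div_norm inner_scaleR_left inner_scaleR_right by (simp only: mult_ac)
  also have "\<dots> = (K * c * ((1 - (norm x)\<^sup>2) / 2) * inverse (norm x)) * (D x \<bullet> x)"
    by (simp only: mult.assoc)
  finally have gt: "(K * c * ((1 - (norm x)\<^sup>2) / 2) * inverse (norm x)) * (D x \<bullet> x) > 0" .
  have "0 \<le> K * c * ((1 - (norm x)\<^sup>2) / 2) * inverse (norm x)"
    using K c pos by simp
  with gt show ?thesis
    using zero_less_mult_iff[of "K * c * ((1 - (norm x)\<^sup>2) / 2) * inverse (norm x)" "D x \<bullet> x"] by linarith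
qed

text \<open>Along the ray the defining function has derivative \<open>D x \<bullet> x > 0\<close> at
  parameter \<open>1\<close>. It therefore passes from negative to positive values, and positive
  values exclude both the domain and its frontier.\<close>

lemma frontier_ray:
  assumes x: "x \<in> frontier \<Omega>"
  obtains d where "d > 0" "\<And>s. 1 - d < s \<Longrightarrow> s < 1 \<Longrightarrow> s *\<^sub>R x \<in> \<Omega>"
    "\<And>s. 1 < s \<Longrightarrow> s < 1 + d \<Longrightarrow> s *\<^sub>R x \<notin> closure \<Omega>"
proof -
  obtain \<phi> D where \<phi>: "C1_defining \<Omega> x \<phi> D"
    using C1 x by (auto simp: C1_boundary_def)
  then obtain \<delta> where \<delta>: "\<delta> > 0" "\<And>y. y \<in> ball x \<delta> \<Longrightarrow> GDERIV \<phi> y :> D y"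
      "\<Omega> \<inter> ball x \<delta> = {y \<in> ball x \<delta>. \<phi> y < 0}" "frontier \<Omega> \<inter> ball x \<delta> = {y \<in> ball x \<delta>. \<phi> y = 0}"
    unfolding C1_defining_def by blast
  have \<phi>x: "\<phi> x = 0"
    using \<delta>(1,4) x by force
  have line: "((\<lambda>s. s *\<^sub>R x) has_derivative (\<lambda>s. s *\<^sub>R x)) (at 1)"
    by (auto intro!: derivative_eq_intros)
  have "(\<phi> has_derivative (\<lambda>h. h \<bullet> D x)) (at (1 *\<^sub>R x))"
    using \<delta>(1,2) by (simp add: gderiv_def)
  have eq: "(*) (D x \<bullet> x) = (\<lambda>s. (s *\<^sub>R x) \<bullet> D x)"
    by (simp add: fun_eq_iff inner_commute mult.commute)
  from has_derivative_compose[OF line \<open>(\<phi> has_derivative _) _\<close>]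
  have "((\<lambda>s. \<phi> (s *\<^sub>R x)) has_real_derivative (D x \<bullet> x)) (at 1)"
    unfolding has_field_derivative_def eq .
  note deriv = this normal_radial[OF x \<phi>]
  obtain d1 where d1: "d1 > 0" "\<And>h. 0 < h \<Longrightarrow> h < d1 \<Longrightarrow> \<phi> (1 *\<^sub>R x) < \<phi> ((1 + h) *\<^sub>R x)"
    using DERIV_pos_inc_right[OF deriv] by blast
  obtain d2 where d2: "d2 > 0" "\<And>h. 0 < h \<Longrightarrow> h < d2 \<Longrightarrow> \<phi> ((1 - h) *\<^sub>R x) < \<phi> (1 *\<^sub>R x)"
    using DERIV_pos_inc_left[OF deriv] by blast
  define d3 where "d3 = \<delta> / (norm x + 1)"
  have d3: "d3 > 0"
    using \<delta>(1) by (simp add: d3_def add_nonneg_pos)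
  have near: "s *\<^sub>R x \<in> ball x \<delta>" if "\<bar>s - 1\<bar> < d3" for s
  proof -
    have "x - s *\<^sub>R x = (1 - s) *\<^sub>R x"
      by (simp add: algebra_simps)
    then have "dist x (s *\<^sub>R x) = \<bar>1 - s\<bar> * norm x"
      by (simp add: dist_norm)
    also have "\<dots> \<le> \<bar>1 - s\<bar> * (norm x + 1)"
      by (intro mult_left_mono) auto
    also have "\<dots> < d3 * (norm x + 1)"
      using that by (intro mult_strict_right_mono) (auto simp: abs_minus_commute add_nonneg_pos)
    also have "\<dots> = \<delta>"
      using add_nonneg_pos[OF norm_ge_zero[of x] zero_less_one] by (simp add: d3_def)
    finally show ?thesis
      by simp
  qed
  show ?thesis
  proof (rule that[of "min d1 (min d2 d3)"])
    show "min d1 (min d2 d3) > 0"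
      using d1(1) d2(1) d3 by simp
    show "s *\<^sub>R x \<in> \<Omega>" if s: "1 - min d1 (min d2 d3) < s" "s < 1" for s
    proof -
      have "\<phi> (s *\<^sub>R x) < 0"
        using d2(2)[of "1 - s"] s \<phi>x by simp
      moreover have "s *\<^sub>R x \<in> ball x \<delta>"
        using s by (intro near) auto
      ultimately show ?thesis
        using \<delta>(3) by blast
    qed
    show "s *\<^sub>R x \<notin> closure \<Omega>" if s: "1 < s" "s < 1 + min d1 (min d2 d3)" for s
    proof
      assume cl: "s *\<^sub>R x \<in> closure \<Omega>"
      have "\<phi> (s *\<^sub>R x) > 0"
        using d1(2)[of "s - 1"] s \<phi>x by simp
      moreover have "s *\<^sub>R x \<in> ball x \<delta>"
        using s by (intro near) auto
      ultimately have "s *\<^sub>R x \<notin> \<Omega>" "s *\<^sub>R x \<notin> frontier \<Omega>"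
        using \<delta>(3,4) by force+
      with cl show False
        by (simp add: frontier_def interior_open \<Omega>_open)
    qed
  qed
qed

text \<open>If the segment to the origin left the domain, consider the largest parameter
  \<open>s0\<close> at which it is outside. That point lies on the frontier, and by
  \<open>frontier_ray\<close> the ray just beyond it avoids the closure, although by maximality it
  is inside.\<close>

lemma ray_inside:
  assumes x: "x \<in> \<Omega>" and t: "0 \<le> t" "t \<le> 1"
  shows "t *\<^sub>R x \<in> \<Omega>"
proof (rule ccontr)
  assume nt: "t *\<^sub>R x \<notin> \<Omega>"
  define T where "T = {0..1} \<inter> (\<lambda>s. s *\<^sub>R x) -` (- \<Omega>)"
  have "closed ((\<lambda>s. s *\<^sub>R x) -` (- \<Omega>))"
    using \<Omega>_open by (intro closed_vimage continuous_intros) (simp add: closed_def)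
  then have "compact T" "T \<noteq> {}"
    using nt t by (auto simp: T_def compact_Int_closed)
  then obtain s0 where s0: "s0 \<in> T" "\<And>s. s \<in> T \<Longrightarrow> s \<le> s0"
    using compact_attains_sup by metis
  have s01: "0 \<le> s0" "s0 \<le> 1" "s0 *\<^sub>R x \<notin> \<Omega>"
    using s0(1) by (auto simp: T_def)
  then have "s0 < 1"
    using x by (cases "s0 = 1") auto
  have in\<Omega>: "s *\<^sub>R x \<in> \<Omega>" if "s0 < s" "s \<le> 1" for s
    using s0(2)[of s] that s01(1) by (auto simp: T_def)
  define e where "e n = inverse (real (Suc n))" for n
  have e: "0 < e n" "e n \<le> 1" for n
    by (simp_all add: e_def inverse_le_1_iff)
  have "(\<lambda>n. (s0 + e n * (1 - s0)) *\<^sub>R x) \<longlonglongrightarrow> (s0 + 0 * (1 - s0)) *\<^sub>R x"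
    unfolding e_def by (intro tendsto_intros LIMSEQ_inverse_real_of_nat)
  moreover have "(s0 + e n * (1 - s0)) *\<^sub>R x \<in> \<Omega>" for n
  proof (rule in\<Omega>)
    show "s0 < s0 + e n * (1 - s0)"
      using e[of n] \<open>s0 < 1\<close> by simp
    have "e n * (1 - s0) \<le> 1 * (1 - s0)"
      using e[of n] \<open>s0 < 1\<close> by (intro mult_right_mono) auto
    then show "s0 + e n * (1 - s0) \<le> 1"
      by simp
  qed
  ultimately have "(s0 + 0 * (1 - s0)) *\<^sub>R x \<in> closure \<Omega>"
    unfolding closure_sequential by (intro exI[of _ "\<lambda>n. (s0 + e n * (1 - s0)) *\<^sub>R x"]) blast
  then have "s0 *\<^sub>R x \<in> closure \<Omega>"
    by simp
  then have fr: "s0 *\<^sub>R x \<in> frontier \<Omega>"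
    using s01(3) by (simp add: frontier_def interior_open \<Omega>_open)
  then obtain d where d: "d > 0" "\<And>s. 1 < s \<Longrightarrow> s < 1 + d \<Longrightarrow> s *\<^sub>R (s0 *\<^sub>R x) \<notin> closure \<Omega>"
    using frontier_ray by metis
  show False
  proof (cases "s0 = 0")
    \<comment> \<open>All multiples of the origin coincide, so the frontier point would lie outside
      the closure.\<close>
    case True
    then have "(1 + d / 2) *\<^sub>R (s0 *\<^sub>R x) = s0 *\<^sub>R x"
      by simp
    then show False
      using d(2)[of "1 + d / 2"] d(1) fr by (simp add: frontier_def del: scaleR_scaleR)
  next
    case False
    then have "s0 > 0"
      using s01(1) by simp
    \<comment> \<open>The cap \<open>1 + d / 2\<close> keeps \<open>s\<close> in the range excluded
      by \<open>frontier_ray\<close>, and \<open>1 / s0\<close> keeps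
      \<open>s * s0 \<le> 1\<close>.\<close>
    define s where "s = min (1 + d / 2) (1 / s0)"
    have s: "1 < s" "s < 1 + d" "s \<le> 1 / s0"
      using d(1) \<open>s0 > 0\<close> \<open>s0 < 1\<close> by (auto simp: s_def)
    have "(s * s0) *\<^sub>R x \<in> \<Omega>"
      using s \<open>s0 > 0\<close> by (intro in\<Omega>) (simp_all add: pos_le_divide_eq)
    then show False
      using d(2)[OF s(1,2)] closure_subset by auto
  qed
qed

text \<open>A frontier point is first moved inward by a factor \<open>s\<close> with
  \<open>t < s < 1\<close>, then contracted within the domain by \<open>t / s\<close>.\<close>

lemma ray_closure:
  assumes x: "x \<in> closure \<Omega>" and t: "0 \<le> t" "t < 1"
  shows "t *\<^sub>R x \<in> \<Omega>"
proof (cases "x \<in> \<Omega>")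
  case True
  then show ?thesis
    using ray_inside t by simp
next
  case False
  then have "x \<in> frontier \<Omega>"
    using x by (simp add: frontier_def interior_open \<Omega>_open)
  then obtain d where d: "d > 0" "\<And>s. 1 - d < s \<Longrightarrow> s < 1 \<Longrightarrow> s *\<^sub>R x \<in> \<Omega>"
    using frontier_ray by metis
  obtain s where s: "max t (1 - d) < s" "s < 1"
    using dense[of "max t (1 - d)" 1] t d(1) by auto
  have "(t / s) *\<^sub>R (s *\<^sub>R x) \<in> \<Omega>"
    using s t by (intro ray_inside[OF d(2)]) auto
  then show ?thesis
    using s t by simp
qed

end

sublocale star_shaped_domain \<subseteq> hyp: hyp_region \<Omega> r
  by unfold_locales (fact \<Omega>_open \<Omega>_cball r_less)+

sublocale star_shaped_domain \<subseteq> reg: star_region \<Omega>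
proof
  show "open \<Omega>"
    by (fact \<Omega>_open)
  show "bounded \<Omega>"
    using \<Omega>_cball bounded_cball by (rule bounded_subset[rotated])
qed (rule ray_closure)

section \<open>Nonexistence\<close>

lemma continuous_on_abs_powr:
  fixes p :: real
  assumes "p > 0"
  shows "continuous_on A (\<lambda>s. \<bar>s\<bar> powr p * s)"
  using assms by (intro continuous_on_mult continuous_on_powr' continuous_intros) auto

text \<open>At \<open>s = 0\<close> the difference quotient equals
  \<open>\<bar>h\<bar> powr (p - 2) * h\<close>, which is continuous with value \<open>0\<close> at
  \<open>h = 0\<close>.\<close>

lemma DERIV_abs_powr:
  fixes s p :: real
  assumes "p > 2"
  shows "((\<lambda>s. \<bar>s\<bar> powr p) has_real_derivative p * (\<bar>s\<bar> powr (p - 2) * s)) (at s)"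
proof -
  have pow: "t powr (p - 1) = t powr (p - 2) * t" if "t > 0" for t :: real
    using that powr_mult_base[of t "p - 2"] by (simp add: mult.commute)
  consider "s > 0" | "s < 0" | "s = 0"
    by linarith
  then show ?thesis
  proof cases
    case 1
    have "((\<lambda>s. \<bar>s\<bar> powr p) has_real_derivative p * s powr (p - 1)) (at s)"
      by (rule has_field_derivative_transform_within_open[OF has_real_derivative_powr[OF 1], of "{0<..}"])
         (use 1 in auto)
    then show ?thesis
      using 1 pow[of s] by simp
  next
    case 2
    have "((\<lambda>s. (- s) powr p) has_real_derivative p * (- s) powr (p - 1) * (- 1)) (at s)"
      using 2 by (auto intro!: derivative_eq_intros)
    then have "((\<lambda>s. \<bar>s\<bar> powr p) has_real_derivative p * (- s) powr (p - 1) * (- 1)) (at s)"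
      by (rule has_field_derivative_transform_within_open[where S = "{..<0}"]) (use 2 in auto)
    then show ?thesis
      using 2 pow[of "- s"] by simp
  next
    case 3
    have "continuous_on UNIV (\<lambda>h :: real. \<bar>h\<bar> powr (p - 2) * h)"
      using assms by (intro continuous_on_abs_powr) simp
    then have "isCont (\<lambda>h :: real. \<bar>h\<bar> powr (p - 2) * h) 0"
      by (simp add: continuous_on_eq_continuous_at)
    then have "(\<lambda>h :: real. \<bar>h\<bar> powr (p - 2) * h) \<midarrow>0\<rightarrow> \<bar>0\<bar> powr (p - 2) * 0"
      unfolding isCont_def .
    moreover have "\<bar>h\<bar> powr (p - 2) * h = \<bar>h\<bar> powr p / h" for h :: real
    proof (cases "h = 0")
      case False
      have "\<bar>h\<bar> powr p = \<bar>h\<bar> powr (p - 2) * h\<^sup>2"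
        using False powr_add[of "\<bar>h\<bar>" "p - 2" 2] by (simp add: powr_numeral)
      then show ?thesis
        using False by (simp add: power2_eq_square)
    qed simp
    ultimately show ?thesis
      using 3 assms by (simp add: DERIV_def)
  qed
qed

section \<open>Rules for the Euler derivative\<close>

lemma euler_add:
  assumes "f differentiable (at x)" "g differentiable (at x)"
  shows "euler (\<lambda>x. f x + g x) x = euler f x + euler g x"
  using assms by (simp add: euler_def partial_add distrib_left sum.distrib)

lemma euler_mult:
  assumes "f differentiable (at x)" "g differentiable (at x)"
  shows "euler (\<lambda>x. f x * g x) x = euler f x * g x + f x * euler g x"
  using assms by (simp add: euler_def partial_mult distrib_left sum.distrib sum_distrib_left sum_distrib_right mult_ac)

lemma euler_cmult:
  assumes "f differentiable (at x)"
  shows "euler (\<lambda>x. c * f x) x = c * euler f x"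
  using assms by (simp add: euler_def partial_cmult sum_distrib_left mult_ac)

lemma euler_chain:
  assumes "f differentiable (at x)" "(\<phi> has_real_derivative d) (at (f x))"
  shows "euler (\<lambda>x. \<phi> (f x)) x = d * euler f x"
  by (simp add: euler_def partial_chain[OF assms] sum_distrib_left mult_ac)

lemma euler_rho_powr:
  assumes "rho x > 0"
  shows "euler (\<lambda>x. rho x powr a) x = - a * (rho x powr (a - 1) * (norm x)\<^sup>2)"
  using assms by (simp add: euler_def partial_rho_powr sum_distrib_left mult_ac flip: sum_component_sq)

text \<open>The derivative stays continuous across sign changes of \<open>v\<close>, because
  \<open>\<bar>v x\<bar> powr (p - 2) * v x\<close> tends to \<open>0\<close> at the zeros of
  \<open>v\<close>. Order \<open>1\<close> is what \<open>integral_euler\<close> asks for.\<close>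

lemma Cb_abs_powr:
  fixes S :: "(real ^ 'n) set"
  assumes "open S" "Cb 1 S v" "p > 2"
  shows "Cb 1 S (\<lambda>x. \<bar>v x\<bar> powr p)"
proof -
  have v: "continuous_on S v" "\<And>x. x \<in> S \<Longrightarrow> v differentiable (at x)" "Cb 0 S (partial i v)" for i
    using assms(2) by simp_all
  obtain B where B: "B \<ge> 0" "\<And>x. x \<in> S \<Longrightarrow> \<bar>v x\<bar> \<le> B"
    using Cb_bound[OF assms(2)] by blast
  have pow: "\<bar>\<bar>v x\<bar> powr a\<bar> \<le> B powr a" if "a > 0" "x \<in> S" for a x
    using B that by (simp add: powr_mono2)
  have c: "continuous_on S (\<lambda>x. \<bar>v x\<bar> powr a)" if "a > 0" for a
    using v(1) that by (intro continuous_on_powr' continuous_intros) auto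
  have bd: "Cb 0 S (\<lambda>x. \<bar>v x\<bar> powr a)" if "a > 0" for a
    using pow[OF that] c[OF that] by (auto simp: bounded_iff)
  have "Cb 0 S (partial i (\<lambda>x. \<bar>v x\<bar> powr p))" for i
  proof (rule Cb_cong[OF assms(1)])
    have "Cb 0 S v"
      using assms(2) by simp
    then show "Cb 0 S (\<lambda>x. p * (\<bar>v x\<bar> powr (p - 2) * v x) * partial i v x)"
      using assms(3) by (intro Cb_mult Cb_cmult assms(1) bd v(3)) auto
    show "p * (\<bar>v x\<bar> powr (p - 2) * v x) * partial i v x = partial i (\<lambda>x. \<bar>v x\<bar> powr p) x" if "x \<in> S" for x
      using partial_chain(1)[OF v(2)[OF that] DERIV_abs_powr[OF assms(3)]] by simp
  qed
  moreover have "(\<lambda>x. \<bar>v x\<bar> powr p) differentiable (at x)" if "x \<in> S" for x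
    by (rule partial_chain(2)[OF v(2)[OF that] DERIV_abs_powr[OF assms(3)]])
  ultimately show ?thesis
    using bd[of p] assms(3) by simp
qed

lemma integral_zero_ext_pos:
  fixes S :: "(real ^ 'n) set"
  assumes "open S" "bounded S" "Cb 0 S w" "\<And>x. x \<in> S \<Longrightarrow> w x \<ge> 0" "x \<in> S" "w x > 0"
  shows "(\<integral>x. zero_ext S w x \<partial>lborel) > 0"
proof -
  have "isCont w x"
    using assms(1,3,5) by (simp add: continuous_on_eq_continuous_at)
  then have "(w \<longlongrightarrow> w x) (nhds x)"
    using isCont_def tendsto_nhds_iff by blast
  then have "\<forall>\<^sub>F y in nhds x. w x / 2 < w y"
    using assms(6) by (intro order_tendstoD) auto
  moreover have "\<forall>\<^sub>F y in nhds x. y \<in> S"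
    using assms(1,5) by (rule eventually_nhds_in_open)
  ultimately have "\<forall>\<^sub>F y in nhds x. y \<in> S \<and> w x / 2 < w y"
    by eventually_elim simp
  then obtain d where d: "d > 0" "\<And>y. dist y x < d \<Longrightarrow> y \<in> S \<and> w x / 2 < w y"
    unfolding eventually_nhds_metric by blast
  have "0 < w x / 2 * measure lborel (ball x d)"
    using assms(6) content_ball_pos[OF d(1), of x] by simp
  also have "\<dots> = (\<integral>y. w x / 2 * indicator (ball x d) y \<partial>lborel)"
    by simp
  also have "\<dots> \<le> (\<integral>y. zero_ext S w y \<partial>lborel)"
  proof (rule integral_mono)
    show "integrable lborel (\<lambda>y. w x / 2 * indicator (ball x d) y)"
      using emeasure_bounded_finite[of "ball x d"] by (intro integrable_mult_right integrable_real_indicator) auto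
    show "integrable lborel (zero_ext S w)"
      by (rule Cb_zero_ext_integrable[OF assms(1-3)])
    show "w x / 2 * indicator (ball x d) y \<le> zero_ext S w y" for y
      using d(2)[of y] assms(4)[of y] by (auto simp: zero_ext_def indicator_def dist_commute)
  qed
  finally show ?thesis .
qed

context star_shaped_domain
begin

text \<open>The integral of \<open>euler v x * h x\<close> is evaluated twice:
  \<open>pohozaev\<close> bounds it above, while \<open>integral_euler\<close> applied to the
  potential \<open>G\<close> computes it exactly.\<close>

lemma solution_trivial:
  fixes k :: nat and q lam :: real
  assumes k: "2 \<le> k" "real k < real CARD('n) / 2"
    and q: "q = 2 * real CARD('n) / (real CARD('n) - 2 * real k)" and lam: "lam < 0"
    and u: "Cb (2 * k) \<Omega> u"
    and eq: "\<And>x. x \<in> \<Omega> \<Longrightarrow> gjms k u x - lam * u x = \<bar>u x\<bar> powr (q - 2) * u x"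
    and bc: "\<And>\<alpha> :: 'n list. length \<alpha> \<le> k - 1 \<Longrightarrow>
         \<forall>x\<in>frontier \<Omega>. (foldr hyp_partial \<alpha> u \<longlongrightarrow> 0) (at x within \<Omega>)"
    and x0: "x0 \<in> \<Omega>"
  shows "u x0 = 0"
proof (rule ccontr)
  assume ux0: "u x0 \<noteq> 0"
  let ?n = "real CARD('n)"
  note pos = hyp.rho_pos and Cb_powr = hyp.Cb_powr
  have n2k: "?n - 2 * real k > 0"
    using k by simp
  have q2: "q - 2 = 4 * real k / (?n - 2 * real k)"
    using n2k by (simp add: q field_simps)
  have q_gt: "q > 2"
  proof -
    have "q - 2 > 0"
      unfolding q2 using n2k k(1) by simp
    then show ?thesis
      by simp
  qed
  \<comment> \<open>Criticality of \<open>q\<close>: the factor \<open>n / q\<close> from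
    \<open>integral_euler\<close> agrees with the factor from \<open>pohozaev\<close>.\<close>
  have nq: "?n / q = (?n - 2 * real k) / 2"
    using n2k k by (simp add: q)
  define s where "s = real k - ?n / 2"
  define v where "v x = rho x powr s * u x" for x
  define h where "h x = (- 1) ^ k * (lap ^^ k) v x" for x
  define \<Phi> where "\<Phi> x = rho x powr (- 2 * real k)" for x :: "real ^ 'n"
  define W where "W x = \<Phi> x * (v x * v x)" for x
  define N where "N x = \<bar>v x\<bar> powr q" for x
  \<comment> \<open>Up to the factor \<open>2 * k\<close>, this is \<open>v\<^sup>2\<close> times
    the Euler derivative of the weight \<open>\<Phi>\<close>.\<close>
  define Y where "Y x = rho x powr (- 2 * real k - 1) * (norm x)\<^sup>2 * (v x * v x)" for x
  \<comment> \<open>A potential of the right-hand side: with \<open>x\<close> frozen, its derivative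
    in the value of \<open>v\<close> is \<open>h\<close>. The dependence of \<open>\<Phi>\<close> on
    \<open>x\<close> is what puts \<open>Y\<close> into \<open>euler_G\<close>.\<close>
  define G where "G x = lam / 2 * W x + 1 / q * N x" for x
  have uk: "Cb k \<Omega> u"
    by (rule Cb_mono[OF u]) simp
  have v: "Cb (2 * k) \<Omega> v" and vk: "Cb k \<Omega> v"
    unfolding v_def by (intro Cb_mult Cb_powr \<Omega>_open u uk)+
  have v1: "Cb 1 \<Omega> v"
    by (rule Cb_mono[OF vk]) (use k in simp)
  have v0: "Cb 0 \<Omega> v"
    using v1 by simp
  have vd: "v differentiable (at x)" if "x \<in> \<Omega>" for x
    using v1 that by simp
  have "vanishing k \<Omega> u"
  proof (rule vanishing_from_hyp_partial[OF \<Omega>_open, of "\<lambda>x. rho x powr (- 1)"])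
    show "Cb l \<Omega> (\<lambda>x. rho x powr (- 1))" for l
      by (rule Cb_powr)
    show "rho x powr (- 1) * ((1 - (norm x)\<^sup>2) / 2) = 1" if "x \<in> \<Omega>" for x
      using pos[OF that] by (simp add: powr_minus flip: rho_def)
    show "Cb l \<Omega> (\<lambda>x. (1 - (norm x)\<^sup>2) / 2)" for l
      using Cb_rho[OF \<Omega>_open reg.S_bounded] by (simp only: rho_def[abs_def])
  qed (use uk bc k in auto)
  then have vv: "vanishing k \<Omega> v"
    unfolding v_def by (rule vanishing_mult[OF \<Omega>_open Cb_powr uk])
  have vv1: "vanishing 1 \<Omega> v"
    using vv k(1) by (cases k) auto
  have h_eq: "h x = lam * \<Phi> x * v x + \<bar>v x\<bar> powr (q - 2) * v x" if x: "x \<in> \<Omega>" for x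
  proof -
    note r = pos[OF x]
    have "h x = (- 1) ^ k * ((- 1) ^ k * rho x powr (- real k - ?n / 2) * gjms k u x)"
      unfolding h_def v_def[abs_def] s_def using hyp.gjms_conformal[OF u x] by simp
    also have "\<dots> = rho x powr (- real k - ?n / 2) * (lam * u x + \<bar>u x\<bar> powr (q - 2) * u x)"
      using eq[OF x] by (simp flip: power_mult_distrib mult.assoc)
    also have "\<dots> = lam * (rho x powr (- real k - ?n / 2) * u x) +
        \<bar>u x\<bar> powr (q - 2) * (rho x powr (- real k - ?n / 2) * u x)"
      by (simp add: algebra_simps)
    also have "rho x powr (- real k - ?n / 2) * u x = \<Phi> x * v x"
      by (simp add: \<Phi>_def v_def s_def flip: powr_add mult.assoc)
    also have "\<bar>u x\<bar> powr (q - 2) * (\<Phi> x * v x) = \<bar>v x\<bar> powr (q - 2) * v x"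
    proof -
      have "\<bar>v x\<bar> powr (q - 2) = (rho x powr s) powr (q - 2) * \<bar>u x\<bar> powr (q - 2)"
        by (simp add: v_def abs_mult powr_mult)
      also have "(rho x powr s) powr (q - 2) = \<Phi> x"
      proof -
        have "s * (q - 2) = - 2 * real k"
          unfolding q2 s_def using n2k by (simp add: field_simps)
        then show ?thesis
          by (simp add: powr_powr \<Phi>_def)
      qed
      finally show ?thesis
        by simp
    qed
    finally show ?thesis
      by (simp add: mult.assoc)
  qed
  have W1: "Cb 1 \<Omega> W" and W0: "Cb 0 \<Omega> W"
    unfolding W_def \<Phi>_def by (intro Cb_mult Cb_powr \<Omega>_open v1 v0)+
  have N1: "Cb 1 \<Omega> N"
    unfolding N_def by (rule Cb_abs_powr[OF \<Omega>_open v1 q_gt])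
  have N0: "Cb 0 \<Omega> N"
    using N1 by simp
  have Y0: "Cb 0 \<Omega> Y"
  proof -
    have "Cb 0 \<Omega> (\<lambda>x. \<Sum>i\<in>UNIV. x $ i * x $ i)"
      by (intro Cb_sum Cb_mult Cb_component \<Omega>_open reg.S_bounded)
    then show ?thesis
      unfolding Y_def sum_component_sq by (intro Cb_mult Cb_powr \<Omega>_open v0)
  qed
  have G1: "Cb 1 \<Omega> G"
    unfolding G_def by (intro Cb_add Cb_cmult \<Omega>_open W1 N1)
  have vG: "vanishing 1 \<Omega> G"
  proof -
    have "(G \<longlongrightarrow> 0) (at x within \<Omega>)" if x: "x \<in> frontier \<Omega>" for x
    proof -
      have lim: "(v \<longlongrightarrow> 0) (at x within \<Omega>)"
        using vv1 x by simp
      have "vanishing 1 \<Omega> W"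
        unfolding W_def \<Phi>_def
        by (intro vanishing_mult[OF \<Omega>_open] Cb_powr Cb_mult \<Omega>_open v1 vv1)
      then have "(W \<longlongrightarrow> 0) (at x within \<Omega>)"
        using x by simp
      moreover have "isCont (\<lambda>s. \<bar>s\<bar> powr q) (0 :: real)"
        by (rule DERIV_isCont[OF DERIV_abs_powr[OF q_gt]])
      then have "((\<lambda>x. \<bar>v x\<bar> powr q) \<longlongrightarrow> \<bar>0\<bar> powr q) (at x within \<Omega>)"
        by (rule isCont_tendsto_compose[OF _ lim])
      ultimately have "((\<lambda>x. lam / 2 * W x + 1 / q * N x) \<longlongrightarrow> lam / 2 * 0 + 1 / q * 0) (at x within \<Omega>)"
        unfolding N_def by (intro tendsto_add tendsto_mult tendsto_const) simp_all
      then show ?thesis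
        by (simp add: G_def[abs_def])
    qed
    then show ?thesis
      by simp
  qed
  have euler_G: "euler G x = euler v x * h x + lam * real k * Y x" if x: "x \<in> \<Omega>" for x
  proof -
    note r = pos[OF x] and d = vd[OF x]
    have dW: "W differentiable (at x)" and dN: "N differentiable (at x)"
      using W1 N1 x by simp_all
    have d\<Phi>: "\<Phi> differentiable (at x)"
      unfolding \<Phi>_def[abs_def] by (rule partial_rho_powr(2)[OF r])
    have "euler G x = lam / 2 * euler W x + 1 / q * euler N x"
    proof -
      have "(\<lambda>x. lam / 2 * W x) differentiable (at x)" "(\<lambda>x. 1 / q * N x) differentiable (at x)"
        by (rule differentiable_mult[OF differentiable_const dW], rule differentiable_mult[OF differentiable_const dN])
      then show ?thesis
        unfolding G_def[abs_def] by (simp only: euler_add euler_cmult[OF dW] euler_cmult[OF dN])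
    qed
    also have "euler N x = q * (\<bar>v x\<bar> powr (q - 2) * v x) * euler v x"
      unfolding N_def[abs_def] by (rule euler_chain[OF d DERIV_abs_powr[OF q_gt]])
    also have "euler W x = euler \<Phi> x * (v x * v x) + \<Phi> x * (2 * v x * euler v x)"
      unfolding W_def[abs_def] using d d\<Phi> by (simp add: euler_mult)
    also have "euler \<Phi> x = 2 * real k * (rho x powr (- 2 * real k - 1) * (norm x)\<^sup>2)"
      unfolding \<Phi>_def[abs_def] euler_rho_powr[OF r] by simp
    finally show ?thesis
      using q_gt unfolding h_eq[OF x] Y_def by (simp add: field_simps)
  qed
  define IW IN IY where "IW = (\<integral>x. zero_ext \<Omega> W x \<partial>lborel)" and "IN = (\<integral>x. zero_ext \<Omega> N x \<partial>lborel)"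
    and "IY = (\<integral>x. zero_ext \<Omega> Y x \<partial>lborel)"
  note int = Cb_zero_ext_integrable[OF \<Omega>_open reg.S_bounded]
  have lin: "(\<integral>x. zero_ext \<Omega> (\<lambda>x. a * f x + b * g x) x \<partial>lborel) =
      a * (\<integral>x. zero_ext \<Omega> f x \<partial>lborel) + b * (\<integral>x. zero_ext \<Omega> g x \<partial>lborel)"
    if "Cb 0 \<Omega> f" "Cb 0 \<Omega> g" for a b f g
  proof -
    have "(\<integral>x. zero_ext \<Omega> (\<lambda>x. a * f x + b * g x) x \<partial>lborel) = (\<integral>x. a * zero_ext \<Omega> f x + b * zero_ext \<Omega> g x \<partial>lborel)"
      by (intro Bochner_Integration.integral_cong refl) (simp add: zero_ext_def)
    then show ?thesis
      using int[OF that(1)] int[OF that(2)] by simp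
  qed
  have h0: "Cb 0 \<Omega> h"
  proof (rule Cb_cong[OF \<Omega>_open])
    show "Cb 0 \<Omega> (\<lambda>x. (- 1) ^ k * (lap ^^ k) v x)"
      using v by (intro Cb_cmult \<Omega>_open Cb_lap_iter) simp
  qed (simp add: h_def)
  have Ev0: "Cb 0 \<Omega> (\<lambda>x. euler v x * h x)"
    using v1 by (intro Cb_mult Cb_euler \<Omega>_open reg.S_bounded h0) simp
  have P: "(\<integral>x. zero_ext \<Omega> (\<lambda>x. euler v x * h x) x \<partial>lborel) \<le>
      (2 * real k - ?n) / 2 * (\<integral>x. zero_ext \<Omega> (\<lambda>x. v x * h x) x \<partial>lborel)"
    using reg.pohozaev[of k v h] k(1) v vv by (simp add: h_def)
  have "(\<integral>x. zero_ext \<Omega> (\<lambda>x. v x * h x) x \<partial>lborel) = (\<integral>x. zero_ext \<Omega> (\<lambda>x. lam * W x + 1 * N x) x \<partial>lborel)"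
  proof (rule integral_zero_ext_cong)
    fix x assume x: "x \<in> \<Omega>"
    have "N x = \<bar>v x\<bar> powr (q - 2) * (v x * v x)"
      using powr_add[of "\<bar>v x\<bar>" "q - 2" 2] by (simp add: N_def powr_numeral power2_eq_square split: if_splits)
    then show "v x * h x = lam * W x + 1 * N x"
      by (simp add: h_eq[OF x] W_def algebra_simps)
  qed
  then have vh: "(\<integral>x. zero_ext \<Omega> (\<lambda>x. v x * h x) x \<partial>lborel) = lam * IW + IN"
    using lin[OF W0 N0, of lam 1] by (simp add: IW_def IN_def)
  have "(\<integral>x. zero_ext \<Omega> (euler G) x \<partial>lborel) = (\<integral>x. zero_ext \<Omega> (\<lambda>x. 1 * (euler v x * h x) + (lam * real k) * Y x) x \<partial>lborel)"
    by (rule integral_zero_ext_cong) (simp add: euler_G)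
  then have EG: "(\<integral>x. zero_ext \<Omega> (euler G) x \<partial>lborel) =
      (\<integral>x. zero_ext \<Omega> (\<lambda>x. euler v x * h x) x \<partial>lborel) + lam * real k * IY"
    using lin[OF Ev0 Y0, of 1 "lam * real k"] by (simp add: IY_def)
  have "(\<integral>x. zero_ext \<Omega> (euler G) x \<partial>lborel) = - ?n * (\<integral>x. zero_ext \<Omega> G x \<partial>lborel)"
    by (rule reg.integral_euler[OF G1 vG])
  also have "(\<integral>x. zero_ext \<Omega> G x \<partial>lborel) = lam / 2 * IW + 1 / q * IN"
    unfolding G_def[abs_def] lin[OF W0 N0] IW_def IN_def ..
  finally have "(\<integral>x. zero_ext \<Omega> (\<lambda>x. euler v x * h x) x \<partial>lborel) = - ?n * lam / 2 * IW - (?n / q) * IN - lam * real k * IY"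
    using EG by (simp add: algebra_simps)
  then have "- ?n * lam / 2 * IW - (?n - 2 * real k) / 2 * IN - lam * real k * IY \<le> (2 * real k - ?n) / 2 * (lam * IW + IN)"
    using P unfolding vh nq by simp
  \<comment> \<open>The multiples of \<open>IN\<close> agree on both sides. For \<open>IW\<close>
    the coefficients of \<open>lam\<close> combine to
    \<open>- n / 2 + (n - 2 * k) / 2 = - k\<close>, the same as for \<open>IY\<close>.\<close>
  then have "- lam * (real k * (IW + IY)) \<le> 0"
    by (simp add: field_simps)
  then have "real k * (IW + IY) \<le> 0"
    using lam zero_le_mult_iff[of lam "real k * (IW + IY)"] by linarith
  then have le: "IW + IY \<le> 0"
    using k(1) mult_le_0_iff[of "real k" "IW + IY"] by linarith
  have "IY \<ge> 0"
    unfolding IY_def by (rule integral_nonneg_AE) (simp add: zero_ext_def Y_def)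
  moreover have "IW > 0"
    unfolding IW_def
  proof (rule integral_zero_ext_pos[OF \<Omega>_open reg.S_bounded W0 _ x0])
    show "W x \<ge> 0" for x
      by (simp add: W_def \<Phi>_def)
    have "\<Phi> x0 > 0" "v x0 \<noteq> 0"
      using ux0 pos[OF x0] by (simp_all add: \<Phi>_def v_def)
    then show "W x0 > 0"
      unfolding W_def power2_eq_square[symmetric] by simp
  qed
  ultimately show False
    using le by simp
qed

end

theorem theorem1p13:
  fixes k :: nat and q lam :: real and \<Omega> :: "(real ^ 'n) set"
  assumes "2 \<le> k" and "real k < real CARD('n) / 2"
    and "q = 2 * real CARD('n) / (real CARD('n) - 2 * real k)"
    and "\<Omega> \<subseteq> ball 0 1" and "open \<Omega>" and "connected \<Omega>" and "\<Omega> \<noteq> {}"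
    and "hyp_bounded \<Omega>" and "C1_boundary \<Omega>" and "star_shaped \<Omega>"
    and "lam < 0"
  shows "\<not> (\<exists>u :: real ^ 'n \<Rightarrow> real.
      Cm_closure (2 * k) \<Omega> u \<and>
      (\<forall>x\<in>\<Omega>. gjms k u x - lam * u x = \<bar>u x\<bar> powr (q - 2) * u x) \<and>
      (\<forall>\<alpha> :: 'n list. length \<alpha> \<le> k - 1 \<longrightarrow>
         (\<forall>x\<in>frontier \<Omega>. (foldr hyp_partial \<alpha> u \<longlongrightarrow> 0) (at x within \<Omega>))) \<and>
      (\<exists>x\<in>closure \<Omega>. u x \<noteq> 0))"
proof
  assume "\<exists>u :: real ^ 'n \<Rightarrow> real.
      Cm_closure (2 * k) \<Omega> u \<and>
      (\<forall>x\<in>\<Omega>. gjms k u x - lam * u x = \<bar>u x\<bar> powr (q - 2) * u x) \<and>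
      (\<forall>\<alpha> :: 'n list. length \<alpha> \<le> k - 1 \<longrightarrow>
         (\<forall>x\<in>frontier \<Omega>. (foldr hyp_partial \<alpha> u \<longlongrightarrow> 0) (at x within \<Omega>))) \<and>
      (\<exists>x\<in>closure \<Omega>. u x \<noteq> 0)"
  then obtain u x1 where u: "Cm_closure (2 * k) \<Omega> u"
      "\<And>x. x \<in> \<Omega> \<Longrightarrow> gjms k u x - lam * u x = \<bar>u x\<bar> powr (q - 2) * u x"
      "\<And>\<alpha> :: 'n list. length \<alpha> \<le> k - 1 \<Longrightarrow>
         \<forall>x\<in>frontier \<Omega>. (foldr hyp_partial \<alpha> u \<longlongrightarrow> 0) (at x within \<Omega>)"
    and x1: "x1 \<in> closure \<Omega>" "u x1 \<noteq> 0"
    by blast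
  obtain r where r: "r < 1" "\<Omega> \<subseteq> cball 0 r"
    using hyp_bounded_imp_cball[OF assms(4,7,8)] by blast
  interpret star_shaped_domain \<Omega> r
    by unfold_locales (fact assms r)+
  have "Cb (2 * k) \<Omega> u"
    by (rule Cm_closure_imp_Cb[OF reg.S_bounded u(1)])
  then have "u x = 0" if "x \<in> \<Omega>" for x
    using solution_trivial[OF assms(1,2,3,11) _ u(2,3) that] by blast
  \<comment> \<open>Nontriviality is stated on the closure; continuity carries the zero from the
    open set to boundary points.\<close>
  moreover have "continuous_on (closure \<Omega>) u"
    using u(1) by (simp add: Cm_closure_def)
  ultimately have "u x1 = 0"
    using continuous_constant_on_closure[of \<Omega> u 0 x1] x1(1) by blast
  with x1(2) show False
    by contradiction
qed

end
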